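(* Let $k$ be a commutative ring, $H$ a Hopf algebra over $k$ with bijective antipode, $A$ a left $H$-module algebra and $\mathcal{C}$ an $(H,A)$-coring. There is a functor $F:{}_H\mathcal{M}^{\mathcal{C}}\to{}_H\mathcal{M}_{{}'\mathcal{C}}$, which sends a right $(H,\mathcal{C})$-comodule $M$ to $M$ with the same $H$-action and the right ${}'\mathcal{C}$-action $mf=m_0f(m_1)$ (and is the identity on underlying maps). If $\mathcal{C}$ is finitely generated and projective as a left $A$-module, then $F$ is an isomorphism of categories.
   Context: Sweedler notation with summation suppressed is used: $\Delta_H(h)=h_1\otimes h_2$, $\Delta_{\mathcal C}(c)=c_1\otimes_Ac_2$, $\rho_M(m)=m_0\otimes_Am_1$; $\epsilon_H$ and $S_H$ are the counit and antipode of $H$. A left $H$-module algebra is a $k$-algebra $A$ with a left $H$-module structure such that $h.(aa')=(h_1.a)(h_2.a')$ and $h.1_A=\epsilon_H(h)1_A$. For a left $H$-module algebra $R$, a left-right $(H,R)$-module is a left $H$-module and right $R$-module $M$ with $h(mr)=(h_1m)(h_2.r)$; ${}_H\mathcal M_R$ is the category of these with $H$-linear, right $R$-linear maps. A left $(H,A)$-bimodule is an $A$-bimodule and left $H$-module $M$ with $h(am)=(h_1.a)(h_2m)$ and $h(ma)=(h_1m)(h_2.a)$. If $M$ is a left-right $(H,A)$-module and $N$ a left $(H,A)$-bimodule, $H$ acts on $M\otimes_AN$ diagonally. An $A$-coring is a coassociative counital coalgebra $(\mathcal C,\Delta_{\mathcal C},\epsilon_{\mathcal C})$ in the monoidal category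 of $A$-bimodules; its left and right $A$-actions are denoted $\blacktriangleright$ and $\blacktriangleleft$. An $(H,A)$-coring is an $A$-coring $\mathcal C$ that is also a left $(H,A)$-bimodule (with the same $A$-bimodule structure) such that $\Delta_{\mathcal C}:\mathcal C\to\mathcal C\otimes_A\mathcal C$ and $\epsilon_{\mathcal C}:\mathcal C\to A$ are $H$-linear. A right $(H,\mathcal C)$-comodule is a right $\mathcal C$-comodule $M$ (right $A$-module with coassociative counital right $A$-linear coaction $\rho_M:M\to M\otimes_A\mathcal C$) that is also a left-right $(H,A)$-module such that $\rho_M$ is $H$-linear. ${}_H\mathcal M^{\mathcal C}$ is the category of these with right $A$-linear, $H$-linear, $\mathcal C$-colinear maps. The left dual ring ${}'\mathcal C$ is the set of left $A$-linear maps $\mathcal C\to A$ with product $(f\#g)(c)=g(c_1\blacktriangleleft f(c_2))$ and unit $\epsilon_{\mathcal C}$; it is a left $H$-module algebra via $(hf)(c)=h_2.f(S_H^{-1}(h_1).c)$. *)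

theory Defs
  imports "HOL-Algebra.Module" "HOL-Algebra.Free_Abelian_Groups"
begin

section \<open>Tensor products\<close>

text \<open>
  \<open>tensor R M ra N la\<close> is the tensor product over a ring \<open>R\<close>, not necessarily commutative, of
  a right module \<open>M\<close> with action \<open>ra\<close> and a left module \<open>N\<close> with action \<open>la\<close>: the free abelian
  group on \<open>carrier M \<times> carrier N\<close> modulo the subgroup generated by the usual relations.
  Its elements are cosets.
\<close>

type_synonym ('m, 'n) tens = "('m \<times> 'n \<Rightarrow>\<^sub>0 int) set"

definition tensor_relators ::
  "('r, 'y) ring_scheme \<Rightarrow> ('m, 'z) ring_scheme \<Rightarrow> ('m \<Rightarrow> 'r \<Rightarrow> 'm) \<Rightarrow>
   ('n, 'w) ring_scheme \<Rightarrow> ('r \<Rightarrow> 'n \<Rightarrow> 'n) \<Rightarrow> ('m \<times> 'n \<Rightarrow>\<^sub>0 int) set" where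
  "tensor_relators R M ra N la =
     {frag_of (m \<oplus>\<^bsub>M\<^esub> m', n) - frag_of (m, n) - frag_of (m', n) | m m' n.
        m \<in> carrier M \<and> m' \<in> carrier M \<and> n \<in> carrier N} \<union>
     {frag_of (m, n \<oplus>\<^bsub>N\<^esub> n') - frag_of (m, n) - frag_of (m, n') | m n n'.
        m \<in> carrier M \<and> n \<in> carrier N \<and> n' \<in> carrier N} \<union>
     {frag_of (ra m r, n) - frag_of (m, la r n) | m r n.
        m \<in> carrier M \<and> r \<in> carrier R \<and> n \<in> carrier N}"

definition tensor_null ::
  "('r, 'y) ring_scheme \<Rightarrow> ('m, 'z) ring_scheme \<Rightarrow> ('m \<Rightarrow> 'r \<Rightarrow> 'm) \<Rightarrow>
   ('n, 'w) ring_scheme \<Rightarrow> ('r \<Rightarrow> 'n \<Rightarrow> 'n) \<Rightarrow> ('m \<times> 'n \<Rightarrow>\<^sub>0 int) set" where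
  "tensor_null R M ra N la =
     generate (free_Abelian_group (carrier M \<times> carrier N)) (tensor_relators R M ra N la)"

definition pure_tensor ::
  "('r, 'y) ring_scheme \<Rightarrow> ('m, 'z) ring_scheme \<Rightarrow> ('m \<Rightarrow> 'r \<Rightarrow> 'm) \<Rightarrow>
   ('n, 'w) ring_scheme \<Rightarrow> ('r \<Rightarrow> 'n \<Rightarrow> 'n) \<Rightarrow> 'm \<Rightarrow> 'n \<Rightarrow> ('m, 'n) tens" where
  "pure_tensor R M ra N la m n =
     tensor_null R M ra N la #>\<^bsub>free_Abelian_group (carrier M \<times> carrier N)\<^esub> frag_of (m, n)"

definition tensor_group ::
  "('r, 'y) ring_scheme \<Rightarrow> ('m, 'z) ring_scheme \<Rightarrow> ('m \<Rightarrow> 'r \<Rightarrow> 'm) \<Rightarrow>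
   ('n, 'w) ring_scheme \<Rightarrow> ('r \<Rightarrow> 'n \<Rightarrow> 'n) \<Rightarrow> ('m, 'n) tens ring" where
  "tensor_group R M ra N la =
     (let Q = free_Abelian_group (carrier M \<times> carrier N) Mod tensor_null R M ra N la
      in \<lparr>carrier = carrier Q, monoid.mult = undefined, monoid.one = undefined,
          ring.zero = \<one>\<^bsub>Q\<^esub>, ring.add = (\<lambda>t u. t \<otimes>\<^bsub>Q\<^esub> u)\<rparr>)"

text \<open>
  If \<open>t = \<Sum>\<^sub>i m\<^sub>i \<otimes> n\<^sub>i\<close>, then \<open>sweedler X b t = \<Sum>\<^sub>i b m\<^sub>i n\<^sub>i\<close>, computed in the
  abelian group \<open>X\<close>.  For \<open>b\<close> biadditive and balanced this does not depend on the chosen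
  representative of \<open>t\<close>; with \<open>t = \<Delta>(h)\<close> it is Sweedler notation,
  \<open>sweedler X b (\<Delta> h) = b h\<^sub>1 h\<^sub>2\<close>.
\<close>

definition sweedler ::
  "('x, 'y) ring_scheme \<Rightarrow> ('m \<Rightarrow> 'n \<Rightarrow> 'x) \<Rightarrow> ('m, 'n) tens \<Rightarrow> 'x" where
  "sweedler X b t =
     (let z = (SOME z. z \<in> t) in
      (\<Oplus>\<^bsub>X\<^esub> p \<in> Poly_Mapping.keys z. [Poly_Mapping.lookup z p] \<cdot>\<^bsub>X\<^esub> b (fst p) (snd p)))"

definition tensor ::
  "('r, 'y) ring_scheme \<Rightarrow> ('k, 'm, 'z) module_scheme \<Rightarrow> ('m \<Rightarrow> 'r \<Rightarrow> 'm) \<Rightarrow>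
   ('n, 'w) ring_scheme \<Rightarrow> ('r \<Rightarrow> 'n \<Rightarrow> 'n) \<Rightarrow> ('k, ('m, 'n) tens) module" where
  "tensor R M ra N la =
     (let T = tensor_group R M ra N la
      in \<lparr>carrier = carrier T, monoid.mult = undefined, monoid.one = undefined,
          ring.zero = ring.zero T, ring.add = ring.add T,
          smult = (\<lambda>c. sweedler T (\<lambda>m n. pure_tensor R M ra N la (c \<odot>\<^bsub>M\<^esub> m) n))\<rparr>)"

abbreviation pure_k ::
  "('k, 'y) ring_scheme \<Rightarrow> ('k, 'm, 'z) module_scheme \<Rightarrow> ('k, 'n, 'w) module_scheme \<Rightarrow>
   'm \<Rightarrow> 'n \<Rightarrow> ('m, 'n) tens" where
  "pure_k k M N \<equiv> pure_tensor k M (\<lambda>m c. c \<odot>\<^bsub>M\<^esub> m) N (smult N)"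

abbreviation tensor_k ::
  "('k, 'y) ring_scheme \<Rightarrow> ('k, 'm, 'z) module_scheme \<Rightarrow> ('k, 'n, 'w) module_scheme \<Rightarrow>
   ('k, ('m, 'n) tens) module" where
  "tensor_k k M N \<equiv> tensor k M (\<lambda>m c. c \<odot>\<^bsub>M\<^esub> m) N (smult N)"

definition tensor_algebra ::
  "('k, 'y) ring_scheme \<Rightarrow> ('k, 'm, 'z) module_scheme \<Rightarrow> ('k, 'n, 'w) module_scheme \<Rightarrow>
   ('k, ('m, 'n) tens) module" where
  "tensor_algebra k A B =
     (let T = tensor_k k A B in
      T \<lparr>monoid.mult :=
           (\<lambda>t u. sweedler T (\<lambda>a b. sweedler T
              (\<lambda>a' b'. pure_k k A B (a \<otimes>\<^bsub>A\<^esub> a') (b \<otimes>\<^bsub>B\<^esub> b')) u) t),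
         monoid.one := pure_k k A B \<one>\<^bsub>A\<^esub> \<one>\<^bsub>B\<^esub>\<rparr>)"


section \<open>Linear maps and algebras\<close>

definition left_linear ::
  "('r, 'y) ring_scheme \<Rightarrow> ('m, 'z) ring_scheme \<Rightarrow> ('r \<Rightarrow> 'm \<Rightarrow> 'm) \<Rightarrow>
   ('n, 'w) ring_scheme \<Rightarrow> ('r \<Rightarrow> 'n \<Rightarrow> 'n) \<Rightarrow> ('m \<Rightarrow> 'n) \<Rightarrow> bool" where
  "left_linear R M la N lb f \<longleftrightarrow>
     f \<in> carrier M \<rightarrow> carrier N \<and>
     (\<forall>x\<in>carrier M. \<forall>y\<in>carrier M. f (x \<oplus>\<^bsub>M\<^esub> y) = f x \<oplus>\<^bsub>N\<^esub> f y) \<and>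
     (\<forall>r\<in>carrier R. \<forall>x\<in>carrier M. f (la r x) = lb r (f x))"

definition right_linear ::
  "('r, 'y) ring_scheme \<Rightarrow> ('m, 'z) ring_scheme \<Rightarrow> ('m \<Rightarrow> 'r \<Rightarrow> 'm) \<Rightarrow>
   ('n, 'w) ring_scheme \<Rightarrow> ('n \<Rightarrow> 'r \<Rightarrow> 'n) \<Rightarrow> ('m \<Rightarrow> 'n) \<Rightarrow> bool" where
  "right_linear R M ra N rb f \<longleftrightarrow>
     f \<in> carrier M \<rightarrow> carrier N \<and>
     (\<forall>x\<in>carrier M. \<forall>y\<in>carrier M. f (x \<oplus>\<^bsub>M\<^esub> y) = f x \<oplus>\<^bsub>N\<^esub> f y) \<and>
     (\<forall>r\<in>carrier R. \<forall>x\<in>carrier M. f (ra x r) = rb (f x) r)"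

text \<open>Not the library locale \<open>algebra\<close>, which requires commutativity.\<close>

locale k_algebra = module k A + ring A for k and A (structure) +
  assumes smult_mult_left:
    "\<lbrakk>c \<in> carrier k; a \<in> carrier A; b \<in> carrier A\<rbrakk> \<Longrightarrow> c \<odot> (a \<otimes> b) = (c \<odot> a) \<otimes> b"
  and smult_mult_right:
    "\<lbrakk>c \<in> carrier k; a \<in> carrier A; b \<in> carrier A\<rbrakk> \<Longrightarrow> c \<odot> (a \<otimes> b) = a \<otimes> (c \<odot> b)"


section \<open>Hopf algebras and their modules\<close>

record ('k, 'h) hopf = "('k, 'h) module" +
  Delta_H :: "'h \<Rightarrow> ('h, 'h) tens"
  eps_H :: "'h \<Rightarrow> 'k"
  S_H :: "'h \<Rightarrow> 'h"

text \<open>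
  In coassociativity \<open>(H \<otimes> H) \<otimes> H\<close> is identified with \<open>H \<otimes> (H \<otimes> H)\<close>:
  \<open>h\<^sub>1\<^sub>1 \<otimes> (h\<^sub>1\<^sub>2 \<otimes> h\<^sub>2) = h\<^sub>1 \<otimes> \<Delta>(h\<^sub>2)\<close>.
\<close>

locale hopf_algebra = k_algebra k H
  for k :: "('k, 'y) ring_scheme" and H :: "('k, 'h) hopf" (structure) +
  assumes Delta_ring_hom: "Delta_H H \<in> ring_hom H (tensor_algebra k H H)"
  and Delta_linear: "left_linear k H (smult H) (tensor_k k H H) (smult (tensor_k k H H)) (Delta_H H)"
  and eps_ring_hom: "eps_H H \<in> ring_hom H k"
  and eps_linear: "left_linear k H (smult H) k (monoid.mult k) (eps_H H)"
  and coassoc: "h \<in> carrier H \<Longrightarrow>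
    sweedler (tensor_k k H (tensor_k k H H))
      (\<lambda>h1 h2. sweedler (tensor_k k H (tensor_k k H H))
         (\<lambda>h11 h12. pure_k k H (tensor_k k H H) h11 (pure_k k H H h12 h2)) (Delta_H H h1))
      (Delta_H H h) =
    sweedler (tensor_k k H (tensor_k k H H))
      (\<lambda>h1 h2. pure_k k H (tensor_k k H H) h1 (Delta_H H h2)) (Delta_H H h)"
  and counit_left: "h \<in> carrier H \<Longrightarrow>
    sweedler H (\<lambda>h1 h2. eps_H H h1 \<odot> h2) (Delta_H H h) = h"
  and counit_right: "h \<in> carrier H \<Longrightarrow>
    sweedler H (\<lambda>h1 h2. eps_H H h2 \<odot> h1) (Delta_H H h) = h"
  and antipode_linear: "left_linear k H (smult H) H (smult H) (S_H H)"
  and antipode_left: "h \<in> carrier H \<Longrightarrow>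
    sweedler H (\<lambda>h1 h2. S_H H h1 \<otimes> h2) (Delta_H H h) = eps_H H h \<odot> \<one>"
  and antipode_right: "h \<in> carrier H \<Longrightarrow>
    sweedler H (\<lambda>h1 h2. h1 \<otimes> S_H H h2) (Delta_H H h) = eps_H H h \<odot> \<one>"

abbreviation S_H_inv :: "('k, 'h) hopf \<Rightarrow> 'h \<Rightarrow> 'h" where
  "S_H_inv H \<equiv> inv_into (carrier H) (S_H H)"

record ('k, 'h, 'm) hmod = "('k, 'm) module" +
  hact :: "'h \<Rightarrow> 'm \<Rightarrow> 'm"

locale h_module = module k M
  for k :: "('k, 'y) ring_scheme" and H :: "('k, 'h) hopf"
    and M :: "('k, 'h, 'm, 'z) hmod_scheme" (structure) +
  assumes hact_closed: "\<lbrakk>h \<in> carrier H; x \<in> carrier M\<rbrakk> \<Longrightarrow> hact M h x \<in> carrier M"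
  and hact_add_left: "\<lbrakk>g \<in> carrier H; h \<in> carrier H; x \<in> carrier M\<rbrakk> \<Longrightarrow>
    hact M (g \<oplus>\<^bsub>H\<^esub> h) x = hact M g x \<oplus> hact M h x"
  and hact_add_right: "\<lbrakk>h \<in> carrier H; x \<in> carrier M; y \<in> carrier M\<rbrakk> \<Longrightarrow>
    hact M h (x \<oplus> y) = hact M h x \<oplus> hact M h y"
  and hact_smult_left: "\<lbrakk>c \<in> carrier k; h \<in> carrier H; x \<in> carrier M\<rbrakk> \<Longrightarrow>
    hact M (c \<odot>\<^bsub>H\<^esub> h) x = c \<odot> hact M h x"
  and hact_smult_right: "\<lbrakk>c \<in> carrier k; h \<in> carrier H; x \<in> carrier M\<rbrakk> \<Longrightarrow>
    hact M h (c \<odot> x) = c \<odot> hact M h x"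
  and hact_one: "x \<in> carrier M \<Longrightarrow> hact M \<one>\<^bsub>H\<^esub> x = x"
  and hact_mult: "\<lbrakk>g \<in> carrier H; h \<in> carrier H; x \<in> carrier M\<rbrakk> \<Longrightarrow>
    hact M (g \<otimes>\<^bsub>H\<^esub> h) x = hact M g (hact M h x)"

definition h_linear ::
  "('k, 'h) hopf \<Rightarrow> ('k, 'h, 'm, 'z) hmod_scheme \<Rightarrow> ('k, 'h, 'n, 'w) hmod_scheme \<Rightarrow>
   ('m \<Rightarrow> 'n) \<Rightarrow> bool" where
  "h_linear H M N f \<longleftrightarrow> left_linear H M (hact M) N (hact N) f"

locale h_module_algebra = k_algebra k A + h_module k H A
  for k :: "('k, 'y) ring_scheme" and H :: "('k, 'h) hopf"
    and A :: "('k, 'h, 'a, 'z) hmod_scheme" (structure) +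
  assumes hact_prod: "\<lbrakk>h \<in> carrier H; a \<in> carrier A; b \<in> carrier A\<rbrakk> \<Longrightarrow>
    hact A h (a \<otimes> b) = sweedler A (\<lambda>h1 h2. hact A h1 a \<otimes> hact A h2 b) (Delta_H H h)"
  and hact_unit: "h \<in> carrier H \<Longrightarrow> hact A h \<one> = eps_H H h \<odot> \<one>"

record ('k, 'h, 'r, 'm) hrmod = "('k, 'h, 'm) hmod" +
  ract :: "'m \<Rightarrow> 'r \<Rightarrow> 'm"

record ('k, 'h, 'r, 'm) hbimod = "('k, 'h, 'r, 'm) hrmod" +
  lact :: "'r \<Rightarrow> 'm \<Rightarrow> 'm"

locale right_module = module k M
  for k :: "('k, 'y) ring_scheme" and R :: "('k, 'r, 'x) module_scheme"
    and M :: "('k, 'h, 'r, 'm, 'z) hrmod_scheme" (structure) +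
  assumes ract_closed: "\<lbrakk>x \<in> carrier M; r \<in> carrier R\<rbrakk> \<Longrightarrow> ract M x r \<in> carrier M"
  and ract_add_left: "\<lbrakk>x \<in> carrier M; y \<in> carrier M; r \<in> carrier R\<rbrakk> \<Longrightarrow>
    ract M (x \<oplus> y) r = ract M x r \<oplus> ract M y r"
  and ract_add_right: "\<lbrakk>x \<in> carrier M; r \<in> carrier R; s \<in> carrier R\<rbrakk> \<Longrightarrow>
    ract M x (r \<oplus>\<^bsub>R\<^esub> s) = ract M x r \<oplus> ract M x s"
  and ract_smult_left: "\<lbrakk>c \<in> carrier k; x \<in> carrier M; r \<in> carrier R\<rbrakk> \<Longrightarrow>
    ract M (c \<odot> x) r = c \<odot> ract M x r"
  and ract_smult_right: "\<lbrakk>c \<in> carrier k; x \<in> carrier M; r \<in> carrier R\<rbrakk> \<Longrightarrow>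
    ract M x (c \<odot>\<^bsub>R\<^esub> r) = c \<odot> ract M x r"
  and ract_one: "x \<in> carrier M \<Longrightarrow> ract M x \<one>\<^bsub>R\<^esub> = x"
  and ract_mult: "\<lbrakk>x \<in> carrier M; r \<in> carrier R; s \<in> carrier R\<rbrakk> \<Longrightarrow>
    ract M x (r \<otimes>\<^bsub>R\<^esub> s) = ract M (ract M x r) s"

locale left_module = module k M
  for k :: "('k, 'y) ring_scheme" and R :: "('k, 'r, 'x) module_scheme"
    and M :: "('k, 'h, 'r, 'm, 'z) hbimod_scheme" (structure) +
  assumes lact_closed: "\<lbrakk>x \<in> carrier M; r \<in> carrier R\<rbrakk> \<Longrightarrow> lact M r x \<in> carrier M"
  and lact_add_right: "\<lbrakk>x \<in> carrier M; y \<in> carrier M; r \<in> carrier R\<rbrakk> \<Longrightarrow>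
    lact M r (x \<oplus> y) = lact M r x \<oplus> lact M r y"
  and lact_add_left: "\<lbrakk>x \<in> carrier M; r \<in> carrier R; s \<in> carrier R\<rbrakk> \<Longrightarrow>
    lact M (r \<oplus>\<^bsub>R\<^esub> s) x = lact M r x \<oplus> lact M s x"
  and lact_smult_right: "\<lbrakk>c \<in> carrier k; x \<in> carrier M; r \<in> carrier R\<rbrakk> \<Longrightarrow>
    lact M r (c \<odot> x) = c \<odot> lact M r x"
  and lact_smult_left: "\<lbrakk>c \<in> carrier k; x \<in> carrier M; r \<in> carrier R\<rbrakk> \<Longrightarrow>
    lact M (c \<odot>\<^bsub>R\<^esub> r) x = c \<odot> lact M r x"
  and lact_one: "x \<in> carrier M \<Longrightarrow> lact M \<one>\<^bsub>R\<^esub> x = x"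
  and lact_mult: "\<lbrakk>x \<in> carrier M; r \<in> carrier R; s \<in> carrier R\<rbrakk> \<Longrightarrow>
    lact M (r \<otimes>\<^bsub>R\<^esub> s) x = lact M r (lact M s x)"

locale bimodule = left_module k R M + right_module k R M
  for k :: "('k, 'y) ring_scheme" and R :: "('k, 'r, 'x) module_scheme"
    and M :: "('k, 'h, 'r, 'm, 'z) hbimod_scheme" (structure) +
  assumes lact_ract: "\<lbrakk>r \<in> carrier R; x \<in> carrier M; s \<in> carrier R\<rbrakk> \<Longrightarrow>
    ract M (lact M r x) s = lact M r (ract M x s)"

text \<open>Left-right \<open>(H,R)\<close>-modules, for a left \<open>H\<close>-module algebra \<open>R\<close>.\<close>

locale hr_module = h_module k H M + right_module k R M
  for k :: "('k, 'y) ring_scheme" and H :: "('k, 'h) hopf"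
    and R :: "('k, 'h, 'r, 'x) hmod_scheme"
    and M :: "('k, 'h, 'r, 'm, 'z) hrmod_scheme" (structure) +
  assumes hact_ract: "\<lbrakk>h \<in> carrier H; x \<in> carrier M; r \<in> carrier R\<rbrakk> \<Longrightarrow>
    hact M h (ract M x r) =
      sweedler M (\<lambda>h1 h2. ract M (hact M h1 x) (hact R h2 r)) (Delta_H H h)"

locale ha_bimodule = bimodule k A M + hr_module k H A M
  for k :: "('k, 'y) ring_scheme" and H :: "('k, 'h) hopf"
    and A :: "('k, 'h, 'a, 'x) hmod_scheme"
    and M :: "('k, 'h, 'a, 'm, 'z) hbimod_scheme" (structure) +
  assumes hact_lact: "\<lbrakk>h \<in> carrier H; a \<in> carrier A; x \<in> carrier M\<rbrakk> \<Longrightarrow>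
    hact M h (lact M a x) =
      sweedler M (\<lambda>h1 h2. lact M (hact A h1 a) (hact M h2 x)) (Delta_H H h)"


section \<open>Corings and comodules\<close>

abbreviation pure_A ::
  "('k, 'h, 'a, 'x) hmod_scheme \<Rightarrow> ('k, 'h, 'a, 'm, 'z) hrmod_scheme \<Rightarrow>
   ('k, 'h, 'a, 'n, 'w) hbimod_scheme \<Rightarrow> 'm \<Rightarrow> 'n \<Rightarrow> ('m, 'n) tens" where
  "pure_A A M N \<equiv> pure_tensor A M (ract M) N (lact N)"

text \<open>
  \<open>M \<otimes>\<^sub>A N\<close> with the diagonal \<open>H\<close>-action and the right \<open>A\<close>-action of \<open>N\<close>.  In the diagonal
  action the sum over \<open>\<Delta>(h)\<close> must be the inner one: for fixed \<open>h\<^sub>1, h\<^sub>2\<close> the map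
  \<open>(m, n) \<mapsto> h\<^sub>1 m \<otimes> h\<^sub>2 n\<close> is not \<open>A\<close>-balanced.
\<close>

definition tensor_A ::
  "('k, 'h) hopf \<Rightarrow> ('k, 'h, 'a, 'x) hmod_scheme \<Rightarrow> ('k, 'h, 'a, 'm, 'z) hrmod_scheme \<Rightarrow>
   ('k, 'h, 'a, 'n, 'w) hbimod_scheme \<Rightarrow> ('k, 'h, 'a, ('m, 'n) tens) hrmod" where
  "tensor_A H A M N =
     (let T = tensor A M (ract M) N (lact N)
      in \<lparr>carrier = carrier T, monoid.mult = undefined, monoid.one = undefined,
          ring.zero = ring.zero T, ring.add = ring.add T, smult = smult T,
          hact = (\<lambda>h. sweedler T (\<lambda>m n. sweedler T
             (\<lambda>h1 h2. pure_A A M N (hact M h1 m) (hact N h2 n)) (Delta_H H h))),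
          ract = (\<lambda>t a. sweedler T (\<lambda>m n. pure_A A M N m (ract N n a)) t)\<rparr>)"

definition tensor_A_bimod ::
  "('k, 'h) hopf \<Rightarrow> ('k, 'h, 'a, 'x) hmod_scheme \<Rightarrow> ('k, 'h, 'a, 'm, 'z) hbimod_scheme \<Rightarrow>
   ('k, 'h, 'a, 'n, 'w) hbimod_scheme \<Rightarrow> ('k, 'h, 'a, ('m, 'n) tens) hbimod" where
  "tensor_A_bimod H A M N =
     (let T = tensor_A H A M N
      in \<lparr>carrier = carrier T, monoid.mult = undefined, monoid.one = undefined,
          ring.zero = ring.zero T, ring.add = ring.add T, smult = smult T, hact = hact T, ract = ract T,
          lact = (\<lambda>a. sweedler T (\<lambda>m n. pure_A A M N (lact M a m) n))\<rparr>)"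

record ('k, 'h, 'a, 'c) coring = "('k, 'h, 'a, 'c) hbimod" +
  Delta_C :: "'c \<Rightarrow> ('c, 'c) tens"
  eps_C :: "'c \<Rightarrow> 'a"

text \<open>As for \<open>H\<close>, coassociativity is stated in \<open>C \<otimes>\<^sub>A (C \<otimes>\<^sub>A C)\<close>.\<close>

locale ha_coring = ha_bimodule k H A C
  for k :: "('k, 'y) ring_scheme" and H :: "('k, 'h) hopf"
    and A :: "('k, 'h, 'a, 'x) hmod_scheme"
    and C :: "('k, 'h, 'a, 'c) coring" (structure) +
  assumes Delta_left_linear:
    "left_linear A C (lact C) (tensor_A_bimod H A C C) (lact (tensor_A_bimod H A C C)) (Delta_C C)"
  and Delta_right_linear:
    "right_linear A C (ract C) (tensor_A_bimod H A C C) (ract (tensor_A_bimod H A C C)) (Delta_C C)"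
  and Delta_h_linear: "h_linear H C (tensor_A_bimod H A C C) (Delta_C C)"
  and eps_left_linear: "left_linear A C (lact C) A (monoid.mult A) (eps_C C)"
  and eps_right_linear: "right_linear A C (ract C) A (monoid.mult A) (eps_C C)"
  and eps_h_linear: "h_linear H C A (eps_C C)"
  and coassoc: "c \<in> carrier C \<Longrightarrow>
    sweedler (tensor_A H A C (tensor_A_bimod H A C C))
      (\<lambda>c1 c2. sweedler (tensor_A H A C (tensor_A_bimod H A C C))
         (\<lambda>c11 c12. pure_A A C (tensor_A_bimod H A C C) c11 (pure_A A C C c12 c2)) (Delta_C C c1))
      (Delta_C C c) =
    sweedler (tensor_A H A C (tensor_A_bimod H A C C))
      (\<lambda>c1 c2. pure_A A C (tensor_A_bimod H A C C) c1 (Delta_C C c2)) (Delta_C C c)"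
  and counit_left: "c \<in> carrier C \<Longrightarrow>
    sweedler C (\<lambda>c1 c2. lact C (eps_C C c1) c2) (Delta_C C c) = c"
  and counit_right: "c \<in> carrier C \<Longrightarrow>
    sweedler C (\<lambda>c1 c2. ract C c1 (eps_C C c2)) (Delta_C C c) = c"

record ('k, 'h, 'a, 'c, 'm) comod = "('k, 'h, 'a, 'm) hrmod" +
  rho :: "'m \<Rightarrow> ('m, 'c) tens"

locale hc_comodule = hr_module k H A M
  for k :: "('k, 'y) ring_scheme" and H :: "('k, 'h) hopf"
    and A :: "('k, 'h, 'a, 'x) hmod_scheme"
    and C :: "('k, 'h, 'a, 'c) coring"
    and M :: "('k, 'h, 'a, 'c, 'm) comod" (structure) +
  assumes rho_right_linear:
    "right_linear A M (ract M) (tensor_A H A M C) (ract (tensor_A H A M C)) (rho M)"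
  and rho_h_linear: "h_linear H M (tensor_A H A M C) (rho M)"
  and coact_coassoc: "x \<in> carrier M \<Longrightarrow>
    sweedler (tensor_A H A M (tensor_A_bimod H A C C))
      (\<lambda>m0 m1. sweedler (tensor_A H A M (tensor_A_bimod H A C C))
         (\<lambda>m00 m01. pure_A A M (tensor_A_bimod H A C C) m00 (pure_A A C C m01 m1)) (rho M m0))
      (rho M x) =
    sweedler (tensor_A H A M (tensor_A_bimod H A C C))
      (\<lambda>m0 m1. pure_A A M (tensor_A_bimod H A C C) m0 (Delta_C C m1)) (rho M x)"
  and coact_counit: "x \<in> carrier M \<Longrightarrow>
    sweedler M (\<lambda>m0 m1. ract M m0 (eps_C C m1)) (rho M x) = x"

definition colinear ::
  "('k, 'h) hopf \<Rightarrow> ('k, 'h, 'a, 'x) hmod_scheme \<Rightarrow> ('k, 'h, 'a, 'c) coring \<Rightarrow>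
   ('k, 'h, 'a, 'c, 'm) comod \<Rightarrow> ('k, 'h, 'a, 'c, 'n) comod \<Rightarrow> ('m \<Rightarrow> 'n) \<Rightarrow> bool" where
  "colinear H A C M N f \<longleftrightarrow>
     (\<forall>x\<in>carrier M. rho N (f x) =
        sweedler (tensor_A H A N C) (\<lambda>m0 m1. pure_A A N C (f m0) m1) (rho M x))"

definition left_dual ::
  "('k, 'h) hopf \<Rightarrow> ('k, 'h, 'a) hmod \<Rightarrow> ('k, 'h, 'a, 'c) coring \<Rightarrow>
   ('k, 'h, 'c \<Rightarrow> 'a) hmod" where
  "left_dual H A C =
     \<lparr>carrier = {f \<in> extensional (carrier C). left_linear A C (lact C) A (monoid.mult A) f},
      monoid.mult = (\<lambda>f g. \<lambda>c\<in>carrier C.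
         sweedler A (\<lambda>c1 c2. g (ract C c1 (f c2))) (Delta_C C c)),
      monoid.one = (\<lambda>c\<in>carrier C. eps_C C c),
      ring.zero = (\<lambda>c\<in>carrier C. \<zero>\<^bsub>A\<^esub>),
      ring.add = (\<lambda>f g. \<lambda>c\<in>carrier C. f c \<oplus>\<^bsub>A\<^esub> g c),
      smult = (\<lambda>x f. \<lambda>c\<in>carrier C. x \<odot>\<^bsub>A\<^esub> f c),
      hact = (\<lambda>h f. \<lambda>c\<in>carrier C.
         sweedler A (\<lambda>h1 h2. hact A h2 (f (hact C (S_H_inv H h1) c))) (Delta_H H h))\<rparr>"


section \<open>Finitely generated and projective left modules\<close>

definition finitely_generated_left ::
  "('k, 'h, 'a) hmod \<Rightarrow> ('k, 'h, 'a, 'c, 'z) hbimod_scheme \<Rightarrow> bool" where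
  "finitely_generated_left A M \<longleftrightarrow>
     (\<exists>G. finite G \<and> G \<subseteq> carrier M \<and>
        (\<forall>x\<in>carrier M. \<exists>r\<in>G \<rightarrow> carrier A. x = (\<Oplus>\<^bsub>M\<^esub> g\<in>G. lact M (r g) g)))"

text \<open>The free left module \<open>A\<^bsup>(I)\<^esup>\<close>, with the left \<open>A\<close>-action as \<open>smult\<close>.\<close>

definition free_left_module :: "('a, 'z) ring_scheme \<Rightarrow> 'i set \<Rightarrow> ('a, 'i \<Rightarrow> 'a) module" where
  "free_left_module A I =
     \<lparr>carrier = {v \<in> I \<rightarrow>\<^sub>E carrier A. finite {i \<in> I. v i \<noteq> \<zero>\<^bsub>A\<^esub>}},
      monoid.mult = undefined, monoid.one = undefined,
      ring.zero = (\<lambda>i\<in>I. \<zero>\<^bsub>A\<^esub>),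
      ring.add = (\<lambda>v w. \<lambda>i\<in>I. v i \<oplus>\<^bsub>A\<^esub> w i),
      smult = (\<lambda>a v. \<lambda>i\<in>I. a \<otimes>\<^bsub>A\<^esub> v i)\<rparr>"

text \<open>
  Projective: a direct summand of a free module, given by a split monomorphism \<open>s\<close> with
  retraction \<open>p\<close>.  It is enough to take index sets in the type of \<open>M\<close>: a projective module is
  a direct summand of the free module on its underlying set.
\<close>

definition projective_left ::
  "('k, 'h, 'a) hmod \<Rightarrow> ('k, 'h, 'a, 'm, 'z) hbimod_scheme \<Rightarrow> bool" where
  "projective_left A M \<longleftrightarrow>
     (\<exists>(I :: 'm set) s p.
        left_linear A M (lact M) (free_left_module A I) (smult (free_left_module A I)) s \<and>
        left_linear A (free_left_module A I) (smult (free_left_module A I)) M (lact M) p \<and>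
        (\<forall>x\<in>carrier M. p (s x) = x))"


section \<open>Categories\<close>

record ('o, 'f) cat =
  Ob :: "'o set"
  Hom :: "'o \<Rightarrow> 'o \<Rightarrow> 'f set"
  Id :: "'o \<Rightarrow> 'f"
  Comp :: "'o \<Rightarrow> 'o \<Rightarrow> 'o \<Rightarrow> 'f \<Rightarrow> 'f \<Rightarrow> 'f"

text \<open>\<open>Comp \<C> X Y Z g f\<close> is \<open>g \<circ> f\<close> for \<open>f : X \<rightarrow> Y\<close> and \<open>g : Y \<rightarrow> Z\<close>.\<close>

locale category =
  fixes \<C> :: "('o, 'f) cat"
  assumes Id_in: "X \<in> Ob \<C> \<Longrightarrow> Id \<C> X \<in> Hom \<C> X X"
  and Comp_in: "\<lbrakk>X \<in> Ob \<C>; Y \<in> Ob \<C>; Z \<in> Ob \<C>; f \<in> Hom \<C> X Y; g \<in> Hom \<C> Y Z\<rbrakk> \<Longrightarrow>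
    Comp \<C> X Y Z g f \<in> Hom \<C> X Z"
  and Comp_Id_right: "\<lbrakk>X \<in> Ob \<C>; Y \<in> Ob \<C>; f \<in> Hom \<C> X Y\<rbrakk> \<Longrightarrow>
    Comp \<C> X X Y f (Id \<C> X) = f"
  and Comp_Id_left: "\<lbrakk>X \<in> Ob \<C>; Y \<in> Ob \<C>; f \<in> Hom \<C> X Y\<rbrakk> \<Longrightarrow>
    Comp \<C> X Y Y (Id \<C> Y) f = f"
  and Comp_assoc: "\<lbrakk>W \<in> Ob \<C>; X \<in> Ob \<C>; Y \<in> Ob \<C>; Z \<in> Ob \<C>;
      f \<in> Hom \<C> W X; g \<in> Hom \<C> X Y; h \<in> Hom \<C> Y Z\<rbrakk> \<Longrightarrow>
    Comp \<C> W X Z (Comp \<C> X Y Z h g) f = Comp \<C> W Y Z h (Comp \<C> W X Y g f)"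

locale cat_functor = C: category \<C> + D: category \<D>
  for \<C> :: "('o, 'f) cat" and \<D> :: "('p, 'g) cat"
    and Fo :: "'o \<Rightarrow> 'p" and Fm :: "'o \<Rightarrow> 'o \<Rightarrow> 'f \<Rightarrow> 'g" +
  assumes Fo_in: "X \<in> Ob \<C> \<Longrightarrow> Fo X \<in> Ob \<D>"
  and Fm_in: "\<lbrakk>X \<in> Ob \<C>; Y \<in> Ob \<C>; f \<in> Hom \<C> X Y\<rbrakk> \<Longrightarrow>
    Fm X Y f \<in> Hom \<D> (Fo X) (Fo Y)"
  and Fm_Id: "X \<in> Ob \<C> \<Longrightarrow> Fm X X (Id \<C> X) = Id \<D> (Fo X)"
  and Fm_Comp: "\<lbrakk>X \<in> Ob \<C>; Y \<in> Ob \<C>; Z \<in> Ob \<C>; f \<in> Hom \<C> X Y; g \<in> Hom \<C> Y Z\<rbrakk> \<Longrightarrow>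
    Fm X Z (Comp \<C> X Y Z g f) = Comp \<D> (Fo X) (Fo Y) (Fo Z) (Fm Y Z g) (Fm X Y f)"

definition cat_isomorphism ::
  "('o, 'f) cat \<Rightarrow> ('p, 'g) cat \<Rightarrow> ('o \<Rightarrow> 'p) \<Rightarrow> ('o \<Rightarrow> 'o \<Rightarrow> 'f \<Rightarrow> 'g) \<Rightarrow> bool" where
  "cat_isomorphism \<C> \<D> Fo Fm \<longleftrightarrow>
     cat_functor \<C> \<D> Fo Fm \<and>
     (\<exists>Go Gm. cat_functor \<D> \<C> Go Gm \<and>
        (\<forall>X\<in>Ob \<C>. Go (Fo X) = X) \<and>
        (\<forall>X\<in>Ob \<C>. \<forall>Y\<in>Ob \<C>. \<forall>f\<in>Hom \<C> X Y. Gm (Fo X) (Fo Y) (Fm X Y f) = f) \<and>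
        (\<forall>X\<in>Ob \<D>. Fo (Go X) = X) \<and>
        (\<forall>X\<in>Ob \<D>. \<forall>Y\<in>Ob \<D>. \<forall>f\<in>Hom \<D> X Y. Fm (Go X) (Go Y) (Gm X Y f) = f))"

text \<open>
  Objects of a category are compared by record equality, so their operations are required to
  be undefined outside the carriers, as are the fields \<open>mult\<close> and \<open>one\<close> that the record type
  of modules inherits from that of rings.  The objects of the two categories below have their
  underlying sets in the type \<open>'m\<close>, which plays the role of a universe.
\<close>

definition normalised ::
  "('k, 'y) ring_scheme \<Rightarrow> ('k, 'h) hopf \<Rightarrow> ('k, 'r, 'x) module_scheme \<Rightarrow>
   ('k, 'h, 'r, 'm, 'z) hrmod_scheme \<Rightarrow> bool" where
  "normalised k H R M \<longleftrightarrow>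
     monoid.mult M = undefined \<and> monoid.one M = undefined \<and>
     ring.add M \<in> carrier M \<rightarrow>\<^sub>E carrier M \<rightarrow>\<^sub>E carrier M \<and>
     smult M \<in> carrier k \<rightarrow>\<^sub>E carrier M \<rightarrow>\<^sub>E carrier M \<and>
     hact M \<in> carrier H \<rightarrow>\<^sub>E carrier M \<rightarrow>\<^sub>E carrier M \<and>
     ract M \<in> carrier M \<rightarrow>\<^sub>E carrier R \<rightarrow>\<^sub>E carrier M"

definition mod_cat ::
  "('k, 'y) ring_scheme \<Rightarrow> ('k, 'h) hopf \<Rightarrow> ('k, 'h, 'r) hmod \<Rightarrow>
   (('k, 'h, 'r, 'm) hrmod, 'm \<Rightarrow> 'm) cat" where
  "mod_cat k H R =
     \<lparr>Ob = {M. hr_module k H R M \<and> normalised k H R M},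
      Hom = (\<lambda>M N. {f \<in> extensional (carrier M).
         right_linear R M (ract M) N (ract N) f \<and> h_linear H M N f}),
      Id = (\<lambda>M. \<lambda>x\<in>carrier M. x),
      Comp = (\<lambda>L M N g f. compose (carrier L) g f)\<rparr>"

definition comod_cat ::
  "('k, 'y) ring_scheme \<Rightarrow> ('k, 'h) hopf \<Rightarrow> ('k, 'h, 'a) hmod \<Rightarrow> ('k, 'h, 'a, 'c) coring \<Rightarrow>
   (('k, 'h, 'a, 'c, 'm) comod, 'm \<Rightarrow> 'm) cat" where
  "comod_cat k H A C =
     \<lparr>Ob = {M. hc_comodule k H A C M \<and> normalised k H A M \<and> rho M \<in> extensional (carrier M)},
      Hom = (\<lambda>M N. {f \<in> extensional (carrier M).
         right_linear A M (ract M) N (ract N) f \<and> h_linear H M N f \<and> colinear H A C M N f}),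
      Id = (\<lambda>M. \<lambda>x\<in>carrier M. x),
      Comp = (\<lambda>L M N g f. compose (carrier L) g f)\<rparr>"

definition comod_to_mod ::
  "('k, 'h) hopf \<Rightarrow> ('k, 'h, 'a) hmod \<Rightarrow> ('k, 'h, 'a, 'c) coring \<Rightarrow>
   ('k, 'h, 'a, 'c, 'm) comod \<Rightarrow> ('k, 'h, 'c \<Rightarrow> 'a, 'm) hrmod" where
  "comod_to_mod H A C M =
     \<lparr>carrier = carrier M, monoid.mult = monoid.mult M, monoid.one = monoid.one M,
      ring.zero = ring.zero M, ring.add = ring.add M, smult = smult M, hact = hact M,
      ract = (\<lambda>x\<in>carrier M. \<lambda>f\<in>carrier (left_dual H A C).
         sweedler M (\<lambda>m0 m1. ract M m0 (f m1)) (rho M x))\<rparr>"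

end

theory Submission
  imports Defs
begin

text \<open>
  For a comodule \<open>M\<close>, associativity of \<open>m f = m\<^sub>0 f(m\<^sub>1)\<close> is coassociativity of \<open>M\<close>, and
  compatibility with \<open>H\<close> comes from \<open>S\<^sup>-\<^sup>1(h\<^sub>2) h\<^sub>1 = \<epsilon>(h)\<close>:
  \<open>(h\<^sub>1 m)(h\<^sub>2 f) = (h\<^sub>1 m\<^sub>0) (h\<^sub>4 f(S\<^sup>-\<^sup>1(h\<^sub>3) h\<^sub>2 m\<^sub>1)) = (h\<^sub>1 m\<^sub>0) (h\<^sub>2 f(m\<^sub>1)) = h(m f)\<close>.
  That \<open>h f\<close> is again left \<open>A\<close>-linear rests on \<open>h\<^sub>2 S\<^sup>-\<^sup>1(h\<^sub>1) = \<epsilon>(h)\<close> and on \<open>S\<close> reversing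
  products and coproducts.

  If \<open>C\<close> is finitely generated projective over \<open>A\<close>, it has a finite dual basis \<open>e\<^sub>j\<close>, \<open>\<phi>\<^sub>j\<close>
  with \<open>c = \<Sum>\<^sub>j \<phi>\<^sub>j(c) e\<^sub>j\<close>.  Then \<open>t = \<Sum>\<^sub>j t(\<phi>\<^sub>j) \<otimes> e\<^sub>j\<close> for all \<open>t \<in> M \<otimes>\<^sub>A C\<close>, where
  \<open>(m \<otimes> c)(f) = m f(c)\<close>, so tensors are determined by their values at the elements of the dual
  ring.  On a module \<open>N\<close> over the dual ring let \<open>a \<in> A\<close> act as \<open>c \<mapsto> \<epsilon>(c) a\<close>, and put
  \<open>\<rho>(x) = \<Sum>\<^sub>j x \<phi>\<^sub>j \<otimes> e\<^sub>j\<close>.  Since \<open>\<rho>(x)(f) = x f\<close>, each comodule axiom for \<open>\<rho>\<close> becomes an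
  identity for the action of the dual ring after evaluation.
\<close>

section \<open>Evaluating bilinear expressions on tensors\<close>

text \<open>Because \<open>sweedler\<close> evaluates a representative picked by Hilbert choice, its
  rules are of two kinds. Those that only change the summand (congruence, additivity, applying an
  additive map, exchanging two sums) hold for the fixed representative. Balancedness enters when the
  tensor itself is rewritten, for instance as the coproduct of a product or the coaction of
  \<open>h x\<close>. Sums with many indices \<open>h1, h2, ...\<close> are written as nested binary
  sums, and a cancellation such as \<open>h2 S(h3)\<close> is a lemma on nested sums of multilinear
  maps.

  The delicate point of the converse direction is \<open>H\<close>-linearity of the constructed
  coaction. Evaluated at \<open>f\<close>, the diagonal action yields \<open>(h1 m) f(h2 c)\<close>,
  which is not an evaluation of \<open>m \<otimes> c\<close> at any one functional. The remedy is a
  twist by the antipode: \<open>h1 (m (S(h2) f)(c)) = (h1 m) f(h2 c)\<close> on tensors and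
  \<open>h1 (x (S(h2) f)) = (h x) f\<close> on the module. After the twist each summand is an
  evaluation of \<open>\<rho>(x)\<close> at the single functional \<open>S(h2) f\<close>.\<close>

definition additive :: "('x, 'y) ring_scheme \<Rightarrow> ('z, 'w) ring_scheme \<Rightarrow> ('x \<Rightarrow> 'z) \<Rightarrow> bool" where
  "additive X Y f \<longleftrightarrow> f \<in> carrier X \<rightarrow> carrier Y \<and>
     (\<forall>x\<in>carrier X. \<forall>y\<in>carrier X. f (x \<oplus>\<^bsub>X\<^esub> y) = f x \<oplus>\<^bsub>Y\<^esub> f y)"

lemma additiveI:
  assumes "\<And>x. x \<in> carrier X \<Longrightarrow> f x \<in> carrier Y"
    and "\<And>x y. x \<in> carrier X \<Longrightarrow> y \<in> carrier X \<Longrightarrow> f (x \<oplus>\<^bsub>X\<^esub> y) = f x \<oplus>\<^bsub>Y\<^esub> f y"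
  shows "additive X Y f"
  using assms by (auto simp: additive_def)

lemma additive_closed: "additive X Y f \<Longrightarrow> x \<in> carrier X \<Longrightarrow> f x \<in> carrier Y"
  by (auto simp: additive_def)

lemma additive_add:
  "additive X Y f \<Longrightarrow> x \<in> carrier X \<Longrightarrow> y \<in> carrier X \<Longrightarrow> f (x \<oplus>\<^bsub>X\<^esub> y) = f x \<oplus>\<^bsub>Y\<^esub> f y"
  by (auto simp: additive_def)

lemma additive_comp: "additive X Y f \<Longrightarrow> additive Y Z g \<Longrightarrow> additive X Z (\<lambda>x. g (f x))"
  by (auto simp: additive_def Pi_iff)

lemma additive_zero:
  assumes X: "abelian_group X" and Y: "abelian_group Y" and f: "additive X Y f"
  shows "f \<zero>\<^bsub>X\<^esub> = \<zero>\<^bsub>Y\<^esub>"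
proof -
  interpret X: abelian_group X by fact
  interpret Y: abelian_group Y by fact
  have c: "f \<zero>\<^bsub>X\<^esub> \<in> carrier Y" using f by (simp add: additive_closed)
  have "f \<zero>\<^bsub>X\<^esub> \<oplus>\<^bsub>Y\<^esub> f \<zero>\<^bsub>X\<^esub> = f \<zero>\<^bsub>X\<^esub>"
    using additive_add[OF f, of "\<zero>\<^bsub>X\<^esub>" "\<zero>\<^bsub>X\<^esub>"] by simp
  then show ?thesis using c by simp
qed

lemma additive_minus:
  assumes X: "abelian_group X" and Y: "abelian_group Y" and f: "additive X Y f"
    and x: "x \<in> carrier X" "y \<in> carrier X"
  shows "f (x \<ominus>\<^bsub>X\<^esub> y) = f x \<ominus>\<^bsub>Y\<^esub> f y"
proof -
  interpret X: abelian_group X by fact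
  interpret Y: abelian_group Y by fact
  have c: "f x \<in> carrier Y" "f y \<in> carrier Y" "f (x \<ominus>\<^bsub>X\<^esub> y) \<in> carrier Y"
    using f x by (auto simp: additive_closed)
  have "f (x \<ominus>\<^bsub>X\<^esub> y) \<oplus>\<^bsub>Y\<^esub> f y = f ((x \<ominus>\<^bsub>X\<^esub> y) \<oplus>\<^bsub>X\<^esub> y)"
    using additive_add[OF f] x by simp
  also have "(x \<ominus>\<^bsub>X\<^esub> y) \<oplus>\<^bsub>X\<^esub> y = x"
    using x by (simp add: a_minus_def X.a_assoc X.l_neg)
  finally have "f x = f (x \<ominus>\<^bsub>X\<^esub> y) \<oplus>\<^bsub>Y\<^esub> f y" by simp
  then show ?thesis using c by (simp add: a_minus_def Y.a_assoc Y.r_neg)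
qed

lemma additive_finsum:
  assumes X: "abelian_group X" and Y: "abelian_group Y" and f: "additive X Y f"
    and "finite I" "\<And>i. i \<in> I \<Longrightarrow> g i \<in> carrier X"
  shows "f (\<Oplus>\<^bsub>X\<^esub>i\<in>I. g i) = (\<Oplus>\<^bsub>Y\<^esub>i\<in>I. f (g i))"
proof -
  interpret X: abelian_group X by fact
  interpret Y: abelian_group Y by fact
  from assms(4,5) show ?thesis
  proof (induction I rule: finite_induct)
    case empty
    then show ?case using additive_zero[OF X Y f] by simp
  next
    case (insert i I)
    then have "g \<in> I \<rightarrow> carrier X" "g i \<in> carrier X"
      "(\<lambda>i. f (g i)) \<in> I \<rightarrow> carrier Y" "f (g i) \<in> carrier Y"
      using additive_closed[OF f] by auto
    then show ?case using insert by (simp add: additive_add[OF f] X.finsum_closed)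
  qed
qed

lemma (in abelian_group) int_multiple_closed: "x \<in> carrier G \<Longrightarrow> [(n::int)] \<cdot> x \<in> carrier G"
  using group.int_pow_closed[OF a_group, of x n] by (simp add: add_pow_def)

lemma (in abelian_group) int_multiple_zero: "[(0::int)] \<cdot> x = \<zero>"
  by (simp add: add_pow_def int_pow_def)

lemma (in abelian_group) int_multiple_add:
  "x \<in> carrier G \<Longrightarrow> [(m + n::int)] \<cdot> x = [m] \<cdot> x \<oplus> [n] \<cdot> x"
  using group.int_pow_mult[OF a_group, of x m n] by (simp add: add_pow_def)

lemma (in abelian_group) eq_diff_of_add_eq:
  assumes "x \<oplus> y = z" "x \<in> carrier G" "y \<in> carrier G"
  shows "x = z \<ominus> y"
  using assms(2,3) by (simp add: a_minus_def a_assoc r_neg flip: assms(1))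

lemma (in abelian_group) add_eq_of_diff_eq:
  assumes "x \<ominus> y = z" "x \<in> carrier G" "y \<in> carrier G"
  shows "x = z \<oplus> y"
  using assms(2,3) by (simp add: a_minus_def a_assoc l_neg flip: assms(1))

text \<open>The sum inside \<open>sweedler\<close>, freed from the chosen representative. On formal
  sums it is a homomorphism, which opens the way to induction over the free abelian group.\<close>

definition frag_eval :: "('x, 'y) ring_scheme \<Rightarrow> ('m \<Rightarrow> 'n \<Rightarrow> 'x) \<Rightarrow> ('m \<times> 'n \<Rightarrow>\<^sub>0 int) \<Rightarrow> 'x" where
  "frag_eval X b z =
     (\<Oplus>\<^bsub>X\<^esub> p \<in> Poly_Mapping.keys z. [Poly_Mapping.lookup z p] \<cdot>\<^bsub>X\<^esub> b (fst p) (snd p))"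

lemma sweedler_frag_eval: "sweedler X b t = frag_eval X b (SOME z. z \<in> t)"
  by (simp add: sweedler_def frag_eval_def Let_def)

locale frag_evaluation = abelian_group X for X :: "('x, 'y) ring_scheme" (structure) +
  fixes U :: "'m set" and V :: "'n set" and b :: "'m \<Rightarrow> 'n \<Rightarrow> 'x"
  assumes b_closed: "m \<in> U \<Longrightarrow> n \<in> V \<Longrightarrow> b m n \<in> carrier X"
begin

text \<open>Cancellation can make the support of \<open>z + w\<close> smaller than the union of the
  two supports. A common index set \<open>K\<close> avoids comparing sums over different
  sets.\<close>

lemma frag_eval_superset:
  assumes "finite K" "Poly_Mapping.keys z \<subseteq> K" "K \<subseteq> U \<times> V"
  shows "frag_eval X b z = (\<Oplus>p\<in>K. [Poly_Mapping.lookup z p] \<cdot> b (fst p) (snd p))"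
proof -
  have c: "(\<lambda>p. [Poly_Mapping.lookup z p] \<cdot> b (fst p) (snd p)) \<in> K \<rightarrow> carrier X"
    using assms b_closed by (auto simp: subset_iff int_multiple_closed)
  show ?thesis unfolding frag_eval_def
    by (rule add.finprod_mono_neutral_cong_left)
       (use assms c in \<open>auto simp: in_keys_iff int_multiple_zero\<close>)
qed

lemma frag_eval_closed: "Poly_Mapping.keys z \<subseteq> U \<times> V \<Longrightarrow> frag_eval X b z \<in> carrier X"
  unfolding frag_eval_def
  by (rule finsum_closed) (use b_closed in \<open>auto intro!: int_multiple_closed\<close>)

lemma frag_eval_of: "p \<in> U \<times> V \<Longrightarrow> frag_eval X b (frag_of p) = b (fst p) (snd p)"
  using b_closed by (subst frag_eval_superset[of "{p}"]) auto

lemma frag_eval_add: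
  assumes "Poly_Mapping.keys z \<subseteq> U \<times> V" "Poly_Mapping.keys w \<subseteq> U \<times> V"
  shows "frag_eval X b (z + w) = frag_eval X b z \<oplus> frag_eval X b w"
proof -
  define K where "K = Poly_Mapping.keys z \<union> Poly_Mapping.keys w"
  have K: "finite K" "K \<subseteq> U \<times> V" using assms by (auto simp: K_def)
  have c: "(\<lambda>p. [Poly_Mapping.lookup u p] \<cdot> b (fst p) (snd p)) \<in> K \<rightarrow> carrier X"
    for u :: "'m \<times> 'n \<Rightarrow>\<^sub>0 int"
    using K b_closed by (auto simp: subset_iff int_multiple_closed)
  have "frag_eval X b (z + w) =
    (\<Oplus>p\<in>K. [Poly_Mapping.lookup z p] \<cdot> b (fst p) (snd p) \<oplus>
             [Poly_Mapping.lookup w p] \<cdot> b (fst p) (snd p))"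
    apply (subst frag_eval_superset[OF K(1) _ K(2)])
    using keys_add[of z w] apply (auto simp: K_def)[1]
    apply (rule finsum_cong')
    using K b_closed by (auto simp: lookup_add int_multiple_add int_multiple_closed subset_iff)
  also have "\<dots> = frag_eval X b z \<oplus> frag_eval X b w"
    using K c by (simp add: finsum_addf frag_eval_superset[of K] K_def)
  finally show ?thesis .
qed

lemma frag_eval_zero: "frag_eval X b 0 = \<zero>"
  by (simp add: frag_eval_def)

lemma frag_eval_minus:
  assumes "Poly_Mapping.keys z \<subseteq> U \<times> V"
  shows "frag_eval X b (- z) = \<ominus> frag_eval X b z"
  using frag_eval_add[of "- z" z] frag_eval_closed[of z] frag_eval_closed[of "- z"] assms
  by (simp add: keys_minus frag_eval_zero minus_equality)

lemma frag_eval_diff: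
  assumes "Poly_Mapping.keys z \<subseteq> U \<times> V" "Poly_Mapping.keys w \<subseteq> U \<times> V"
  shows "frag_eval X b (z - w) = frag_eval X b z \<ominus> frag_eval X b w"
  using frag_eval_add[of z "- w"] assms by (simp add: frag_eval_minus a_minus_def keys_minus)

text \<open>Both sides respect differences of formal sums, so the generators decide.\<close>

lemma frag_eval_additive:
  assumes Y: "abelian_group Y" and f: "additive X Y f" and z: "Poly_Mapping.keys z \<subseteq> U \<times> V"
  shows "f (frag_eval X b z) = frag_eval Y (\<lambda>m n. f (b m n)) z"
proof -
  interpret Y: frag_evaluation Y U V "\<lambda>m n. f (b m n)"
    by (intro frag_evaluation.intro frag_evaluation_axioms.intro Y)
       (use f b_closed in \<open>auto simp: additive_def\<close>)
  have X: "abelian_group X" ..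
  show ?thesis using z
  proof (induction z rule: free_Abelian_group_induct[consumes 1, case_names 1 2 3])
    case 1
    then show ?case by (simp add: frag_eval_zero Y.frag_eval_zero additive_zero[OF X Y f])
  next
    case (2 x y)
    then show ?case
      by (simp add: frag_eval_diff Y.frag_eval_diff additive_minus[OF X Y f] frag_eval_closed)
  next
    case (3 a)
    then show ?case by (simp add: frag_eval_of Y.frag_eval_of)
  qed
qed

end

definition balanced ::
  "('r, 'v) ring_scheme \<Rightarrow> ('m, 'z) ring_scheme \<Rightarrow> ('m \<Rightarrow> 'r \<Rightarrow> 'm) \<Rightarrow>
   ('n, 'w) ring_scheme \<Rightarrow> ('r \<Rightarrow> 'n \<Rightarrow> 'n) \<Rightarrow> ('x, 'y) ring_scheme \<Rightarrow> ('m \<Rightarrow> 'n \<Rightarrow> 'x) \<Rightarrow> bool" where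
  "balanced R M ra N la X b \<longleftrightarrow>
     (\<forall>n\<in>carrier N. additive M X (\<lambda>m. b m n)) \<and>
     (\<forall>m\<in>carrier M. additive N X (b m)) \<and>
     (\<forall>m\<in>carrier M. \<forall>r\<in>carrier R. \<forall>n\<in>carrier N. b (ra m r) n = b m (la r n))"

lemma balancedI:
  assumes "\<And>n. n \<in> carrier N \<Longrightarrow> additive M X (\<lambda>m. b m n)"
    and "\<And>m. m \<in> carrier M \<Longrightarrow> additive N X (b m)"
    and "\<And>m r n. m \<in> carrier M \<Longrightarrow> r \<in> carrier R \<Longrightarrow> n \<in> carrier N \<Longrightarrow> b (ra m r) n = b m (la r n)"
  shows "balanced R M ra N la X b"
  using assms by (simp add: balanced_def)

text \<open>Closedness of the two actions is what puts the relators into the free group. The locale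
  serves tensor products over \<open>k\<close> and over \<open>A\<close>, and also those whose right
  factor is itself a tensor product.\<close>

locale tensor_product = M: abelian_group M + N: abelian_group N
  for R :: "('r, 'v) ring_scheme" and M :: "('m, 'z) ring_scheme" and ra :: "'m \<Rightarrow> 'r \<Rightarrow> 'm"
    and N :: "('n, 'w) ring_scheme" and la :: "'r \<Rightarrow> 'n \<Rightarrow> 'n" +
  assumes ra_closed: "m \<in> carrier M \<Longrightarrow> r \<in> carrier R \<Longrightarrow> ra m r \<in> carrier M"
    and la_closed: "n \<in> carrier N \<Longrightarrow> r \<in> carrier R \<Longrightarrow> la r n \<in> carrier N"
begin

abbreviation "T \<equiv> tensor_group R M ra N la"
abbreviation "F \<equiv> free_Abelian_group (carrier M \<times> carrier N)"
abbreviation "null \<equiv> tensor_null R M ra N la"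
abbreviation "pure \<equiv> pure_tensor R M ra N la"
abbreviation "coset z \<equiv> null #>\<^bsub>F\<^esub> z"

lemma relators_subset: "tensor_relators R M ra N la \<subseteq> carrier F"
proof
  fix z assume z: "z \<in> tensor_relators R M ra N la"
  have d: "Poly_Mapping.keys (u - v) \<subseteq> S" if "Poly_Mapping.keys u \<subseteq> S" "Poly_Mapping.keys v \<subseteq> S"
    for u v :: "'m \<times> 'n \<Rightarrow>\<^sub>0 int" and S
    using keys_diff[of u v] that by blast
  from z show "z \<in> carrier F"
    unfolding tensor_relators_def
    apply (elim UnE CollectE exE conjE)
      apply (simp_all only: carrier_free_Abelian_group_iff)
      apply (rule d, rule d; simp)+
    apply (rule d; simp add: ra_closed la_closed)
    done
qed

lemma null_subgroup: "subgroup null F"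
  unfolding tensor_null_def
  by (rule group.generate_is_subgroup[OF group_free_Abelian_group relators_subset])

lemma null_normal: "null \<lhd> F"
  using comm_group.subgroup_imp_normal[OF abelian_free_Abelian_group null_subgroup] .

lemma carrier_T: "carrier T = coset ` carrier F"
  by (simp add: tensor_group_def Let_def carrier_FactGroup)

lemma add_T: "t \<oplus>\<^bsub>T\<^esub> u = t <#>\<^bsub>F\<^esub> u"
  by (simp add: tensor_group_def Let_def)

lemma zero_T: "\<zero>\<^bsub>T\<^esub> = null"
  by (simp add: tensor_group_def Let_def)

text \<open>The quotient of the free group is a multiplicative group in the library's sense; its
  laws are transported to the additive part of the record.\<close>

lemma T_abelian_group: "abelian_group T"
proof -
  interpret Q: comm_group "F Mod null"
    by (rule comm_group.abelian_FactGroup[OF abelian_free_Abelian_group null_subgroup])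
  have e: "carrier T = carrier (F Mod null)" "ring.add T = monoid.mult (F Mod null)"
    "ring.zero T = monoid.one (F Mod null)"
    by (auto simp: tensor_group_def Let_def)
  show ?thesis
  proof (rule abelian_groupI; simp only: e)
    fix x assume "x \<in> carrier (F Mod null)"
    then show "\<exists>y\<in>carrier (F Mod null). y \<otimes>\<^bsub>F Mod null\<^esub> x = \<one>\<^bsub>F Mod null\<^esub>"
      by (intro bexI[of _ "inv\<^bsub>F Mod null\<^esub> x"] Q.l_inv Q.inv_closed)
  qed (fact Q.m_closed Q.one_closed Q.m_assoc Q.m_comm Q.l_one)+
qed

interpretation T: abelian_group T by (rule T_abelian_group)

lemma coset_closed: "Poly_Mapping.keys z \<subseteq> carrier M \<times> carrier N \<Longrightarrow> coset z \<in> carrier T"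
  by (auto simp: carrier_T)

lemma coset_add:
  assumes "Poly_Mapping.keys z \<subseteq> carrier M \<times> carrier N" "Poly_Mapping.keys w \<subseteq> carrier M \<times> carrier N"
  shows "coset (z + w) = coset z \<oplus>\<^bsub>T\<^esub> coset w"
  using normal.rcos_sum[OF null_normal, of z w] assms by (simp add: add_T)

lemma coset_zero: "coset 0 = \<zero>\<^bsub>T\<^esub>"
  using group.coset_mult_one[OF group_free_Abelian_group, of null] subgroup.subset[OF null_subgroup]
  by (simp add: zero_T)

lemma coset_null: "z \<in> null \<Longrightarrow> coset z = \<zero>\<^bsub>T\<^esub>"
  unfolding zero_T
  by (rule group.coset_join2[OF group_free_Abelian_group subgroup.mem_carrier[OF null_subgroup]
      null_subgroup])

text \<open>Elements of \<open>null\<close> are formal sums over the product of the carriers, so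
  every member of a coset is one as well. Hence whatever \<open>SOME\<close> picks can be
  evaluated.\<close>

lemma some_in_tensor:
  assumes "t \<in> carrier T"
  shows "Poly_Mapping.keys (SOME z. z \<in> t) \<subseteq> carrier M \<times> carrier N" "coset (SOME z. z \<in> t) = t"
proof -
  obtain w where w: "w \<in> carrier F" "t = coset w" using assms carrier_T by auto
  have "w \<in> t"
    using group.rcos_self[OF group_free_Abelian_group w(1) null_subgroup] w by simp
  then have s: "(SOME z. z \<in> t) \<in> t" by (rule someI)
  show "coset (SOME z. z \<in> t) = t"
    using group.repr_independence[OF group_free_Abelian_group _ w(1) null_subgroup] s w by blast
  show "Poly_Mapping.keys (SOME z. z \<in> t) \<subseteq> carrier M \<times> carrier N"
  proof -
    obtain v where v: "v \<in> null" "(SOME z. z \<in> t) = v + w"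
      using s w by (auto simp: r_coset_def)
    have "v \<in> carrier F" by (rule subgroup.mem_carrier[OF null_subgroup v(1)])
    then show ?thesis using v w keys_add[of v w] by auto
  qed
qed

lemma pure_closed: "m \<in> carrier M \<Longrightarrow> n \<in> carrier N \<Longrightarrow> pure m n \<in> carrier T"
  unfolding pure_tensor_def by (rule coset_closed) auto

lemma coset_diff:
  assumes "Poly_Mapping.keys z \<subseteq> carrier M \<times> carrier N" "Poly_Mapping.keys w \<subseteq> carrier M \<times> carrier N"
  shows "coset (z - w) = coset z \<ominus>\<^bsub>T\<^esub> coset w"
proof -
  have "Poly_Mapping.keys (z - w) \<subseteq> carrier M \<times> carrier N"
    using assms keys_diff[of z w] by blast
  then have "coset (z - w) \<oplus>\<^bsub>T\<^esub> coset w = coset z" "coset (z - w) \<in> carrier T"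
    using coset_add[of "z - w" w] assms coset_closed by auto
  then show ?thesis
    by (rule T.eq_diff_of_add_eq) (rule coset_closed[OF assms(2)])
qed

lemma coset_relator:
  assumes "z - w - v \<in> tensor_relators R M ra N la"
    and "Poly_Mapping.keys z \<subseteq> carrier M \<times> carrier N"
    and "Poly_Mapping.keys w \<subseteq> carrier M \<times> carrier N" "Poly_Mapping.keys v \<subseteq> carrier M \<times> carrier N"
  shows "coset z = coset w \<oplus>\<^bsub>T\<^esub> coset v"
proof -
  have c: "Poly_Mapping.keys (w + v) \<subseteq> carrier M \<times> carrier N"
    using assms keys_add[of w v] by blast
  have "z - w - v \<in> null"
    unfolding tensor_null_def by (rule generate.incl) (rule assms)
  then have "coset (z - (w + v)) = \<zero>\<^bsub>T\<^esub>" by (simp add: coset_null diff_diff_eq)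
  then have "coset z \<ominus>\<^bsub>T\<^esub> coset (w + v) = \<zero>\<^bsub>T\<^esub>"
    by (simp add: coset_diff[OF assms(2) c])
  from T.add_eq_of_diff_eq[OF this coset_closed[OF assms(2)] coset_closed[OF c]]
  show ?thesis
    using coset_closed[OF assms(3)] coset_closed[OF assms(4)] by (simp add: coset_add[OF assms(3,4)])
qed

lemma pure_balanced: "balanced R M ra N la T pure"
proof (intro balancedI additiveI)
  fix m m' n assume a: "m \<in> carrier M" "m' \<in> carrier M" "n \<in> carrier N"
  show "pure (m \<oplus>\<^bsub>M\<^esub> m') n = pure m n \<oplus>\<^bsub>T\<^esub> pure m' n"
    unfolding pure_tensor_def
    by (rule coset_relator) (use a in \<open>auto simp: tensor_relators_def\<close>)
next
  fix m n n' assume a: "m \<in> carrier M" "n' \<in> carrier N" "n \<in> carrier N"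
  show "pure m (n \<oplus>\<^bsub>N\<^esub> n') = pure m n \<oplus>\<^bsub>T\<^esub> pure m n'"
    unfolding pure_tensor_def
    by (rule coset_relator) (use a in \<open>auto simp: tensor_relators_def\<close>)
next
  fix m r n assume a: "m \<in> carrier M" "r \<in> carrier R" "n \<in> carrier N"
  \<comment> \<open>The balancing relator has two terms; it is read as a relator of three terms
    whose last one is \<open>0\<close>.\<close>
  have "coset (frag_of (ra m r, n)) = coset (frag_of (m, la r n)) \<oplus>\<^bsub>T\<^esub> coset 0"
    by (rule coset_relator) (use a in \<open>auto simp: tensor_relators_def ra_closed la_closed\<close>)
  then show "pure (ra m r) n = pure m (la r n)"
    unfolding pure_tensor_def
    using a coset_closed[of "frag_of (m, la r n)"] by (simp add: coset_zero la_closed)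
qed (simp_all add: pure_closed)

lemmas pure_add_left = additive_add[OF pure_balanced[unfolded balanced_def, THEN conjunct1, rule_format]]
lemmas pure_add_right =
  additive_add[OF pure_balanced[unfolded balanced_def, THEN conjunct2, THEN conjunct1, rule_format]]
lemmas pure_balance = pure_balanced[unfolded balanced_def, THEN conjunct2, THEN conjunct2, rule_format]

end

section \<open>Universal property of the tensor product\<close>

context tensor_product
begin

interpretation T: abelian_group T by (rule T_abelian_group)

lemma frag_evaluationI:
  assumes "abelian_group X" "\<And>m n. m \<in> carrier M \<Longrightarrow> n \<in> carrier N \<Longrightarrow> b m n \<in> carrier X"
  shows "frag_evaluation X (carrier M) (carrier N) b"
  by (intro frag_evaluation.intro frag_evaluation_axioms.intro assms)

lemma balanced_evaluation:
  assumes "abelian_group X" "balanced R M ra N la X b"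
  shows "frag_evaluation X (carrier M) (carrier N) b"
  using assms by (intro frag_evaluationI) (auto simp: balanced_def additive_def)

lemma sweedler_closed:
  assumes "abelian_group X" "t \<in> carrier T"
    and "\<And>m n. m \<in> carrier M \<Longrightarrow> n \<in> carrier N \<Longrightarrow> b m n \<in> carrier X"
  shows "sweedler X b t \<in> carrier X"
  using frag_evaluation.frag_eval_closed[OF frag_evaluationI[OF assms(1,3)]] some_in_tensor[OF assms(2)]
  by (simp add: sweedler_frag_eval)

text \<open>No balancedness is needed here: \<open>sweedler\<close> evaluates one fixed representative.\<close>

lemma sweedler_apply:
  assumes "abelian_group X" "abelian_group Y" "t \<in> carrier T" "additive X Y f"
    and "\<And>m n. m \<in> carrier M \<Longrightarrow> n \<in> carrier N \<Longrightarrow> b m n \<in> carrier X"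
  shows "f (sweedler X b t) = sweedler Y (\<lambda>m n. f (b m n)) t"
  using frag_evaluation.frag_eval_additive[OF frag_evaluationI[OF assms(1,5)] assms(2,4)]
    some_in_tensor[OF assms(3)]
  by (simp add: sweedler_frag_eval)

text \<open>The formal sums that evaluate to zero form a subgroup, and biadditivity together with
  balancing says that it contains the generators of \<open>null\<close>.\<close>

lemma frag_eval_null:
  assumes X: "abelian_group X" and bal: "balanced R M ra N la X b" and z: "z \<in> null"
  shows "frag_eval X b z = \<zero>\<^bsub>X\<^esub>"
proof -
  interpret X: frag_evaluation X "carrier M" "carrier N" b by (rule balanced_evaluation[OF X bal])
  let ?K = "{z \<in> carrier F. frag_eval X b z = \<zero>\<^bsub>X\<^esub>}"
  have "subgroup ?K F"
  proof (rule group.subgroupI[OF group_free_Abelian_group])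
    show "?K \<noteq> {}" by (auto intro!: exI[of _ 0] simp: X.frag_eval_zero)
    show "inv\<^bsub>F\<^esub> a \<in> ?K" if "a \<in> ?K" for a
      using that by (simp add: X.frag_eval_minus keys_minus)
    show "a \<otimes>\<^bsub>F\<^esub> c \<in> ?K" if "a \<in> ?K" "c \<in> ?K" for a c
      using that keys_add[of a c] by (auto simp: X.frag_eval_add)
  qed auto
  moreover have "tensor_relators R M ra N la \<subseteq> ?K"
  proof
    fix z assume z: "z \<in> tensor_relators R M ra N la"
    then have "z \<in> carrier F" using relators_subset by blast
    moreover have "frag_eval X b z = \<zero>\<^bsub>X\<^esub>"
    proof -
      have three: "frag_eval X b (frag_of p - frag_of q - frag_of r) = \<zero>\<^bsub>X\<^esub>"
        if "p \<in> carrier M \<times> carrier N" "q \<in> carrier M \<times> carrier N" "r \<in> carrier M \<times> carrier N"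
          and "b (fst p) (snd p) = b (fst q) (snd q) \<oplus>\<^bsub>X\<^esub> b (fst r) (snd r)" for p q r
      proof -
        have "Poly_Mapping.keys (frag_of q + frag_of r) \<subseteq> carrier M \<times> carrier N"
          using that keys_add[of "frag_of q" "frag_of r"] by auto
        then show ?thesis
          using that X.b_closed
          by (auto simp: diff_diff_eq X.frag_eval_diff X.frag_eval_add X.frag_eval_of a_minus_def
              X.r_neg)
      qed
      have two: "frag_eval X b (frag_of p - frag_of q) = \<zero>\<^bsub>X\<^esub>"
        if "p \<in> carrier M \<times> carrier N" "q \<in> carrier M \<times> carrier N"
          and "b (fst p) (snd p) = b (fst q) (snd q)" for p q
        using that X.b_closed
        by (auto simp: X.frag_eval_diff X.frag_eval_of a_minus_def X.r_neg)
      have b: "b (m \<oplus>\<^bsub>M\<^esub> m') n = b m n \<oplus>\<^bsub>X\<^esub> b m' n"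
        if "m \<in> carrier M" "m' \<in> carrier M" "n \<in> carrier N" for m m' n
        using that bal by (simp add: balanced_def additive_def)
      have b': "b m (n \<oplus>\<^bsub>N\<^esub> n') = b m n \<oplus>\<^bsub>X\<^esub> b m n'"
        if "m \<in> carrier M" "n' \<in> carrier N" "n \<in> carrier N" for m n' n
        using that bal by (simp add: balanced_def additive_def)
      have b'': "b (ra m r) n = b m (la r n)"
        if "m \<in> carrier M" "r \<in> carrier R" "n \<in> carrier N" for m r n
        using that bal by (simp add: balanced_def)
      show ?thesis
        using z unfolding tensor_relators_def
        apply (elim UnE CollectE exE conjE; simp only:)
          apply (rule three; simp add: b)
         apply (rule three; simp add: b')
        apply (rule two; simp add: b'' ra_closed la_closed)
        done
    qed
    ultimately show "z \<in> ?K" by simp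
  qed
  ultimately have "null \<subseteq> ?K"
    unfolding tensor_null_def by (intro group.generate_subgroup_incl[OF group_free_Abelian_group])
  then show ?thesis using z by blast
qed

text \<open>Two representatives differ by an element of \<open>null\<close>, on which
  \<open>b\<close> evaluates to zero. This is the point where the choice in \<open>sweedler\<close>
  becomes harmless.\<close>

lemma sweedler_coset:
  assumes X: "abelian_group X" and b: "balanced R M ra N la X b"
    and z: "Poly_Mapping.keys z \<subseteq> carrier M \<times> carrier N"
  shows "sweedler X b (coset z) = frag_eval X b z"
proof -
  interpret X: frag_evaluation X "carrier M" "carrier N" b by (rule balanced_evaluation[OF X b])
  define w where "w = (SOME w. w \<in> coset z)"
  have c: "coset z \<in> carrier T" by (rule coset_closed[OF z])
  have w: "Poly_Mapping.keys w \<subseteq> carrier M \<times> carrier N" "coset w = coset z"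
    using some_in_tensor[OF c] by (auto simp: w_def)
  have "w \<in> coset z"
    using group.rcos_self[OF group_free_Abelian_group, of w _ null] w null_subgroup by auto
  then obtain v where v: "v \<in> null" "w = v + z"
    unfolding r_coset_def by auto
  have "v \<in> carrier F" using v(1) null_subgroup subgroup.mem_carrier by metis
  then have "frag_eval X b w = frag_eval X b z"
    using v z frag_eval_null[OF X b v(1)] by (simp add: X.frag_eval_add X.frag_eval_closed)
  then show ?thesis by (simp add: sweedler_frag_eval w_def)
qed

lemma sweedler_pure:
  assumes X: "abelian_group X" and b: "balanced R M ra N la X b" and "m \<in> carrier M" "n \<in> carrier N"
  shows "sweedler X b (pure m n) = b m n"
  using frag_evaluation.frag_eval_of[OF balanced_evaluation[OF X b], of "(m, n)"]
    sweedler_coset[OF X b, of "frag_of (m, n)"] assms(3,4)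
  by (simp add: pure_tensor_def)

text \<open>The representatives chosen for \<open>t\<close>, \<open>u\<close> and their sum are
  unrelated, so this rests on balancedness, in contrast to additivity in the summand.\<close>

lemma sweedler_additive:
  assumes X: "abelian_group X" and b: "balanced R M ra N la X b"
  shows "additive T X (sweedler X b)"
proof (rule additiveI)
  fix t u assume tu: "t \<in> carrier T" "u \<in> carrier T"
  obtain z w where z: "Poly_Mapping.keys z \<subseteq> carrier M \<times> carrier N" "t = coset z"
    and w: "Poly_Mapping.keys w \<subseteq> carrier M \<times> carrier N" "u = coset w"
    using tu carrier_T by auto
  have "Poly_Mapping.keys (z + w) \<subseteq> carrier M \<times> carrier N"
    using z w keys_add[of z w] by blast
  then show "sweedler X b (t \<oplus>\<^bsub>T\<^esub> u) = sweedler X b t \<oplus>\<^bsub>X\<^esub> sweedler X b u"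
    using z w sweedler_coset[OF X b] frag_evaluation.frag_eval_add[OF balanced_evaluation[OF X b]]
    by (simp flip: coset_add)
qed (use b sweedler_closed[OF X] in \<open>auto simp: balanced_def additive_def\<close>)

lemma sweedler_cong:
  assumes "abelian_group X" "t \<in> carrier T"
    and b: "\<And>m n. m \<in> carrier M \<Longrightarrow> n \<in> carrier N \<Longrightarrow> b m n \<in> carrier X"
    and c: "\<And>m n. m \<in> carrier M \<Longrightarrow> n \<in> carrier N \<Longrightarrow> b m n = c m n"
  shows "sweedler X b t = sweedler X c t"
proof -
  interpret X: abelian_group X by fact
  show ?thesis
    unfolding sweedler_def Let_def
  proof (rule X.finsum_cong')
    fix p assume "p \<in> Poly_Mapping.keys (SOME z. z \<in> t)"
    then have "p \<in> carrier M \<times> carrier N" using some_in_tensor[OF assms(2)] by blast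
    then show "[Poly_Mapping.lookup (SOME z. z \<in> t) p] \<cdot>\<^bsub>X\<^esub> b (fst p) (snd p) =
        [Poly_Mapping.lookup (SOME z. z \<in> t) p] \<cdot>\<^bsub>X\<^esub> c (fst p) (snd p)"
      using c by auto
  next
    show "(\<lambda>p. [Poly_Mapping.lookup (SOME z. z \<in> t) p] \<cdot>\<^bsub>X\<^esub> c (fst p) (snd p))
      \<in> Poly_Mapping.keys (SOME z. z \<in> t) \<rightarrow> carrier X"
    proof
      fix p assume "p \<in> Poly_Mapping.keys (SOME z. z \<in> t)"
      then have "p \<in> carrier M \<times> carrier N" using some_in_tensor[OF assms(2)] by blast
      then have "c (fst p) (snd p) \<in> carrier X" using b[of "fst p" "snd p"] c by auto
      then show "[Poly_Mapping.lookup (SOME z. z \<in> t) p] \<cdot>\<^bsub>X\<^esub> c (fst p) (snd p) \<in> carrier X"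
        by (rule X.int_multiple_closed)
    qed
  qed simp
qed

text \<open>Every tensor is the sum of the pure tensors of its representative; hence additive maps
  on a tensor product are determined by their values on pure tensors.\<close>

lemma sweedler_pure_self:
  assumes t: "t \<in> carrier T"
  shows "sweedler T pure t = t"
proof -
  interpret P: frag_evaluation T "carrier M" "carrier N" pure
    by (rule balanced_evaluation) (auto simp: pure_balanced T_abelian_group)
  have "frag_eval T pure z = coset z" if "Poly_Mapping.keys z \<subseteq> carrier M \<times> carrier N" for z
    using that
  proof (induction z rule: free_Abelian_group_induct[consumes 1, case_names 1 2 3])
    case 1
    then show ?case by (simp add: P.frag_eval_zero coset_zero)
  next
    case (2 x y)
    then show ?case by (simp add: P.frag_eval_diff coset_diff)
  next
    case (3 a)
    then show ?case by (simp add: P.frag_eval_of) (simp add: pure_tensor_def)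
  qed
  then show ?thesis using some_in_tensor[OF t] by (simp add: sweedler_frag_eval)
qed

text \<open>All three sums run over the same representative of \<open>t\<close>: this is additivity
  of evaluation in the function, not in the tensor.\<close>

lemma sweedler_add_fun:
  assumes X: "abelian_group X" and t: "t \<in> carrier T"
    and b: "\<And>m n. m \<in> carrier M \<Longrightarrow> n \<in> carrier N \<Longrightarrow> b m n \<in> carrier X"
    and c: "\<And>m n. m \<in> carrier M \<Longrightarrow> n \<in> carrier N \<Longrightarrow> c m n \<in> carrier X"
  shows "sweedler X (\<lambda>m n. b m n \<oplus>\<^bsub>X\<^esub> c m n) t = sweedler X b t \<oplus>\<^bsub>X\<^esub> sweedler X c t"
proof -
  interpret X: abelian_group X by fact
  interpret b: frag_evaluation X "carrier M" "carrier N" b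
    by unfold_locales (rule b)
  interpret c: frag_evaluation X "carrier M" "carrier N" c
    by unfold_locales (rule c)
  interpret bc: frag_evaluation X "carrier M" "carrier N" "\<lambda>m n. b m n \<oplus>\<^bsub>X\<^esub> c m n"
    by unfold_locales (simp add: b c)
  have "frag_eval X (\<lambda>m n. b m n \<oplus>\<^bsub>X\<^esub> c m n) z = frag_eval X b z \<oplus>\<^bsub>X\<^esub> frag_eval X c z"
    if "Poly_Mapping.keys z \<subseteq> carrier M \<times> carrier N" for z
    using that
  proof (induction z rule: free_Abelian_group_induct[consumes 1, case_names 1 2 3])
    case 1
    then show ?case by (simp add: b.frag_eval_zero c.frag_eval_zero bc.frag_eval_zero)
  next
    case (2 x y)
    then show ?case
      by (simp add: b.frag_eval_diff c.frag_eval_diff bc.frag_eval_diff a_minus_def X.minus_add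
          b.frag_eval_closed c.frag_eval_closed X.a_ac)
  next
    case (3 a)
    then show ?case by (simp add: b.frag_eval_of c.frag_eval_of bc.frag_eval_of)
  qed
  then show ?thesis using some_in_tensor[OF t] by (simp add: sweedler_frag_eval)
qed

lemma tensor_additive_eqI:
  assumes "abelian_group X" "additive T X f" "additive T X g"
    and "\<And>m n. m \<in> carrier M \<Longrightarrow> n \<in> carrier N \<Longrightarrow> f (pure m n) = g (pure m n)"
    and t: "t \<in> carrier T"
  shows "f t = g t"
proof -
  have "f t = sweedler X (\<lambda>m n. f (pure m n)) t"
    using sweedler_apply[OF T_abelian_group assms(1) t assms(2), of pure] sweedler_pure_self[OF t]
    by (simp add: pure_closed)
  also have "\<dots> = sweedler X (\<lambda>m n. g (pure m n)) t"
    by (rule sweedler_cong[OF assms(1) t])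
       (use assms in \<open>auto simp: pure_closed additive_closed\<close>)
  also have "\<dots> = g t"
    using sweedler_apply[OF T_abelian_group assms(1) t assms(3), of pure] sweedler_pure_self[OF t]
    by (simp add: pure_closed)
  finally show ?thesis .
qed

end

text \<open>Fubini for two fixed representatives. The induction runs over the formal sum that
  represents \<open>t\<close>, while \<open>u\<close> is treated with the rules for the
  summand.\<close>

lemma sweedler_swap:
  assumes "tensor_product R M ra N la" "tensor_product R' M' ra' N' la'" "abelian_group X"
    and t: "t \<in> carrier (tensor_group R M ra N la)" and u: "u \<in> carrier (tensor_group R' M' ra' N' la')"
    and b: "\<And>m n m' n'. m \<in> carrier M \<Longrightarrow> n \<in> carrier N \<Longrightarrow> m' \<in> carrier M' \<Longrightarrow> n' \<in> carrier N' \<Longrightarrow>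
      b m n m' n' \<in> carrier X"
  shows "sweedler X (\<lambda>m n. sweedler X (\<lambda>m' n'. b m n m' n') u) t =
    sweedler X (\<lambda>m' n'. sweedler X (\<lambda>m n. b m n m' n') t) u"
proof -
  interpret t: tensor_product R M ra N la by fact
  interpret u: tensor_product R' M' ra' N' la' by fact
  interpret X: abelian_group X by fact
  have fe: "frag_evaluation X (carrier M) (carrier N) (\<lambda>m n. b m n m' n')"
    if "m' \<in> carrier M'" "n' \<in> carrier N'" for m' n'
    by unfold_locales (simp add: b that)
  have uc: "sweedler X (\<lambda>m' n'. c m' n') u \<in> carrier X"
    if "\<And>m' n'. m' \<in> carrier M' \<Longrightarrow> n' \<in> carrier N' \<Longrightarrow> c m' n' \<in> carrier X" for c
    by (rule u.sweedler_closed[OF assms(3) u that])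
  interpret e: frag_evaluation X "carrier M" "carrier N" "\<lambda>m n. sweedler X (\<lambda>m' n'. b m n m' n') u"
    by unfold_locales (simp add: b uc)
  have "frag_eval X (\<lambda>m n. sweedler X (\<lambda>m' n'. b m n m' n') u) z =
      sweedler X (\<lambda>m' n'. frag_eval X (\<lambda>m n. b m n m' n') z) u"
    if "Poly_Mapping.keys z \<subseteq> carrier M \<times> carrier N" for z
    using that
  proof (induction z rule: free_Abelian_group_induct[consumes 1, case_names 1 2 3])
    case 1
    have "sweedler X (\<lambda>m' n'. \<zero>\<^bsub>X\<^esub>) u = \<zero>\<^bsub>X\<^esub>"
      by (simp add: sweedler_def)
    then show ?case by (simp add: frag_eval_def)
  next
    case (2 x y)
    \<comment> \<open>Over \<open>u\<close> there is a rule for sums of summands, so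
      \<open>x\<close> is split as \<open>(x - y) + y\<close> and the difference is recovered by
      cancelling.\<close>
    have "sweedler X (\<lambda>m' n'. frag_eval X (\<lambda>m n. b m n m' n') x) u =
        sweedler X (\<lambda>m' n'. frag_eval X (\<lambda>m n. b m n m' n') (x - y) \<oplus>\<^bsub>X\<^esub>
          frag_eval X (\<lambda>m n. b m n m' n') y) u"
    proof (rule u.sweedler_cong[OF assms(3) u])
      fix m' n' assume mn: "m' \<in> carrier M'" "n' \<in> carrier N'"
      interpret c: frag_evaluation X "carrier M" "carrier N" "\<lambda>m n. b m n m' n'" by (rule fe[OF mn])
      show "frag_eval X (\<lambda>m n. b m n m' n') x \<in> carrier X"
        using 2 c.frag_eval_closed by simp
      show "frag_eval X (\<lambda>m n. b m n m' n') x = frag_eval X (\<lambda>m n. b m n m' n') (x - y) \<oplus>\<^bsub>X\<^esub>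
          frag_eval X (\<lambda>m n. b m n m' n') y"
        using c.frag_eval_add[of "x - y" y] 2 keys_diff[of x y] by auto
    qed
    also have "\<dots> = sweedler X (\<lambda>m' n'. frag_eval X (\<lambda>m n. b m n m' n') (x - y)) u \<oplus>\<^bsub>X\<^esub>
        sweedler X (\<lambda>m' n'. frag_eval X (\<lambda>m n. b m n m' n') y) u"
      by (rule u.sweedler_add_fun[OF assms(3) u])
        (use 2 keys_diff[of x y] frag_evaluation.frag_eval_closed[OF fe] in \<open>blast+\<close>)
    finally have *: "sweedler X (\<lambda>m' n'. frag_eval X (\<lambda>m n. b m n m' n') x) u = \<dots>" .
    have "sweedler X (\<lambda>m' n'. frag_eval X (\<lambda>m n. b m n m' n') (x - y)) u \<in> carrier X"
      "sweedler X (\<lambda>m' n'. frag_eval X (\<lambda>m n. b m n m' n') y) u \<in> carrier X"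
      by (rule uc; use 2 keys_diff[of x y] frag_evaluation.frag_eval_closed[OF fe] in blast)+
    then show ?case
      using 2 * by (simp add: e.frag_eval_diff a_minus_def X.a_assoc X.r_neg)
  next
    case (3 a)
    then show ?case
      by (simp add: e.frag_eval_of)
         (rule u.sweedler_cong[OF assms(3) u];
          use 3 frag_evaluation.frag_eval_of[OF fe] b in \<open>force\<close>)
  qed
  then show ?thesis using t.some_in_tensor[OF t] by (simp add: sweedler_frag_eval[of X _ t])
qed

section \<open>Threefold tensor products\<close>

lemma tensor_simps [simp]:
  "carrier (tensor R M ra N la) = carrier (tensor_group R M ra N la)"
  "ring.add (tensor R M ra N la) = ring.add (tensor_group R M ra N la)"
  "ring.zero (tensor R M ra N la) = ring.zero (tensor_group R M ra N la)"
  by (simp_all add: tensor_def Let_def)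

lemma tensor_A_simps [simp]:
  "carrier (tensor_A H A M N) = carrier (tensor_group A M (ract M) N (lact N))"
  "ring.add (tensor_A H A M N) = ring.add (tensor_group A M (ract M) N (lact N))"
  "ring.zero (tensor_A H A M N) = ring.zero (tensor_group A M (ract M) N (lact N))"
  by (simp_all add: tensor_A_def Let_def)

lemma tensor_A_bimod_simps [simp]:
  "carrier (tensor_A_bimod H A M N) = carrier (tensor_group A M (ract M) N (lact N))"
  "ring.add (tensor_A_bimod H A M N) = ring.add (tensor_group A M (ract M) N (lact N))"
  "ring.zero (tensor_A_bimod H A M N) = ring.zero (tensor_group A M (ract M) N (lact N))"
  by (simp_all add: tensor_A_bimod_def Let_def)

lemma abelian_group_cong:
  assumes X: "abelian_group X" and "carrier Y = carrier X" "ring.add Y = ring.add X" "ring.zero Y = ring.zero X"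
  shows "abelian_group Y"
proof -
  interpret X: abelian_group X by fact
  show ?thesis
  proof (rule abelian_groupI; simp only: assms(2-))
    fix x assume "x \<in> carrier X"
    then show "\<exists>y\<in>carrier X. y \<oplus>\<^bsub>X\<^esub> x = \<zero>\<^bsub>X\<^esub>"
      by (intro bexI[of _ "\<ominus>\<^bsub>X\<^esub> x"] X.l_neg X.a_inv_closed)
  qed (simp_all add: X.a_ac)
qed

text \<open>\<open>tensor_group\<close>, \<open>tensor\<close>, \<open>tensor_A\<close> and
  \<open>tensor_A_bimod\<close> are different records around one additive group, and the definitions
  mix them as targets of sums.\<close>

lemma (in tensor_product) sweedler_target:
  assumes X: "abelian_group X" and "carrier Y = carrier X" "ring.add Y = ring.add X" "ring.zero Y = ring.zero X"
    and t: "t \<in> carrier T"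
    and b: "\<And>m n. m \<in> carrier M \<Longrightarrow> n \<in> carrier N \<Longrightarrow> b m n \<in> carrier X"
  shows "sweedler Y b t = sweedler X b t"
proof -
  have "additive X Y (\<lambda>x. x)" using assms by (auto simp: additive_def)
  from sweedler_apply[OF X abelian_group_cong[OF assms(1-4)] t this b] show ?thesis by simp
qed

definition balanced3 ::
  "('r, 'v) ring_scheme \<Rightarrow> ('m, 'z) ring_scheme \<Rightarrow> ('m \<Rightarrow> 'r \<Rightarrow> 'm) \<Rightarrow>
   ('n, 'w) ring_scheme \<Rightarrow> ('r \<Rightarrow> 'n \<Rightarrow> 'n) \<Rightarrow> ('n \<Rightarrow> 'r \<Rightarrow> 'n) \<Rightarrow>
   ('p, 'u) ring_scheme \<Rightarrow> ('r \<Rightarrow> 'p \<Rightarrow> 'p) \<Rightarrow>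
   ('x, 'y) ring_scheme \<Rightarrow> ('m \<Rightarrow> 'n \<Rightarrow> 'p \<Rightarrow> 'x) \<Rightarrow> bool" where
  "balanced3 R M rm N ln rn P lp X b \<longleftrightarrow>
     (\<forall>n\<in>carrier N. \<forall>p\<in>carrier P. additive M X (\<lambda>m. b m n p)) \<and>
     (\<forall>m\<in>carrier M. \<forall>p\<in>carrier P. additive N X (\<lambda>n. b m n p)) \<and>
     (\<forall>m\<in>carrier M. \<forall>n\<in>carrier N. additive P X (b m n)) \<and>
     (\<forall>m\<in>carrier M. \<forall>r\<in>carrier R. \<forall>n\<in>carrier N. \<forall>p\<in>carrier P. b (rm m r) n p = b m (ln r n) p) \<and>
     (\<forall>m\<in>carrier M. \<forall>r\<in>carrier R. \<forall>n\<in>carrier N. \<forall>p\<in>carrier P. b m (rn n r) p = b m n (lp r p))"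

lemma balanced3I:
  assumes "\<And>n p. n \<in> carrier N \<Longrightarrow> p \<in> carrier P \<Longrightarrow> additive M X (\<lambda>m. b m n p)"
    and "\<And>m p. m \<in> carrier M \<Longrightarrow> p \<in> carrier P \<Longrightarrow> additive N X (\<lambda>n. b m n p)"
    and "\<And>m n. m \<in> carrier M \<Longrightarrow> n \<in> carrier N \<Longrightarrow> additive P X (b m n)"
    and "\<And>m r n p. m \<in> carrier M \<Longrightarrow> r \<in> carrier R \<Longrightarrow> n \<in> carrier N \<Longrightarrow> p \<in> carrier P \<Longrightarrow>
      b (rm m r) n p = b m (ln r n) p"
    and "\<And>m r n p. m \<in> carrier M \<Longrightarrow> r \<in> carrier R \<Longrightarrow> n \<in> carrier N \<Longrightarrow> p \<in> carrier P \<Longrightarrow>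
      b m (rn n r) p = b m n (lp r p)"
  shows "balanced3 R M rm N ln rn P lp X b"
  using assms by (simp add: balanced3_def)

text \<open>
  \<open>T'\<close> and \<open>L\<close> stand for the variants of \<open>N \<otimes> P\<close> and its left action that occur in the
  coassociativity axioms, namely \<open>tensor_k\<close> and \<open>tensor_A_bimod\<close>.
\<close>

locale triple_tensor = M: abelian_group M + NP: tensor_product R N rn P lp
  for R :: "('r, 'v) ring_scheme" and M :: "('m, 'z) ring_scheme" and rm :: "'m \<Rightarrow> 'r \<Rightarrow> 'm"
    and N :: "('n, 'w) ring_scheme" and ln :: "'r \<Rightarrow> 'n \<Rightarrow> 'n" and rn :: "'n \<Rightarrow> 'r \<Rightarrow> 'n"
    and P :: "('p, 'u) ring_scheme" and lp :: "'r \<Rightarrow> 'p \<Rightarrow> 'p" +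
  fixes T' :: "(('n, 'p) tens, 'y) ring_scheme" and L :: "'r \<Rightarrow> ('n, 'p) tens \<Rightarrow> ('n, 'p) tens"
  assumes rm_closed: "m \<in> carrier M \<Longrightarrow> r \<in> carrier R \<Longrightarrow> rm m r \<in> carrier M"
    and ln_additive: "r \<in> carrier R \<Longrightarrow> additive N N (ln r)"
    and ln_rn: "r \<in> carrier R \<Longrightarrow> n \<in> carrier N \<Longrightarrow> s \<in> carrier R \<Longrightarrow> ln r (rn n s) = rn (ln r n) s"
    and carrier_T': "carrier T' = carrier (tensor_group R N rn P lp)"
    and add_T': "ring.add T' = ring.add (tensor_group R N rn P lp)"
    and zero_T': "ring.zero T' = ring.zero (tensor_group R N rn P lp)"
    and L: "r \<in> carrier R \<Longrightarrow> t \<in> carrier T' \<Longrightarrow>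
      L r t = sweedler T' (\<lambda>n p. pure_tensor R N rn P lp (ln r n) p) t"
begin

abbreviation "pure_NP \<equiv> pure_tensor R N rn P lp"

lemma abelian_group_T': "abelian_group T'"
  by (rule abelian_group_cong[OF NP.T_abelian_group carrier_T' add_T' zero_T'])

lemma pure_NP_closed: "n \<in> carrier N \<Longrightarrow> p \<in> carrier P \<Longrightarrow> pure_NP n p \<in> carrier T'"
  by (simp add: carrier_T' NP.pure_closed)

lemma ln_closed: "n \<in> carrier N \<Longrightarrow> r \<in> carrier R \<Longrightarrow> ln r n \<in> carrier N"
  by (rule additive_closed[OF ln_additive])

lemma L_closed: "r \<in> carrier R \<Longrightarrow> t \<in> carrier T' \<Longrightarrow> L r t \<in> carrier T'"
  unfolding L by (rule NP.sweedler_closed[OF abelian_group_T'])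
    (auto simp: carrier_T' NP.pure_closed ln_closed)

sublocale MNP: tensor_product R M rm T' L
  by (intro tensor_product.intro M.abelian_group_axioms abelian_group_T' tensor_product_axioms.intro
      rm_closed L_closed)

text \<open>\<open>L\<close> is itself a Sweedler sum over the chosen representative; balancedness
  of \<open>b\<close> allows evaluating the tensor it produces.\<close>

lemma sweedler_L:
  assumes X: "abelian_group X" and b: "balanced R N rn P lp X b" and r: "r \<in> carrier R" and t: "t \<in> carrier T'"
  shows "sweedler X b (L r t) = sweedler X (\<lambda>n p. b (ln r n) p) t"
proof -
  have a: "additive T' X (sweedler X b)"
    using NP.sweedler_additive[OF X b] by (simp add: additive_def carrier_T' add_T')
  have b_closed: "n \<in> carrier N \<Longrightarrow> p \<in> carrier P \<Longrightarrow> b n p \<in> carrier X" for n p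
    using b by (auto simp: balanced_def additive_def)
  have "sweedler X b (L r t) = sweedler X (\<lambda>n p. sweedler X b (pure_NP (ln r n) p)) t"
    unfolding L[OF r t]
    by (rule NP.sweedler_apply[OF abelian_group_T' X _ a])
       (use t r in \<open>auto simp: carrier_T' NP.pure_closed ln_closed\<close>)
  also have "\<dots> = sweedler X (\<lambda>n p. b (ln r n) p) t"
    by (rule NP.sweedler_cong[OF X])
       (use t r b_closed NP.sweedler_pure[OF X b] in \<open>auto simp: carrier_T' NP.pure_closed ln_closed\<close>)
  finally show ?thesis .
qed

text \<open>The universal property in two stages: balancing \<open>N\<close> against
  \<open>P\<close> lets \<open>b m\<close> descend to the inner tensor product, and balancing
  \<open>M\<close> against \<open>N\<close>, carried through \<open>L\<close>, lets the result
  descend to the outer one.\<close>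

lemma balanced_sweedler:
  assumes X: "abelian_group X" and b: "balanced3 R M rm N ln rn P lp X b"
  shows "balanced R M rm T' L X (\<lambda>m t. sweedler X (b m) t)"
proof (rule balancedI)
  have bal: "balanced R N rn P lp X (b m)" if "m \<in> carrier M" for m
    using b that by (simp add: balanced3_def balanced_def)
  have b_closed: "m \<in> carrier M \<Longrightarrow> n \<in> carrier N \<Longrightarrow> p \<in> carrier P \<Longrightarrow> b m n p \<in> carrier X" for m n p
    using b by (auto simp: balanced3_def additive_def)
  show "additive T' X (sweedler X (b m))" if "m \<in> carrier M" for m
    using NP.sweedler_additive[OF X bal[OF that]] by (simp add: additive_def carrier_T' add_T')
  show "additive M X (\<lambda>m. sweedler X (b m) t)" if t: "t \<in> carrier T'" for t
  proof (rule additiveI)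
    fix x y assume xy: "x \<in> carrier M" "y \<in> carrier M"
    have "sweedler X (b (x \<oplus>\<^bsub>M\<^esub> y)) t = sweedler X (\<lambda>n p. b x n p \<oplus>\<^bsub>X\<^esub> b y n p) t"
      by (rule NP.sweedler_cong[OF X])
         (use t xy b b_closed abelian_groupE(1)[OF X] in \<open>auto simp: carrier_T' balanced3_def additive_def\<close>)
    also have "\<dots> = sweedler X (b x) t \<oplus>\<^bsub>X\<^esub> sweedler X (b y) t"
      by (rule NP.sweedler_add_fun[OF X]) (use t xy b_closed in \<open>auto simp: carrier_T'\<close>)
    finally show "sweedler X (b (x \<oplus>\<^bsub>M\<^esub> y)) t = sweedler X (b x) t \<oplus>\<^bsub>X\<^esub> sweedler X (b y) t" .
  qed (rule NP.sweedler_closed[OF X], use t b_closed in \<open>auto simp: carrier_T'\<close>)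
  show "sweedler X (b (rm m r)) t = sweedler X (b m) (L r t)"
    if "m \<in> carrier M" "r \<in> carrier R" "t \<in> carrier T'" for m r t
    unfolding sweedler_L[OF X bal[OF that(1)] that(2,3)]
    by (rule NP.sweedler_cong[OF X])
       (use that b b_closed in \<open>auto simp: carrier_T' balanced3_def additive_def rm_closed ln_closed\<close>)
qed

lemma sweedler_pure_pure:
  assumes X: "abelian_group X" and b: "balanced3 R M rm N ln rn P lp X b"
    and "m \<in> carrier M" "n \<in> carrier N" "p \<in> carrier P"
  shows "sweedler X (\<lambda>m t. sweedler X (b m) t) (MNP.pure m (pure_NP n p)) = b m n p"
proof -
  have bal: "balanced R N rn P lp X (b m)"
    using b assms(3) by (simp add: balanced3_def balanced_def)
  show ?thesis
    using MNP.sweedler_pure[OF X balanced_sweedler[OF X b], of m "pure_NP n p"]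
      NP.sweedler_pure[OF X bal assms(4,5)] assms pure_NP_closed
    by simp
qed

text \<open>Membership is recorded too, since in the converse direction the two sides of
  coassociativity are tensors not yet known to be equal, compared through their evaluations.\<close>

lemma sweedler_nest_left:
  assumes Y: "abelian_group Y" "carrier Y = carrier MNP.T" "ring.add Y = ring.add MNP.T"
    and X: "abelian_group X" and b: "balanced3 R M rm N ln rn P lp X b"
    and MP: "tensor_product R M rm P lp" and MN: "tensor_product R M rm N ln"
    and t: "t \<in> carrier (tensor_group R M rm P lp)"
    and D: "\<And>m. m \<in> carrier M \<Longrightarrow> D m \<in> carrier (tensor_group R M rm N ln)"
  shows "sweedler Y (\<lambda>m0 m1. sweedler Y (\<lambda>m00 m01. MNP.pure m00 (pure_NP m01 m1)) (D m0)) t \<in> carrier MNP.T"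
    and "sweedler X (\<lambda>m t. sweedler X (b m) t)
        (sweedler Y (\<lambda>m0 m1. sweedler Y (\<lambda>m00 m01. MNP.pure m00 (pure_NP m01 m1)) (D m0)) t) =
      sweedler X (\<lambda>m0 m1. sweedler X (\<lambda>m00 m01. b m00 m01 m1) (D m0)) t"
proof -
  interpret MP: tensor_product R M rm P lp by fact
  interpret MN: tensor_product R M rm N ln by fact
  have b_closed: "m \<in> carrier M \<Longrightarrow> n \<in> carrier N \<Longrightarrow> p \<in> carrier P \<Longrightarrow> b m n p \<in> carrier X" for m n p
    using b by (auto simp: balanced3_def additive_def)
  let ?f = "sweedler X (\<lambda>m t. sweedler X (b m) t)"
  have f: "additive Y X ?f"
    using MNP.sweedler_additive[OF X balanced_sweedler[OF X b]] by (simp add: additive_def Y)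
  have pc: "MNP.pure m (pure_NP n p) \<in> carrier Y"
    if "m \<in> carrier M" "n \<in> carrier N" "p \<in> carrier P" for m n p
    using that by (simp add: Y MNP.pure_closed pure_NP_closed)
  have c: "sweedler Y (\<lambda>m00 m01. MNP.pure m00 (pure_NP m01 p)) (D m) \<in> carrier Y"
    if "m \<in> carrier M" "p \<in> carrier P" for m p
    by (rule MN.sweedler_closed[OF Y(1)]) (use D that pc in auto)
  have "sweedler Y (\<lambda>m0 m1. sweedler Y (\<lambda>m00 m01. MNP.pure m00 (pure_NP m01 m1)) (D m0)) t \<in> carrier Y"
    by (rule MP.sweedler_closed[OF Y(1) t]) (rule c)
  then show "sweedler Y (\<lambda>m0 m1. sweedler Y (\<lambda>m00 m01. MNP.pure m00 (pure_NP m01 m1)) (D m0)) t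
      \<in> carrier MNP.T"
    by (simp add: Y)
  have "?f (sweedler Y (\<lambda>m0 m1. sweedler Y (\<lambda>m00 m01. MNP.pure m00 (pure_NP m01 m1)) (D m0)) t) =
      sweedler X (\<lambda>m0 m1. ?f (sweedler Y (\<lambda>m00 m01. MNP.pure m00 (pure_NP m01 m1)) (D m0))) t"
    by (rule MP.sweedler_apply[OF Y(1) X t f]) (rule c)
  also have "\<dots> = sweedler X (\<lambda>m0 m1. sweedler X (\<lambda>m00 m01. b m00 m01 m1) (D m0)) t"
  proof (rule MP.sweedler_cong[OF X t])
    fix m p assume mp: "m \<in> carrier M" "p \<in> carrier P"
    have "?f (sweedler Y (\<lambda>m00 m01. MNP.pure m00 (pure_NP m01 p)) (D m)) =
      sweedler X (\<lambda>m00 m01. ?f (MNP.pure m00 (pure_NP m01 p))) (D m)"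
      by (rule MN.sweedler_apply[OF Y(1) X D f]) (use mp pc in auto)
    also have "\<dots> = sweedler X (\<lambda>m00 m01. b m00 m01 p) (D m)"
      by (rule MN.sweedler_cong[OF X D])
         (use mp sweedler_pure_pure[OF X b] b_closed in auto)
    finally show "?f (sweedler Y (\<lambda>m00 m01. MNP.pure m00 (pure_NP m01 p)) (D m)) =
      sweedler X (\<lambda>m00 m01. b m00 m01 p) (D m)" .
    then show "?f (sweedler Y (\<lambda>m00 m01. MNP.pure m00 (pure_NP m01 p)) (D m)) \<in> carrier X"
      using MN.sweedler_closed[OF X D] mp b_closed by simp
  qed
  finally show "?f (sweedler Y (\<lambda>m0 m1. sweedler Y (\<lambda>m00 m01. MNP.pure m00 (pure_NP m01 m1)) (D m0)) t) =
      \<dots>" .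
qed

lemma sweedler_nest_right:
  assumes Y: "abelian_group Y" "carrier Y = carrier MNP.T" "ring.add Y = ring.add MNP.T"
    and X: "abelian_group X" and b: "balanced3 R M rm N ln rn P lp X b"
    and MP: "tensor_product R M rm P lp"
    and t: "t \<in> carrier (tensor_group R M rm P lp)"
    and D': "\<And>p. p \<in> carrier P \<Longrightarrow> D' p \<in> carrier T'"
  shows "sweedler Y (\<lambda>m0 m1. MNP.pure m0 (D' m1)) t \<in> carrier MNP.T"
    and "sweedler X (\<lambda>m t. sweedler X (b m) t) (sweedler Y (\<lambda>m0 m1. MNP.pure m0 (D' m1)) t) =
      sweedler X (\<lambda>m0 m1. sweedler X (b m0) (D' m1)) t"
proof -
  interpret MP: tensor_product R M rm P lp by fact
  have b_closed: "m \<in> carrier M \<Longrightarrow> n \<in> carrier N \<Longrightarrow> p \<in> carrier P \<Longrightarrow> b m n p \<in> carrier X" for m n p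
    using b by (auto simp: balanced3_def additive_def)
  let ?f = "sweedler X (\<lambda>m t. sweedler X (b m) t)"
  note bs = balanced_sweedler[OF X b]
  have f: "additive Y X ?f"
    using MNP.sweedler_additive[OF X bs] by (simp add: additive_def Y)
  have c: "MNP.pure m (D' p) \<in> carrier Y" if "m \<in> carrier M" "p \<in> carrier P" for m p
    using that by (simp add: Y MNP.pure_closed D')
  have "sweedler Y (\<lambda>m0 m1. MNP.pure m0 (D' m1)) t \<in> carrier Y"
    by (rule MP.sweedler_closed[OF Y(1) t]) (rule c)
  then show "sweedler Y (\<lambda>m0 m1. MNP.pure m0 (D' m1)) t \<in> carrier MNP.T" by (simp add: Y)
  have "?f (sweedler Y (\<lambda>m0 m1. MNP.pure m0 (D' m1)) t) = sweedler X (\<lambda>m0 m1. ?f (MNP.pure m0 (D' m1))) t"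
    by (rule MP.sweedler_apply[OF Y(1) X t f]) (rule c)
  also have "\<dots> = sweedler X (\<lambda>m0 m1. sweedler X (b m0) (D' m1)) t"
    by (rule MP.sweedler_cong[OF X t])
       (use MNP.sweedler_pure[OF X bs] D' b_closed NP.sweedler_closed[OF X] in \<open>auto simp: carrier_T'\<close>)
  finally show "?f (sweedler Y (\<lambda>m0 m1. MNP.pure m0 (D' m1)) t) = \<dots>" .
qed

text \<open>Coassociativity is an equation between triple tensors. Applying the map induced by
  \<open>b\<close> turns it into the rebracketing rule of Sweedler computations, for
  \<open>H\<close> and for comodules alike.\<close>

lemma sweedler_coassoc:
  assumes Y: "abelian_group Y" "carrier Y = carrier MNP.T" "ring.add Y = ring.add MNP.T"
    and X: "abelian_group X" and b: "balanced3 R M rm N ln rn P lp X b"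
    and MP: "tensor_product R M rm P lp" and MN: "tensor_product R M rm N ln"
    and t: "t \<in> carrier (tensor_group R M rm P lp)"
    and D: "\<And>m. m \<in> carrier M \<Longrightarrow> D m \<in> carrier (tensor_group R M rm N ln)"
    and D': "\<And>p. p \<in> carrier P \<Longrightarrow> D' p \<in> carrier T'"
    and eq: "sweedler Y (\<lambda>m0 m1. sweedler Y (\<lambda>m00 m01. MNP.pure m00 (pure_NP m01 m1)) (D m0)) t =
      sweedler Y (\<lambda>m0 m1. MNP.pure m0 (D' m1)) t"
  shows "sweedler X (\<lambda>m0 m1. sweedler X (\<lambda>m00 m01. b m00 m01 m1) (D m0)) t =
    sweedler X (\<lambda>m0 m1. sweedler X (b m0) (D' m1)) t"
  using sweedler_nest_left(2)[where D = D, OF Y X b MP MN t D]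
    sweedler_nest_right(2)[where D' = D', OF Y X b MP t D'] eq
  by simp

end

section \<open>Multilinear maps and Sweedler sums over a Hopf algebra\<close>

definition klin ::
  "('k, 'v) ring_scheme \<Rightarrow> ('k, 'm, 'z) module_scheme \<Rightarrow> ('k, 'x, 'w) module_scheme \<Rightarrow> ('m \<Rightarrow> 'x) \<Rightarrow> bool" where
  "klin k Y X f \<longleftrightarrow> additive Y X f \<and> (\<forall>c\<in>carrier k. \<forall>y\<in>carrier Y. f (c \<odot>\<^bsub>Y\<^esub> y) = c \<odot>\<^bsub>X\<^esub> f y)"

lemma klinI:
  assumes "\<And>y. y \<in> carrier Y \<Longrightarrow> f y \<in> carrier X"
    and "\<And>y z. y \<in> carrier Y \<Longrightarrow> z \<in> carrier Y \<Longrightarrow> f (y \<oplus>\<^bsub>Y\<^esub> z) = f y \<oplus>\<^bsub>X\<^esub> f z"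
    and "\<And>c y. c \<in> carrier k \<Longrightarrow> y \<in> carrier Y \<Longrightarrow> f (c \<odot>\<^bsub>Y\<^esub> y) = c \<odot>\<^bsub>X\<^esub> f y"
  shows "klin k Y X f"
  using assms by (auto simp: klin_def additive_def)

lemma klin_closed: "klin k Y X f \<Longrightarrow> y \<in> carrier Y \<Longrightarrow> f y \<in> carrier X"
  and klin_add: "klin k Y X f \<Longrightarrow> y \<in> carrier Y \<Longrightarrow> z \<in> carrier Y \<Longrightarrow> f (y \<oplus>\<^bsub>Y\<^esub> z) = f y \<oplus>\<^bsub>X\<^esub> f z"
  and klin_smult: "klin k Y X f \<Longrightarrow> c \<in> carrier k \<Longrightarrow> y \<in> carrier Y \<Longrightarrow> f (c \<odot>\<^bsub>Y\<^esub> y) = c \<odot>\<^bsub>X\<^esub> f y"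
  and klin_additive: "klin k Y X f \<Longrightarrow> additive Y X f"
  by (auto simp: klin_def additive_def)

lemma klin_left_linear: "left_linear k Y (smult Y) X (smult X) f \<Longrightarrow> klin k Y X f"
  by (auto simp: klin_def additive_def left_linear_def)

lemma klin_comp: "klin k X Z g \<Longrightarrow> klin k Y X f \<Longrightarrow> klin k Y Z (\<lambda>y. g (f y))"
  by (auto simp: klin_def additive_def Pi_iff)

lemma klin_id: "klin k X X (\<lambda>x. x)"
  by (auto simp: klin_def additive_def)

lemma klin_cong:
  assumes "module k Y" "klin k Y X f" "\<And>y. y \<in> carrier Y \<Longrightarrow> f y = g y"
  shows "klin k Y X g"
proof -
  interpret Y: module k Y by fact
  show ?thesis using assms(2,3) by (auto simp: klin_def additive_def Pi_iff)
qed

definition bilin ::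
  "('k, 'v) ring_scheme \<Rightarrow> ('k, 'm, 'z) module_scheme \<Rightarrow> ('k, 'n, 'u) module_scheme \<Rightarrow>
   ('k, 'x, 'w) module_scheme \<Rightarrow> ('m \<Rightarrow> 'n \<Rightarrow> 'x) \<Rightarrow> bool" where
  "bilin k M N X b \<longleftrightarrow> (\<forall>n\<in>carrier N. klin k M X (\<lambda>m. b m n)) \<and> (\<forall>m\<in>carrier M. klin k N X (b m))"

lemma bilinI:
  assumes "\<And>n. n \<in> carrier N \<Longrightarrow> klin k M X (\<lambda>m. b m n)" "\<And>m. m \<in> carrier M \<Longrightarrow> klin k N X (b m)"
  shows "bilin k M N X b"
  using assms by (simp add: bilin_def)

lemma bilin_closed: "bilin k M N X b \<Longrightarrow> m \<in> carrier M \<Longrightarrow> n \<in> carrier N \<Longrightarrow> b m n \<in> carrier X"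
  by (auto simp: bilin_def klin_def additive_def)

lemma bilin_left: "bilin k M N X b \<Longrightarrow> n \<in> carrier N \<Longrightarrow> klin k M X (\<lambda>m. b m n)"
  and bilin_right: "bilin k M N X b \<Longrightarrow> m \<in> carrier M \<Longrightarrow> klin k N X (b m)"
  by (auto simp: bilin_def)

lemma bilin_balanced: "bilin k M N X b \<Longrightarrow> balanced k M (\<lambda>m c. c \<odot>\<^bsub>M\<^esub> m) N (smult N) X b"
  by (intro balancedI) (auto simp: bilin_def klin_def)

definition trilin ::
  "('k, 'v) ring_scheme \<Rightarrow> ('k, 'm, 'z) module_scheme \<Rightarrow>
   ('k, 'x, 'w) module_scheme \<Rightarrow> ('m \<Rightarrow> 'm \<Rightarrow> 'm \<Rightarrow> 'x) \<Rightarrow> bool" where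
  "trilin k M X b \<longleftrightarrow>
    (\<forall>y\<in>carrier M. \<forall>z\<in>carrier M. klin k M X (\<lambda>x. b x y z) \<and> klin k M X (\<lambda>x. b y x z) \<and>
      klin k M X (\<lambda>x. b y z x))"

lemma trilinI:
  assumes "\<And>y z. y \<in> carrier M \<Longrightarrow> z \<in> carrier M \<Longrightarrow> klin k M X (\<lambda>x. b x y z)"
    and "\<And>y z. y \<in> carrier M \<Longrightarrow> z \<in> carrier M \<Longrightarrow> klin k M X (\<lambda>x. b y x z)"
    and "\<And>y z. y \<in> carrier M \<Longrightarrow> z \<in> carrier M \<Longrightarrow> klin k M X (\<lambda>x. b y z x)"
  shows "trilin k M X b"
  using assms by (simp add: trilin_def)

lemma trilin_closed:
  "trilin k M X b \<Longrightarrow> x \<in> carrier M \<Longrightarrow> y \<in> carrier M \<Longrightarrow> z \<in> carrier M \<Longrightarrow> b x y z \<in> carrier X"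
  using klin_closed[of k M X "\<lambda>x. b x y z" x] by (simp add: trilin_def)

lemma trilin_bilin:
  "trilin k M X b \<Longrightarrow> x \<in> carrier M \<Longrightarrow> bilin k M M X (b x)"
  by (auto simp: trilin_def bilin_def)

lemma trilin_balanced3:
  assumes "trilin k M X b"
  shows "balanced3 k M (\<lambda>m c. c \<odot>\<^bsub>M\<^esub> m) M (smult M) (\<lambda>m c. c \<odot>\<^bsub>M\<^esub> m) M (smult M) X b"
proof (rule balanced3I)
  show "b (c \<odot>\<^bsub>M\<^esub> x) y z = b x (c \<odot>\<^bsub>M\<^esub> y) z"
    if "x \<in> carrier M" "c \<in> carrier k" "y \<in> carrier M" "z \<in> carrier M" for x c y z
    using assms klin_smult[of k M X "\<lambda>x. b x y z" c x] klin_smult[of k M X "\<lambda>y. b x y z" c y] that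
    by (simp add: trilin_def)
  show "b x (c \<odot>\<^bsub>M\<^esub> y) z = b x y (c \<odot>\<^bsub>M\<^esub> z)"
    if "x \<in> carrier M" "c \<in> carrier k" "y \<in> carrier M" "z \<in> carrier M" for x c y z
    using assms klin_smult[of k M X "\<lambda>y. b x y z" c y] klin_smult[of k M X "b x y" c z] that
    by (simp add: trilin_def)
qed (use assms in \<open>auto simp: trilin_def intro: klin_additive\<close>)

text \<open>The default value \<open>\<zero>\<close> makes congruence and closure unconditional.\<close>

definition SH :: "('k, 'h) hopf \<Rightarrow> ('x, 'w) ring_scheme \<Rightarrow> ('h \<Rightarrow> 'h \<Rightarrow> 'x) \<Rightarrow> 'h \<Rightarrow> 'x" where
  "SH H X b h = (if h \<in> carrier H \<and> (\<forall>x\<in>carrier H. \<forall>y\<in>carrier H. b x y \<in> carrier X)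
     then sweedler X b (Delta_H H h) else \<zero>\<^bsub>X\<^esub>)"

section \<open>Sweedler sums over the coproduct of \<open>H\<close>\<close>

context hopf_algebra
begin

abbreviation "ksr \<equiv> \<lambda>m c. c \<odot> m"

lemma module_H: "module k H" ..

lemma tensor_product_H: "tensor_product k H ksr H (smult H)"
  by unfold_locales auto

lemma Delta_closed: "h \<in> carrier H \<Longrightarrow> Delta_H H h \<in> carrier (tensor_group k H ksr H (smult H))"
  using Delta_linear by (auto simp: left_linear_def)

lemma eps_closed: "h \<in> carrier H \<Longrightarrow> eps_H H h \<in> carrier k"
  and eps_add: "h \<in> carrier H \<Longrightarrow> g \<in> carrier H \<Longrightarrow> eps_H H (h \<oplus> g) = eps_H H h \<oplus>\<^bsub>k\<^esub> eps_H H g"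
  and eps_smult: "h \<in> carrier H \<Longrightarrow> c \<in> carrier k \<Longrightarrow> eps_H H (c \<odot> h) = c \<otimes>\<^bsub>k\<^esub> eps_H H h"
  and eps_mult: "h \<in> carrier H \<Longrightarrow> g \<in> carrier H \<Longrightarrow> eps_H H (h \<otimes> g) = eps_H H h \<otimes>\<^bsub>k\<^esub> eps_H H g"
  and eps_one: "eps_H H \<one> = \<one>\<^bsub>k\<^esub>"
  using eps_linear eps_ring_hom by (auto simp: left_linear_def ring_hom_def)

lemma antipode_klin: "klin k H H (S_H H)"
  by (rule klin_left_linear[OF antipode_linear])

lemma antipode_closed: "h \<in> carrier H \<Longrightarrow> S_H H h \<in> carrier H"
  by (rule klin_closed[OF antipode_klin])

lemma SH_eq:
  assumes "h \<in> carrier H" "\<And>x y. x \<in> carrier H \<Longrightarrow> y \<in> carrier H \<Longrightarrow> b x y \<in> carrier X"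
  shows "SH H X b h = sweedler X b (Delta_H H h)"
  using assms by (simp add: SH_def)

lemma SH_closed:
  assumes "abelian_group X"
  shows "SH H X b h \<in> carrier X"
  using tensor_product.sweedler_closed[OF tensor_product_H assms Delta_closed] assms abelian_groupE(2)
  unfolding SH_def by (smt (verit))

lemma SH_cong:
  assumes "abelian_group X" "\<And>x y. x \<in> carrier H \<Longrightarrow> y \<in> carrier H \<Longrightarrow> b x y = b' x y"
  shows "SH H X b h = SH H X b' h"
proof (cases "h \<in> carrier H \<and> (\<forall>x\<in>carrier H. \<forall>y\<in>carrier H. b x y \<in> carrier X)")
  case True
  then show ?thesis
    using assms tensor_product.sweedler_cong[OF tensor_product_H assms(1) Delta_closed, of h b b']
    by (simp add: SH_def)
next
  case False
  then show ?thesis using assms(2) by (auto simp: SH_def)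
qed

lemma SH_apply:
  assumes "abelian_group X" "abelian_group Y" "additive X Y f" "h \<in> carrier H"
    and "\<And>x y. x \<in> carrier H \<Longrightarrow> y \<in> carrier H \<Longrightarrow> b x y \<in> carrier X"
  shows "f (SH H X b h) = SH H Y (\<lambda>x y. f (b x y)) h"
proof -
  have "f (b x y) \<in> carrier Y" if "x \<in> carrier H" "y \<in> carrier H" for x y
    using assms that additive_closed by metis
  then show ?thesis
    using tensor_product.sweedler_apply[OF tensor_product_H assms(1,2) Delta_closed assms(3), of h b] assms
    by (simp add: SH_eq)
qed

lemma SH_add_fun:
  assumes "abelian_group X"
    and "\<And>x y. x \<in> carrier H \<Longrightarrow> y \<in> carrier H \<Longrightarrow> b x y \<in> carrier X"
    and "\<And>x y. x \<in> carrier H \<Longrightarrow> y \<in> carrier H \<Longrightarrow> c x y \<in> carrier X" and "h \<in> carrier H"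
  shows "SH H X (\<lambda>x y. b x y \<oplus>\<^bsub>X\<^esub> c x y) h = SH H X b h \<oplus>\<^bsub>X\<^esub> SH H X c h"
  using tensor_product.sweedler_add_fun[OF tensor_product_H assms(1) Delta_closed, of h b c] assms
  by (simp add: SH_eq abelian_groupE(1))

lemma SH_SH_eq:
  assumes X: "abelian_group X" and h: "h \<in> carrier H"
    and g: "\<And>x y. x \<in> carrier H \<Longrightarrow> y \<in> carrier H \<Longrightarrow> g x y \<in> carrier H"
    and b: "\<And>x y u v. x \<in> carrier H \<Longrightarrow> y \<in> carrier H \<Longrightarrow> u \<in> carrier H \<Longrightarrow> v \<in> carrier H \<Longrightarrow>
      b x y u v \<in> carrier X"
  shows "SH H X (\<lambda>x y. SH H X (b x y) (g x y)) h =
    sweedler X (\<lambda>x y. sweedler X (b x y) (Delta_H H (g x y))) (Delta_H H h)"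
proof -
  have "SH H X (\<lambda>x y. SH H X (b x y) (g x y)) h =
      sweedler X (\<lambda>x y. SH H X (b x y) (g x y)) (Delta_H H h)"
    using h by (simp add: SH_eq SH_closed[OF X])
  also have "\<dots> = sweedler X (\<lambda>x y. sweedler X (b x y) (Delta_H H (g x y))) (Delta_H H h)"
  proof (rule tensor_product.sweedler_cong[OF tensor_product_H X Delta_closed[OF h]])
    show "SH H X (b x y) (g x y) \<in> carrier X" for x y by (rule SH_closed[OF X])
    show "SH H X (b x y) (g x y) = sweedler X (b x y) (Delta_H H (g x y))"
      if "x \<in> carrier H" "y \<in> carrier H" for x y
      by (rule SH_eq) (use that g b in auto)
  qed
  finally show ?thesis .
qed

lemma SH_swap:
  assumes "abelian_group X" "h \<in> carrier H" "g \<in> carrier H"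
    and "\<And>x y u v. x \<in> carrier H \<Longrightarrow> y \<in> carrier H \<Longrightarrow> u \<in> carrier H \<Longrightarrow> v \<in> carrier H \<Longrightarrow>
      b x y u v \<in> carrier X"
  shows "SH H X (\<lambda>x y. SH H X (\<lambda>u v. b x y u v) g) h = SH H X (\<lambda>u v. SH H X (\<lambda>x y. b x y u v) h) g"
proof -
  have 1: "SH H X (\<lambda>x y. SH H X (\<lambda>u v. b x y u v) g) h =
      sweedler X (\<lambda>x y. sweedler X (\<lambda>u v. b x y u v) (Delta_H H g)) (Delta_H H h)"
    by (rule SH_SH_eq) (use assms in auto)
  have 2: "SH H X (\<lambda>u v. SH H X (\<lambda>x y. b x y u v) h) g =
      sweedler X (\<lambda>u v. sweedler X (\<lambda>x y. b x y u v) (Delta_H H h)) (Delta_H H g)"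
    by (rule SH_SH_eq) (use assms in auto)
  show ?thesis unfolding 1 2
    by (rule sweedler_swap[OF tensor_product_H tensor_product_H assms(1) Delta_closed Delta_closed])
       (use assms in auto)
qed

lemma klin_SH_body:
  assumes X: "module k X" and Y: "module k Y" and h: "h \<in> carrier H"
    and b: "\<And>x y. x \<in> carrier H \<Longrightarrow> y \<in> carrier H \<Longrightarrow> klin k Y X (\<lambda>z. b z x y)"
  shows "klin k Y X (\<lambda>z. SH H X (b z) h)"
proof -
  interpret X: module k X by fact
  interpret Y: module k Y by fact
  have bc: "b z x y \<in> carrier X" if "z \<in> carrier Y" "x \<in> carrier H" "y \<in> carrier H" for z x y
    using klin_closed[OF b] that by blast
  show ?thesis
  proof (rule klinI)
    fix z assume "z \<in> carrier Y"
    then show "SH H X (b z) h \<in> carrier X" by (simp add: SH_closed X.abelian_group_axioms)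
  next
    fix y z assume yz: "y \<in> carrier Y" "z \<in> carrier Y"
    have "SH H X (b (y \<oplus>\<^bsub>Y\<^esub> z)) h = SH H X (\<lambda>u v. b y u v \<oplus>\<^bsub>X\<^esub> b z u v) h"
      by (rule SH_cong[OF X.abelian_group_axioms]) (use klin_add[OF b] yz in blast)
    then show "SH H X (b (y \<oplus>\<^bsub>Y\<^esub> z)) h = SH H X (b y) h \<oplus>\<^bsub>X\<^esub> SH H X (b z) h"
      using SH_add_fun[OF X.abelian_group_axioms] bc yz h by simp
  next
    fix c z assume cz: "c \<in> carrier k" "z \<in> carrier Y"
    have a: "additive X X (smult X c)"
      by (rule additiveI) (use cz X.smult_r_distr in auto)
    have "SH H X (b (c \<odot>\<^bsub>Y\<^esub> z)) h = SH H X (\<lambda>u v. c \<odot>\<^bsub>X\<^esub> b z u v) h"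
      by (rule SH_cong[OF X.abelian_group_axioms]) (use klin_smult[OF b] cz in blast)
    then show "SH H X (b (c \<odot>\<^bsub>Y\<^esub> z)) h = c \<odot>\<^bsub>X\<^esub> SH H X (b z) h"
      using SH_apply[OF X.abelian_group_axioms X.abelian_group_axioms a h, of "b z"] bc cz by simp
  qed
qed

text \<open>Linearity in the element whose coproduct is taken: it combines linearity of
  \<open>Delta_H\<close> with balancedness of \<open>b\<close>, whereas \<open>klin_SH_body\<close>
  concerns a parameter of the summand.\<close>

lemma klin_SH:
  assumes X: "module k X" and b: "bilin k H H X b"
  shows "klin k H X (SH H X b)"
proof -
  interpret X: module k X by fact
  interpret tp: tensor_product k H ksr H "smult H" by (rule tensor_product_H)
  note ag = X.abelian_group_axioms
  have bc: "b x y \<in> carrier X" if "x \<in> carrier H" "y \<in> carrier H" for x y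
    by (rule bilin_closed[OF b that])
  have a: "additive tp.T X (sweedler X b)"
    by (rule tp.sweedler_additive[OF ag bilin_balanced[OF b]])
  have e: "SH H X b h = sweedler X b (Delta_H H h)" if "h \<in> carrier H" for h
    using SH_eq bc that by blast
  have D: "klin k H (tensor_k k H H) (Delta_H H)"
    by (rule klin_left_linear[OF Delta_linear])
  \<comment> \<open>Scalar multiplication on the tensor square is itself defined by
    \<open>sweedler\<close>, so its compatibility with \<open>b\<close> has to be computed.\<close>
  have s: "sweedler X b (c \<odot>\<^bsub>tensor_k k H H\<^esub> t) = c \<odot>\<^bsub>X\<^esub> sweedler X b t"
    if c: "c \<in> carrier k" and t: "t \<in> carrier tp.T" for c t
  proof -
    have am: "additive X X (smult X c)"
      by (rule additiveI) (use c X.smult_r_distr in auto)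
    have "sweedler X b (c \<odot>\<^bsub>tensor_k k H H\<^esub> t) = sweedler X b (sweedler tp.T (\<lambda>m n. tp.pure (c \<odot> m) n) t)"
      by (simp add: tensor_def Let_def)
    also have "\<dots> = sweedler X (\<lambda>m n. sweedler X b (tp.pure (c \<odot> m) n)) t"
      by (rule tp.sweedler_apply[OF tp.T_abelian_group ag t a]) (simp add: tp.pure_closed c)
    also have "\<dots> = sweedler X (\<lambda>m n. c \<odot>\<^bsub>X\<^esub> b m n) t"
    proof (rule tp.sweedler_cong[OF ag t])
      fix m n assume mn: "m \<in> carrier H" "n \<in> carrier H"
      have "sweedler X b (tp.pure (c \<odot> m) n) = b (c \<odot> m) n"
        by (rule tp.sweedler_pure[OF ag bilin_balanced[OF b]]) (use mn c in auto)
      also have "\<dots> = c \<odot>\<^bsub>X\<^esub> b m n" by (rule klin_smult[OF bilin_left[OF b mn(2)] c mn(1)])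
      finally show "sweedler X b (tp.pure (c \<odot> m) n) = c \<odot>\<^bsub>X\<^esub> b m n" .
      then show "sweedler X b (tp.pure (c \<odot> m) n) \<in> carrier X" using bc c mn by simp
    qed
    also have "\<dots> = c \<odot>\<^bsub>X\<^esub> sweedler X b t"
      by (rule tp.sweedler_apply[OF ag ag t am, symmetric]) (rule bc)
    finally show ?thesis .
  qed
  show ?thesis
  proof (rule klinI)
    show "SH H X b y \<in> carrier X" for y by (rule SH_closed[OF ag])
    show "SH H X b (y \<oplus> z) = SH H X b y \<oplus>\<^bsub>X\<^esub> SH H X b z" if "y \<in> carrier H" "z \<in> carrier H" for y z
      using klin_add[OF D that] additive_add[OF a Delta_closed Delta_closed] that by (simp add: e)
    show "SH H X b (c \<odot> y) = c \<odot>\<^bsub>X\<^esub> SH H X b y" if "c \<in> carrier k" "y \<in> carrier H" for c y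
      using klin_smult[OF D that] s[OF that(1) Delta_closed[OF that(2)]] that by (simp add: e)
  qed
qed

lemma klin_SH_arg:
  assumes "module k X" "klin k Y H g" "bilin k H H X b"
  shows "klin k Y X (\<lambda>y. SH H X b (g y))"
  by (rule klin_comp[OF klin_SH[OF assms(1,3)] assms(2)])

lemma SH_mult:
  assumes X: "module k X" and b: "bilin k H H X b" and gh: "g \<in> carrier H" "h \<in> carrier H"
  shows "SH H X b (g \<otimes> h) = SH H X (\<lambda>x y. SH H X (\<lambda>u v. b (x \<otimes> u) (y \<otimes> v)) h) g"
proof -
  interpret X: module k X by fact
  interpret tp: tensor_product k H ksr H "smult H" by (rule tensor_product_H)
  note ag = X.abelian_group_axioms
  have bc: "b x y \<in> carrier X" if "x \<in> carrier H" "y \<in> carrier H" for x y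
    by (rule bilin_closed[OF b that])
  have a: "additive tp.T X (sweedler X b)"
    by (rule tp.sweedler_additive[OF ag bilin_balanced[OF b]])
  have T_eq: "sweedler (tensor_k k H H) c t = sweedler tp.T c t"
    if "t \<in> carrier tp.T" "\<And>m n. m \<in> carrier H \<Longrightarrow> n \<in> carrier H \<Longrightarrow> c m n \<in> carrier tp.T" for c t
    by (rule tp.sweedler_target[OF tp.T_abelian_group]) (use that in auto)
  have in_c: "sweedler tp.T (\<lambda>u v. tp.pure (x \<otimes> u) (y \<otimes> v)) (Delta_H H h) \<in> carrier tp.T"
    if "x \<in> carrier H" "y \<in> carrier H" for x y
    by (rule tp.sweedler_closed[OF tp.T_abelian_group Delta_closed[OF gh(2)]])
       (use that tp.pure_closed in auto)
  have "Delta_H H (g \<otimes> h) = Delta_H H g \<otimes>\<^bsub>tensor_algebra k H H\<^esub> Delta_H H h"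
    using Delta_ring_hom gh by (simp add: ring_hom_mult)
  also have "\<dots> = sweedler (tensor_k k H H) (\<lambda>x y. sweedler (tensor_k k H H)
      (\<lambda>u v. tp.pure (x \<otimes> u) (y \<otimes> v)) (Delta_H H h)) (Delta_H H g)"
    by (simp add: tensor_algebra_def Let_def)
  also have "\<dots> = sweedler (tensor_k k H H) (\<lambda>x y. sweedler tp.T
      (\<lambda>u v. tp.pure (x \<otimes> u) (y \<otimes> v)) (Delta_H H h)) (Delta_H H g)"
    by (rule tp.sweedler_cong[OF abelian_group_cong[OF tp.T_abelian_group] Delta_closed[OF gh(1)]])
       (use in_c T_eq[OF Delta_closed[OF gh(2)]] tp.pure_closed in \<open>auto\<close>)
  also have "\<dots> = sweedler tp.T (\<lambda>x y. sweedler tp.T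
      (\<lambda>u v. tp.pure (x \<otimes> u) (y \<otimes> v)) (Delta_H H h)) (Delta_H H g)"
    by (rule T_eq[OF Delta_closed[OF gh(1)]]) (rule in_c)
  finally have D: "Delta_H H (g \<otimes> h) = \<dots>" .
  have "SH H X b (g \<otimes> h) = sweedler X b (Delta_H H (g \<otimes> h))"
    using bc gh by (simp add: SH_eq)
  also have "\<dots> = sweedler X (\<lambda>x y. sweedler X b (sweedler tp.T
      (\<lambda>u v. tp.pure (x \<otimes> u) (y \<otimes> v)) (Delta_H H h))) (Delta_H H g)"
    unfolding D by (rule tp.sweedler_apply[OF tp.T_abelian_group ag Delta_closed[OF gh(1)] a]) (rule in_c)
  also have "\<dots> = SH H X (\<lambda>x y. sweedler X b (sweedler tp.T
      (\<lambda>u v. tp.pure (x \<otimes> u) (y \<otimes> v)) (Delta_H H h))) g"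
    using gh(1) in_c additive_closed[OF a] by (simp add: SH_eq)
  also have "\<dots> = SH H X (\<lambda>x y. SH H X (\<lambda>u v. b (x \<otimes> u) (y \<otimes> v)) h) g"
  proof (rule SH_cong[OF ag])
    fix x y assume xy: "x \<in> carrier H" "y \<in> carrier H"
    have "sweedler X b (sweedler tp.T (\<lambda>u v. tp.pure (x \<otimes> u) (y \<otimes> v)) (Delta_H H h)) =
      sweedler X (\<lambda>u v. sweedler X b (tp.pure (x \<otimes> u) (y \<otimes> v))) (Delta_H H h)"
      by (rule tp.sweedler_apply[OF tp.T_abelian_group ag Delta_closed[OF gh(2)] a])
         (simp add: xy tp.pure_closed)
    also have "\<dots> = sweedler X (\<lambda>u v. b (x \<otimes> u) (y \<otimes> v)) (Delta_H H h)"
      by (rule tp.sweedler_cong[OF ag Delta_closed[OF gh(2)]])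
         (use xy bc tp.sweedler_pure[OF ag bilin_balanced[OF b]] in auto)
    also have "\<dots> = SH H X (\<lambda>u v. b (x \<otimes> u) (y \<otimes> v)) h"
      using gh(2) xy bc by (simp add: SH_eq)
    finally show "sweedler X b (sweedler tp.T (\<lambda>u v. tp.pure (x \<otimes> u) (y \<otimes> v)) (Delta_H H h)) = \<dots>" .
  qed
  finally show ?thesis .
qed

lemma SH_one:
  assumes X: "module k X" and b: "bilin k H H X b"
  shows "SH H X b \<one> = b \<one> \<one>"
proof -
  interpret X: module k X by fact
  interpret tp: tensor_product k H ksr H "smult H" by (rule tensor_product_H)
  note ag = X.abelian_group_axioms
  have "Delta_H H \<one> = tp.pure \<one> \<one>"
    using ring_hom_one[OF Delta_ring_hom] by (simp add: tensor_algebra_def Let_def)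
  then show ?thesis
    using tp.sweedler_pure[OF ag bilin_balanced[OF b]] bilin_closed[OF b] by (simp add: SH_eq)
qed

lemma SH_coassoc:
  assumes X: "module k X" and b: "trilin k H X b" and h: "h \<in> carrier H"
  shows "SH H X (\<lambda>x y. SH H X (\<lambda>p q. b p q y) x) h = SH H X (\<lambda>x y. SH H X (\<lambda>p q. b x p q) y) h"
proof -
  interpret X: module k X by fact
  interpret tp: tensor_product k H ksr H "smult H" by (rule tensor_product_H)
  note ag = X.abelian_group_axioms
  have bc: "b x y z \<in> carrier X" if "x \<in> carrier H" "y \<in> carrier H" "z \<in> carrier H" for x y z
    by (rule trilin_closed[OF b that])
  interpret tt: triple_tensor k H ksr H "smult H" ksr H "smult H" "tensor_k k H H" "smult (tensor_k k H H)"
  proof unfold_locales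
    show "additive H H ((\<odot>) r)" if "r \<in> carrier k" for r
      by (rule additiveI) (use that smult_r_distr in auto)
    show "r \<odot> (s \<odot> n) = s \<odot> (r \<odot> n)" if "r \<in> carrier k" "n \<in> carrier H" "s \<in> carrier k" for r n s
      using that smult_assoc1[of r s n] smult_assoc1[of s r n] by (simp add: R.m_comm)
    show "r \<odot>\<^bsub>tensor_k k H H\<^esub> t = sweedler (tensor_k k H H) (\<lambda>n. tp.pure (r \<odot> n)) t"
      if "r \<in> carrier k" "t \<in> carrier (tensor_k k H H)" for r t
    proof -
      have "sweedler (tensor_k k H H) (\<lambda>n. tp.pure (r \<odot> n)) t = sweedler tp.T (\<lambda>n. tp.pure (r \<odot> n)) t"
        by (rule tp.sweedler_target[OF tp.T_abelian_group])
           (use that tp.pure_closed in auto)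
      then show ?thesis by (simp add: tensor_def Let_def)
    qed
  qed auto
  let ?Y = "tensor_k k H (tensor_k k H H)"
  have "sweedler X (\<lambda>x y. sweedler X (\<lambda>p q. b p q y) (Delta_H H x)) (Delta_H H h) =
    sweedler X (\<lambda>x y. sweedler X (b x) (Delta_H H y)) (Delta_H H h)"
  proof (rule tt.sweedler_coassoc[where Y = ?Y])
    show "abelian_group ?Y"
      by (rule abelian_group_cong[OF tt.MNP.T_abelian_group]) auto
  qed (use coassoc[OF h] Delta_closed h trilin_balanced3[OF b] tensor_product_H ag in auto)
  moreover have "SH H X (\<lambda>x y. SH H X (\<lambda>p q. b p q y) x) h =
    sweedler X (\<lambda>x y. sweedler X (\<lambda>p q. b p q y) (Delta_H H x)) (Delta_H H h)"
    by (rule SH_SH_eq) (use ag h bc in auto)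
  moreover have "SH H X (\<lambda>x y. SH H X (\<lambda>p q. b x p q) y) h =
    sweedler X (\<lambda>x y. sweedler X (b x) (Delta_H H y)) (Delta_H H h)"
    by (rule SH_SH_eq) (use ag h bc in auto)
  ultimately show ?thesis by simp
qed

lemma SH_counit_left:
  assumes X: "module k X" and f: "klin k H X f" and h: "h \<in> carrier H"
  shows "SH H X (\<lambda>x y. eps_H H x \<odot>\<^bsub>X\<^esub> f y) h = f h"
proof -
  interpret X: module k X by fact
  have "f (SH H H (\<lambda>x y. eps_H H x \<odot> y) h) = SH H X (\<lambda>x y. f (eps_H H x \<odot> y)) h"
    by (rule SH_apply[OF _ _ klin_additive[OF f] h]) (auto simp: eps_closed X.abelian_group_axioms intro: abelian_group_axioms)
  also have "\<dots> = SH H X (\<lambda>x y. eps_H H x \<odot>\<^bsub>X\<^esub> f y) h"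
    by (rule SH_cong) (auto simp: X.abelian_group_axioms klin_smult[OF f] eps_closed)
  finally show ?thesis using counit_left[OF h] h by (simp add: SH_eq eps_closed)
qed

lemma SH_counit_right:
  assumes X: "module k X" and f: "klin k H X f" and h: "h \<in> carrier H"
  shows "SH H X (\<lambda>x y. eps_H H y \<odot>\<^bsub>X\<^esub> f x) h = f h"
proof -
  interpret X: module k X by fact
  have "f (SH H H (\<lambda>x y. eps_H H y \<odot> x) h) = SH H X (\<lambda>x y. f (eps_H H y \<odot> x)) h"
    by (rule SH_apply[OF _ _ klin_additive[OF f] h]) (auto simp: eps_closed X.abelian_group_axioms intro: abelian_group_axioms)
  also have "\<dots> = SH H X (\<lambda>x y. eps_H H y \<odot>\<^bsub>X\<^esub> f x) h"
    by (rule SH_cong) (auto simp: X.abelian_group_axioms klin_smult[OF f] eps_closed)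
  finally show ?thesis using counit_right[OF h] h by (simp add: SH_eq eps_closed)
qed

end

section \<open>Cancellation in Hopf algebras and the antipode\<close>

lemma (in module) smult_klin: "c \<in> carrier R \<Longrightarrow> klin R M M (smult M c)"
  by (intro klinI) (auto simp: smult_r_distr simp flip: smult_assoc1 intro: arg_cong2[of _ _ _ _ "smult M"] R.m_comm)

lemma klin_smultI:
  "module k X \<Longrightarrow> c \<in> carrier k \<Longrightarrow> klin k Y X f \<Longrightarrow> klin k Y X (\<lambda>y. c \<odot>\<^bsub>X\<^esub> f y)"
  by (rule klin_comp[OF module.smult_klin])

context k_algebra
begin

lemma klin_mult_left: "a \<in> carrier A \<Longrightarrow> klin k Y A f \<Longrightarrow> klin k Y A (\<lambda>y. f y \<otimes> a)"
  by (rule klin_comp[of _ _ _ "\<lambda>y. y \<otimes> a"]) (auto intro!: klinI simp: l_distr smult_mult_left)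

lemma klin_mult_right: "a \<in> carrier A \<Longrightarrow> klin k Y A f \<Longrightarrow> klin k Y A (\<lambda>y. a \<otimes> f y)"
  by (rule klin_comp[of _ _ _ "\<lambda>y. a \<otimes> y"]) (auto intro!: klinI simp: r_distr smult_mult_right)

end

context hopf_algebra
begin

lemma ag_H: "abelian_group H" ..

lemma klin_antipodeI: "klin k Y H f \<Longrightarrow> klin k Y H (\<lambda>y. S_H H (f y))"
  by (rule klin_comp[OF antipode_klin])

lemma klin_epsI:
  assumes "module k X" "x \<in> carrier X" "klin k Y H f"
  shows "klin k Y X (\<lambda>y. eps_H H (f y) \<odot>\<^bsub>X\<^esub> x)"
proof -
  interpret X: module k X by fact
  show ?thesis
    by (rule klin_comp[OF _ assms(3), of X "\<lambda>y. eps_H H y \<odot>\<^bsub>X\<^esub> x"])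
       (auto intro!: klinI simp: eps_closed eps_add eps_smult X.smult_l_distr X.smult_assoc1 assms(2))
qed

lemma klin_bilin_leftI: "bilin k H H X b \<Longrightarrow> n \<in> carrier H \<Longrightarrow> klin k Y H f \<Longrightarrow> klin k Y X (\<lambda>y. b (f y) n)"
  by (rule klin_comp[OF bilin_left])

lemma klin_bilin_rightI: "bilin k H H X b \<Longrightarrow> n \<in> carrier H \<Longrightarrow> klin k Y H f \<Longrightarrow> klin k Y X (\<lambda>y. b n (f y))"
  by (rule klin_comp[OF bilin_right])

text \<open>Collected so that multilinearity of a summand, the side condition of each
  coassociativity, counit and cancellation step, is found by backward chaining.\<close>

lemmas klin_intros = bilinI trilinI klin_id klin_smultI klin_mult_left klin_mult_right
  klin_antipodeI klin_epsI klin_SH_body klin_SH_arg module_H antipode_closed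

text \<open>Composed with the coproduct, \<open>\<phi>\<close> is the unit of the convolution
  algebra. The instances are \<open>S(p) q\<close>, \<open>p S(q)\<close>, \<open>S^-1(q) p\<close>
  and \<open>q S^-1(p)\<close>, so one set of cancellation rules serves all four.\<close>

definition conv_unit :: "('h \<Rightarrow> 'h \<Rightarrow> 'h) \<Rightarrow> bool" where
  "conv_unit \<phi> \<longleftrightarrow> bilin k H H H \<phi> \<and> (\<forall>h\<in>carrier H. SH H H \<phi> h = eps_H H h \<odot> \<one>)"

lemma conv_unit_closed: "conv_unit \<phi> \<Longrightarrow> p \<in> carrier H \<Longrightarrow> q \<in> carrier H \<Longrightarrow> \<phi> p q \<in> carrier H"
  by (auto simp: conv_unit_def intro: bilin_closed)

lemma conv_unit_apply:
  assumes X: "module k X" and \<phi>: "conv_unit \<phi>" and f: "klin k H X f" and h: "h \<in> carrier H"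
  shows "SH H X (\<lambda>p q. f (\<phi> p q)) h = eps_H H h \<odot>\<^bsub>X\<^esub> f \<one>"
proof -
  interpret X: module k X by fact
  have "SH H X (\<lambda>p q. f (\<phi> p q)) h = f (SH H H \<phi> h)"
    by (rule SH_apply[OF ag_H X.abelian_group_axioms klin_additive[OF f] h, symmetric])
       (rule conv_unit_closed[OF \<phi>])
  also have "\<dots> = eps_H H h \<odot>\<^bsub>X\<^esub> f \<one>"
    using \<phi> h klin_smult[OF f] by (simp add: conv_unit_def eps_closed)
  finally show ?thesis .
qed

lemma collapse_left:
  assumes X: "module k X" and \<phi>: "conv_unit \<phi>" and E: "bilin k H H X E" and h: "h \<in> carrier H"
  shows "SH H X (\<lambda>x y. SH H X (\<lambda>p q. E (\<phi> p q) y) x) h = E \<one> h"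
proof -
  interpret X: module k X by fact
  have "SH H X (\<lambda>x y. SH H X (\<lambda>p q. E (\<phi> p q) y) x) h = SH H X (\<lambda>x y. eps_H H x \<odot>\<^bsub>X\<^esub> E \<one> y) h"
    by (rule SH_cong[OF X.abelian_group_axioms])
       (rule conv_unit_apply[OF X \<phi> bilin_left[OF E]])
  also have "\<dots> = E \<one> h"
    by (rule SH_counit_left[OF X bilin_right[OF E] h]) simp
  finally show ?thesis .
qed

lemma collapse_right:
  assumes X: "module k X" and \<phi>: "conv_unit \<phi>" and E: "bilin k H H X E" and h: "h \<in> carrier H"
  shows "SH H X (\<lambda>x y. SH H X (\<lambda>p q. E x (\<phi> p q)) y) h = E h \<one>"
proof -
  interpret X: module k X by fact
  have "SH H X (\<lambda>x y. SH H X (\<lambda>p q. E x (\<phi> p q)) y) h = SH H X (\<lambda>x y. eps_H H y \<odot>\<^bsub>X\<^esub> E x \<one>) h"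
    by (rule SH_cong[OF X.abelian_group_axioms])
       (rule conv_unit_apply[OF X \<phi> bilin_right[OF E]])
  also have "\<dots> = E h \<one>"
    by (rule SH_counit_right[OF X bilin_left[OF E] h]) simp
  finally show ?thesis .
qed

lemma trilin_conv_left:
  assumes "conv_unit \<phi>" "bilin k H H X E"
  shows "trilin k H X (\<lambda>x p q. E (\<phi> x p) q)"
  using assms unfolding conv_unit_def
  by (intro trilinI)
     (auto intro: klin_bilin_leftI bilin_left bilin_right bilin_closed)

lemma trilin_conv_right:
  assumes "conv_unit \<phi>" "bilin k H H X E"
  shows "trilin k H X (\<lambda>p q y. E p (\<phi> q y))"
  using assms unfolding conv_unit_def
  by (intro trilinI)
     (auto intro: klin_bilin_rightI bilin_left bilin_right bilin_closed)

text \<open>The two arguments of \<open>\<phi>\<close> come from different sides of the outer split.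
  Coassociativity brings them together, and then the counit absorbs the scalar.\<close>

lemma collapse_left':
  assumes X: "module k X" and \<phi>: "conv_unit \<phi>" and E: "bilin k H H X E" and h: "h \<in> carrier H"
  shows "SH H X (\<lambda>x y. SH H X (\<lambda>p q. E (\<phi> x p) q) y) h = E \<one> h"
  using SH_coassoc[OF X trilin_conv_left[OF \<phi> E] h] collapse_left[OF assms] by simp

lemma collapse_right':
  assumes X: "module k X" and \<phi>: "conv_unit \<phi>" and E: "bilin k H H X E" and h: "h \<in> carrier H"
  shows "SH H X (\<lambda>x y. SH H X (\<lambda>p q. E p (\<phi> q y)) x) h = E h \<one>"
  using SH_coassoc[OF X trilin_conv_right[OF \<phi> E] h] collapse_right[OF assms] by simp

text \<open>
  In Sweedler notation: if \<open>\<phi> h\<^sub>1 h\<^sub>2 = \<epsilon>(h)\<close>, then \<open>D h\<^sub>1 (\<phi> h\<^sub>2 h\<^sub>3) h\<^sub>4 = D h\<^sub>1 1 h\<^sub>2\<close>.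
\<close>

lemma collapse_middle:
  assumes X: "module k X" and \<phi>: "conv_unit \<phi>" and D: "trilin k H X D" and h: "h \<in> carrier H"
  shows "SH H X (\<lambda>x y. SH H X (\<lambda>p q. SH H X (\<lambda>u v. D p (\<phi> q u) v) y) x) h =
    SH H X (\<lambda>x y. D x \<one> y) h"
proof -
  interpret X: module k X by fact
  note ag = X.abelian_group_axioms
  have \<phi>b: "bilin k H H H \<phi>" using \<phi> by (simp add: conv_unit_def)
  have Dk: "y \<in> carrier H \<Longrightarrow> z \<in> carrier H \<Longrightarrow> klin k H X (\<lambda>x. D x y z)"
    "y \<in> carrier H \<Longrightarrow> z \<in> carrier H \<Longrightarrow> klin k H X (\<lambda>x. D y x z)"
    "y \<in> carrier H \<Longrightarrow> z \<in> carrier H \<Longrightarrow> klin k H X (D y z)" for y z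
    using D by (auto simp: trilin_def)
  \<comment> \<open>The sum over the right half is kept inside a trilinear map, so the fourfold
    coproduct is rebracketed with the rule for three factors.\<close>
  have B: "trilin k H X (\<lambda>p q y. SH H X (\<lambda>u v. D p (\<phi> q u) v) y)"
  proof (intro trilinI)
    fix y z assume yz: "y \<in> carrier H" "z \<in> carrier H"
    show "klin k H X (\<lambda>x. SH H X (\<lambda>u v. D x (\<phi> y u) v) z)"
      by (intro klin_SH_body X module_H yz Dk) (auto intro: bilin_closed[OF \<phi>b] yz)
    show "klin k H X (\<lambda>x. SH H X (\<lambda>u v. D y (\<phi> x u) v) z)"
      by (intro klin_SH_body X module_H yz klin_comp[OF Dk(2)] bilin_left[OF \<phi>b])
    show "klin k H X (\<lambda>x. SH H X (\<lambda>u v. D y (\<phi> z u) v) x)"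
      by (intro klin_SH X bilinI klin_comp[OF Dk(2)] bilin_right[OF \<phi>b] Dk(3) bilin_closed[OF \<phi>b] yz)
  qed
  have "SH H X (\<lambda>x y. SH H X (\<lambda>p q. SH H X (\<lambda>u v. D p (\<phi> q u) v) y) x) h =
    SH H X (\<lambda>x y. SH H X (\<lambda>p q. SH H X (\<lambda>u v. D x (\<phi> p u) v) q) y) h"
    by (rule SH_coassoc[OF X B h])
  also have "\<dots> = SH H X (\<lambda>x y. D x \<one> y) h"
    by (rule SH_cong[OF ag]) (rule collapse_left'[OF X \<phi> trilin_bilin[OF D]])
  finally show ?thesis .
qed

lemma conv_unit_antipode_left: "conv_unit (\<lambda>p q. S_H H p \<otimes> q)"
  unfolding conv_unit_def
  by (auto intro!: klin_intros simp: SH_eq antipode_left antipode_closed)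

lemma conv_unit_antipode_right: "conv_unit (\<lambda>p q. p \<otimes> S_H H q)"
  unfolding conv_unit_def
  by (auto intro!: klin_intros simp: SH_eq antipode_right antipode_closed)

text \<open>Both sides equal \<open>S(g\<^sub>1 h\<^sub>1) g\<^sub>2 h\<^sub>2 S(h\<^sub>3) S(g\<^sub>3)\<close>.\<close>

lemma antipode_mult:
  assumes g: "g \<in> carrier H" and h: "h \<in> carrier H"
  shows "S_H H (g \<otimes> h) = S_H H h \<otimes> S_H H g"
proof -
  note [simp] = antipode_closed
  note cong = SH_cong[OF ag_H]
  \<comment> \<open>\<open>g2 S(g3)\<close> is inserted here:
    \<open>S(g h) = S(g1 h) g2 S(g3)\<close>. The next equation inserts \<open>h2 S(h3)\<close>
    between \<open>g2\<close> and \<open>S(g3)\<close>.\<close>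
  have "S_H H (g \<otimes> h) = SH H H (\<lambda>a w. SH H H (\<lambda>p q. S_H H (p \<otimes> h) \<otimes> (q \<otimes> S_H H w)) a) g"
    by (subst collapse_right'[OF module_H conv_unit_antipode_right, of "\<lambda>x y. S_H H (x \<otimes> h) \<otimes> y"])
       (auto intro!: klin_intros simp: g h)
  also have "\<dots> = SH H H (\<lambda>a w. SH H H (\<lambda>p q. SH H H (\<lambda>c r. SH H H (\<lambda>s u.
      S_H H (p \<otimes> s) \<otimes> (q \<otimes> ((u \<otimes> S_H H r) \<otimes> S_H H w))) c) h) a) g"
    by (intro cong, subst collapse_right'[OF module_H conv_unit_antipode_right, where
          E = "\<lambda>x y. S_H H (p \<otimes> x) \<otimes> (q \<otimes> (y \<otimes> S_H H w))" for p q w])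
       (auto intro!: klin_intros simp: g h)
  also have "\<dots> = SH H H (\<lambda>a w. SH H H (\<lambda>c r. SH H H (\<lambda>p q. SH H H (\<lambda>s u.
      S_H H (p \<otimes> s) \<otimes> (q \<otimes> u) \<otimes> (S_H H r \<otimes> S_H H w)) c) a) h) g"
  proof (rule cong)
    fix a w assume aw: "a \<in> carrier H" "w \<in> carrier H"
    show "SH H H (\<lambda>p q. SH H H (\<lambda>c r. SH H H (\<lambda>s u.
        S_H H (p \<otimes> s) \<otimes> (q \<otimes> ((u \<otimes> S_H H r) \<otimes> S_H H w))) c) h) a =
      SH H H (\<lambda>c r. SH H H (\<lambda>p q. SH H H (\<lambda>s u.
        S_H H (p \<otimes> s) \<otimes> (q \<otimes> u) \<otimes> (S_H H r \<otimes> S_H H w)) c) a) h"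
      apply (subst SH_swap[OF ag_H aw(1) h])
       apply (rule SH_closed[OF ag_H])
      apply (intro cong)
      apply (simp add: m_assoc aw)
      done
  qed
  \<comment> \<open>The legs \<open>p, q\<close> of \<open>a\<close> and \<open>s, u\<close> of
    \<open>c\<close> merge into the legs of the product of \<open>a\<close> and \<open>c\<close>,
    whose \<open>S(x) y\<close> then cancels.\<close>
  also have "\<dots> = SH H H (\<lambda>a w. SH H H (\<lambda>c r.
      SH H H (\<lambda>x y. S_H H x \<otimes> y \<otimes> (S_H H r \<otimes> S_H H w)) (a \<otimes> c)) h) g"
    by (intro cong, subst SH_mult) (auto intro!: klin_intros module_H)
  also have "\<dots> = SH H H (\<lambda>a w. SH H H (\<lambda>c r. eps_H H c \<odot> (eps_H H a \<odot> (S_H H r \<otimes> S_H H w))) h) g"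
  proof (intro cong)
    fix a w c r assume c: "a \<in> carrier H" "w \<in> carrier H" "c \<in> carrier H" "r \<in> carrier H"
    have "SH H H (\<lambda>x y. S_H H x \<otimes> y \<otimes> (S_H H r \<otimes> S_H H w)) (a \<otimes> c) =
        eps_H H (a \<otimes> c) \<odot> (\<one> \<otimes> (S_H H r \<otimes> S_H H w))"
      by (rule conv_unit_apply[OF module_H conv_unit_antipode_left])
         (use c in \<open>auto intro!: klin_intros\<close>)
    then show "SH H H (\<lambda>x y. S_H H x \<otimes> y \<otimes> (S_H H r \<otimes> S_H H w)) (a \<otimes> c) =
        eps_H H c \<odot> (eps_H H a \<odot> (S_H H r \<otimes> S_H H w))"
      using c by (simp add: eps_mult eps_closed R.m_comm[of "eps_H H a"] smult_assoc1)
  qed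
  also have "\<dots> = SH H H (\<lambda>a w. eps_H H a \<odot> (S_H H h \<otimes> S_H H w)) g"
    by (intro cong, subst SH_counit_left) (auto intro!: klin_intros simp: h eps_closed)
  also have "\<dots> = S_H H h \<otimes> S_H H g"
    by (subst SH_counit_left) (auto intro!: klin_intros simp: g h)
  finally show ?thesis .
qed

lemma antipode_one: "S_H H \<one> = \<one>"
proof -
  have "SH H H (\<lambda>p q. S_H H p \<otimes> q) \<one> = S_H H \<one> \<otimes> \<one>"
    by (rule SH_one[OF module_H]) (use conv_unit_antipode_left in \<open>simp add: conv_unit_def\<close>)
  moreover have "SH H H (\<lambda>p q. S_H H p \<otimes> q) \<one> = \<one>"
    using conv_unit_antipode_left by (simp add: conv_unit_def eps_one)
  ultimately show ?thesis by (simp add: antipode_closed)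
qed

text \<open>
  With \<open>\<Delta>(S h\<^sub>1) = x \<otimes> y\<close>, both sides equal \<open>b (x h\<^sub>2 S(h\<^sub>5)) (y h\<^sub>3 S(h\<^sub>4))\<close>: either cancel
  \<open>h\<^sub>3 S(h\<^sub>4)\<close> and then \<open>h\<^sub>2 S(h\<^sub>3)\<close>, or combine \<open>\<Delta>(S h\<^sub>1) \<Delta>(h\<^sub>2) = \<Delta>(S(h\<^sub>1) h\<^sub>2)\<close>.
\<close>

lemma antipode_comult:
  assumes X: "module k X" and b: "bilin k H H X b" and h: "h \<in> carrier H"
  shows "SH H X b (S_H H h) = SH H X (\<lambda>u v. b (S_H H v) (S_H H u)) h"
proof -
  interpret X: module k X by fact
  note ag = X.abelian_group_axioms
  note cong = SH_cong[OF ag]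
  note [simp] = antipode_closed SH_closed[OF ag]
  note intros = klin_intros X klin_bilin_leftI[OF b] klin_bilin_rightI[OF b]
  have bc [simp]: "b x y \<in> carrier X" if "x \<in> carrier H" "y \<in> carrier H" for x y
    by (rule bilin_closed[OF b that])
  \<comment> \<open>In Sweedler notation \<open>W x y r\<close> is
    \<open>b (x r1 S(r4)) (y r2 S(r3))\<close>; the antipodes stand in mirrored order, so
    cancellation can proceed from the inside.\<close>
  define W where "W x y r = SH H X (\<lambda>p r'. SH H X (\<lambda>q r''. SH H X (\<lambda>u v.
    b (x \<otimes> (p \<otimes> S_H H v)) (y \<otimes> (q \<otimes> S_H H u))) r'') r') r" for x y r
  define Q where "Q = SH H X (\<lambda>a r. SH H X (\<lambda>x y. W x y r) (S_H H a)) h"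
  have WA: "W x y r = eps_H H r \<odot>\<^bsub>X\<^esub> b x y"
    if c: "x \<in> carrier H" "y \<in> carrier H" "r \<in> carrier H" for x y r
  proof -
    have "W x y r = SH H X (\<lambda>p r'. b (x \<otimes> (p \<otimes> S_H H r')) (y \<otimes> \<one>)) r"
      unfolding W_def
      by (rule cong)
         (rule collapse_left'[OF X conv_unit_antipode_right,
            where E = "\<lambda>z v. b (x \<otimes> (p \<otimes> S_H H v)) (y \<otimes> z)" for p];
          use c in \<open>auto intro!: intros\<close>)
    also have "\<dots> = eps_H H r \<odot>\<^bsub>X\<^esub> b (x \<otimes> \<one>) (y \<otimes> \<one>)"
      by (rule conv_unit_apply[OF X conv_unit_antipode_right,
            where f = "\<lambda>z. b (x \<otimes> z) (y \<otimes> \<one>)"];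
          use c in \<open>auto intro!: intros\<close>)
    finally show ?thesis using c by simp
  qed
  \<comment> \<open>Rebracketed so that \<open>z\<close> carries \<open>r1, r2\<close> and
    \<open>w\<close> carries \<open>r3, r4\<close>: the first pair is to be multiplied with the
    coproduct of \<open>S(a)\<close>, the second sits under the antipodes.\<close>
  have WB: "W x y r = SH H X (\<lambda>z w. SH H X (\<lambda>p q. SH H X (\<lambda>u v.
      b (x \<otimes> (p \<otimes> S_H H v)) (y \<otimes> (q \<otimes> S_H H u))) w) z) r"
    if c: "x \<in> carrier H" "y \<in> carrier H" "r \<in> carrier H" for x y r
    unfolding W_def
    by (rule SH_coassoc[OF X _ c(3), symmetric])
       (use c in \<open>auto intro!: intros\<close>)
  have "Q = SH H X (\<lambda>a r. eps_H H r \<odot>\<^bsub>X\<^esub> SH H X b (S_H H a)) h"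
    unfolding Q_def
  proof (rule cong)
    fix a r assume c: "a \<in> carrier H" "r \<in> carrier H"
    have "SH H X (\<lambda>x y. W x y r) (S_H H a) = SH H X (\<lambda>x y. eps_H H r \<odot>\<^bsub>X\<^esub> b x y) (S_H H a)"
      by (rule cong) (simp add: WA c)
    also have "\<dots> = eps_H H r \<odot>\<^bsub>X\<^esub> SH H X b (S_H H a)"
      by (rule SH_apply[OF ag ag klin_additive[OF X.smult_klin], symmetric])
         (use c in \<open>auto simp: eps_closed\<close>)
    finally show "SH H X (\<lambda>x y. W x y r) (S_H H a) = \<dots>" .
  qed
  also have "\<dots> = SH H X b (S_H H h)"
    by (rule SH_counit_right[OF X _ h]) (auto intro!: intros b)
  finally have A: "Q = SH H X b (S_H H h)" .
  \<comment> \<open>\<open>E c w\<close> is \<open>b (c1 S(w2)) (c2 S(w1))\<close>: the coproduct of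
    \<open>c\<close> times the reversed coproduct of \<open>w\<close> under \<open>S\<close>. At
    \<open>c = 1\<close> it is the right-hand side of the claim.\<close>
  define E where "E c w = SH H X (\<lambda>u v. SH H X (\<lambda>x y. b (x \<otimes> S_H H v) (y \<otimes> S_H H u)) c) w" for c w
  have Eb: "bilin k H H X E"
    unfolding E_def by (auto intro!: intros)
  have "Q = SH H X (\<lambda>a r. SH H X (\<lambda>z w. E (S_H H a \<otimes> z) w) r) h"
    unfolding Q_def
  proof (rule cong)
    fix a r assume c: "a \<in> carrier H" "r \<in> carrier H"
    have "SH H X (\<lambda>x y. W x y r) (S_H H a) = SH H X (\<lambda>x y. SH H X (\<lambda>z w. SH H X (\<lambda>p q. SH H X (\<lambda>u v.
      b (x \<otimes> (p \<otimes> S_H H v)) (y \<otimes> (q \<otimes> S_H H u))) w) z) r) (S_H H a)"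
      by (rule cong) (simp add: WB c)
    also have "\<dots> = SH H X (\<lambda>z w. SH H X (\<lambda>x y. SH H X (\<lambda>p q. SH H X (\<lambda>u v.
      b (x \<otimes> (p \<otimes> S_H H v)) (y \<otimes> (q \<otimes> S_H H u))) w) z) (S_H H a)) r"
      by (rule SH_swap[OF ag]) (use c in auto)
    also have "\<dots> = SH H X (\<lambda>z w. E (S_H H a \<otimes> z) w) r"
    proof (rule cong)
      fix z w assume zw: "z \<in> carrier H" "w \<in> carrier H"
      have "SH H X (\<lambda>x y. SH H X (\<lambda>p q. SH H X (\<lambda>u v.
          b (x \<otimes> (p \<otimes> S_H H v)) (y \<otimes> (q \<otimes> S_H H u))) w) z) (S_H H a) =
        SH H X (\<lambda>x y. SH H X (\<lambda>u v. SH H X (\<lambda>p q.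
          b (x \<otimes> (p \<otimes> S_H H v)) (y \<otimes> (q \<otimes> S_H H u))) z) w) (S_H H a)"
        by (rule cong, rule SH_swap[OF ag]) (use zw in auto)
      also have "\<dots> = SH H X (\<lambda>u v. SH H X (\<lambda>x y. SH H X (\<lambda>p q.
          b (x \<otimes> (p \<otimes> S_H H v)) (y \<otimes> (q \<otimes> S_H H u))) z) (S_H H a)) w"
        by (rule SH_swap[OF ag]) (use zw c in auto)
      also have "\<dots> = SH H X (\<lambda>u v. SH H X (\<lambda>x y. SH H X (\<lambda>p q.
          b ((x \<otimes> p) \<otimes> S_H H v) ((y \<otimes> q) \<otimes> S_H H u)) z) (S_H H a)) w"
        by (intro cong) (simp add: m_assoc)
      also have "\<dots> = E (S_H H a \<otimes> z) w"
        unfolding E_def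
        by (rule cong, rule SH_mult[OF X, symmetric]) (use zw c in \<open>auto intro!: intros\<close>)
      finally show "SH H X (\<lambda>x y. SH H X (\<lambda>p q. SH H X (\<lambda>u v.
          b (x \<otimes> (p \<otimes> S_H H v)) (y \<otimes> (q \<otimes> S_H H u))) w) z) (S_H H a) = E (S_H H a \<otimes> z) w" .
    qed
    finally show "SH H X (\<lambda>x y. W x y r) (S_H H a) = \<dots>" .
  qed
  also have "\<dots> = E \<one> h"
    by (rule collapse_left'[OF X conv_unit_antipode_left Eb h])
  also have "\<dots> = SH H X (\<lambda>u v. b (S_H H v) (S_H H u)) h"
    unfolding E_def
  proof (rule cong)
    fix u v assume "u \<in> carrier H" "v \<in> carrier H"
    then show "SH H X (\<lambda>x y. b (x \<otimes> S_H H v) (y \<otimes> S_H H u)) \<one> = b (S_H H v) (S_H H u)"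
      by (subst SH_one[OF X]) (auto intro!: intros)
  qed
  finally show ?thesis using A by simp
qed

end

section \<open>The inverse of the antipode\<close>

locale hopf_bijective = hopf_algebra k H
  for k :: "('k, 'y) ring_scheme" and H :: "('k, 'h) hopf" (structure) +
  assumes bij_antipode: "bij_betw (S_H H) (carrier H) (carrier H)"
begin

lemma S_inv_closed [simp]: "h \<in> carrier H \<Longrightarrow> S_H_inv H h \<in> carrier H"
  using bij_betw_inv_into[OF bij_antipode] by (auto simp: bij_betw_def)

lemma S_S_inv [simp]: "h \<in> carrier H \<Longrightarrow> S_H H (S_H_inv H h) = h"
  using bij_antipode by (simp add: bij_betw_inv_into_right)

lemma S_inv_S [simp]: "h \<in> carrier H \<Longrightarrow> S_H_inv H (S_H H h) = h"
  using bij_antipode by (simp add: bij_betw_inv_into_left)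

lemma S_eqD: "S_H H g = S_H H h \<Longrightarrow> g \<in> carrier H \<Longrightarrow> h \<in> carrier H \<Longrightarrow> g = h"
  by (metis S_inv_S)

lemma S_inv_klin: "klin k H H (S_H_inv H)"
proof (rule klinI)
  show "S_H_inv H (y \<oplus> z) = S_H_inv H y \<oplus> S_H_inv H z" if "y \<in> carrier H" "z \<in> carrier H" for y z
    by (rule S_eqD) (use that klin_add[OF antipode_klin] in auto)
  show "S_H_inv H (c \<odot> y) = c \<odot> S_H_inv H y" if "c \<in> carrier k" "y \<in> carrier H" for c y
    by (rule S_eqD) (use that klin_smult[OF antipode_klin] in auto)
qed simp

lemma klin_S_invI: "klin k Y H f \<Longrightarrow> klin k Y H (\<lambda>y. S_H_inv H (f y))"
  by (rule klin_comp[OF S_inv_klin])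

lemma S_inv_mult:
  "g \<in> carrier H \<Longrightarrow> h \<in> carrier H \<Longrightarrow> S_H_inv H (g \<otimes> h) = S_H_inv H h \<otimes> S_H_inv H g"
  by (rule S_eqD) (auto simp: antipode_mult)

lemma S_inv_one: "S_H_inv H \<one> = \<one>"
  by (rule S_eqD) (auto simp: antipode_one)

text \<open>The rule for \<open>S\<close> is applied to the element \<open>S^-1(h)\<close> and to
  \<open>b\<close> precomposed with \<open>S^-1\<close> and a swap of arguments.\<close>

lemma S_inv_comult:
  assumes X: "module k X" and b: "bilin k H H X b" and h: "h \<in> carrier H"
  shows "SH H X b (S_H_inv H h) = SH H X (\<lambda>u v. b (S_H_inv H v) (S_H_inv H u)) h"
proof -
  interpret X: module k X by fact
  have "SH H X (\<lambda>u v. b (S_H_inv H v) (S_H_inv H u)) (S_H H (S_H_inv H h)) =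
    SH H X (\<lambda>u v. b (S_H_inv H (S_H H u)) (S_H_inv H (S_H H v))) (S_H_inv H h)"
    by (rule antipode_comult[OF X])
       (auto intro!: klin_intros klin_S_invI X klin_bilin_leftI[OF b] klin_bilin_rightI[OF b] simp: h)
  also have "\<dots> = SH H X b (S_H_inv H h)"
    by (rule SH_cong[OF X.abelian_group_axioms]) simp
  finally show ?thesis using h by simp
qed

text \<open>\<open>S\<close> is injective and fixes \<open>\<epsilon>(h) 1\<close>, so the identity
  may be checked after applying \<open>S\<close>.\<close>

lemma conv_unit_of_antipode:
  assumes b: "bilin k H H H \<phi>" and \<psi>: "conv_unit \<psi>"
    and S: "\<And>p q. p \<in> carrier H \<Longrightarrow> q \<in> carrier H \<Longrightarrow> S_H H (\<phi> p q) = \<psi> p q"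
  shows "conv_unit \<phi>"
  unfolding conv_unit_def
proof (intro conjI ballI b)
  fix h assume h: "h \<in> carrier H"
  show "SH H H \<phi> h = eps_H H h \<odot> \<one>"
  proof (rule S_eqD)
    have "S_H H (SH H H \<phi> h) = SH H H (\<lambda>p q. S_H H (\<phi> p q)) h"
      by (rule SH_apply[OF ag_H ag_H klin_additive[OF antipode_klin] h]) (rule bilin_closed[OF b])
    also have "\<dots> = SH H H \<psi> h"
      by (rule SH_cong[OF ag_H]) (rule S)
    also have "\<dots> = S_H H (eps_H H h \<odot> \<one>)"
      using \<psi> h klin_smult[OF antipode_klin] by (simp add: conv_unit_def eps_closed antipode_one)
    finally show "S_H H (SH H H \<phi> h) = S_H H (eps_H H h \<odot> \<one>)" .
  qed (auto simp: SH_closed ag_H eps_closed h)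
qed

text \<open>Reversing products, \<open>S\<close> turns \<open>S^-1(q) p\<close> into
  \<open>S(p) q\<close>; in the companion below it turns \<open>q S^-1(p)\<close> into
  \<open>p S(q)\<close>.\<close>

lemma conv_unit_S_inv_left: "conv_unit (\<lambda>p q. S_H_inv H q \<otimes> p)"
  by (rule conv_unit_of_antipode[OF _ conv_unit_antipode_left])
     (auto intro!: klin_intros klin_S_invI simp: antipode_mult)

lemma conv_unit_S_inv_right: "conv_unit (\<lambda>p q. q \<otimes> S_H_inv H p)"
  by (rule conv_unit_of_antipode[OF _ conv_unit_antipode_right])
     (auto intro!: klin_intros klin_S_invI simp: antipode_mult)

end

section \<open>Module structures\<close>

text \<open>Actions on tensor products and maps \<open>f \<otimes> C\<close> are defined by an inner
  sum of this shape; this is the substitution rule for evaluating them.\<close>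

lemma (in tensor_product) sweedler_sweedler_pure:
  assumes X: "abelian_group X" and b: "balanced R M ra N la X b"
    and T': "carrier T' = carrier T" "ring.add T' = ring.add T" "ring.zero T' = ring.zero T"
    and S: "tensor_product R' P rp Q lq" and t: "t \<in> carrier (tensor_group R' P rp Q lq)"
    and p: "\<And>x y. x \<in> carrier P \<Longrightarrow> y \<in> carrier Q \<Longrightarrow> p x y \<in> carrier M"
    and q: "\<And>x y. x \<in> carrier P \<Longrightarrow> y \<in> carrier Q \<Longrightarrow> q x y \<in> carrier N"
  shows "sweedler X b (sweedler T' (\<lambda>x y. pure (p x y) (q x y)) t) = sweedler X (\<lambda>x y. b (p x y) (q x y)) t"
proof -
  have T: "abelian_group T'" by (rule abelian_group_cong[OF T_abelian_group T'])
  have a: "additive T' X (sweedler X b)"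
    using sweedler_additive[OF X b] by (simp add: additive_def T')
  have b_closed: "b m n \<in> carrier X" if "m \<in> carrier M" "n \<in> carrier N" for m n
    using b that by (auto simp: balanced_def additive_def)
  have "sweedler X b (sweedler T' (\<lambda>x y. pure (p x y) (q x y)) t) =
    sweedler X (\<lambda>x y. sweedler X b (pure (p x y) (q x y))) t"
    by (rule tensor_product.sweedler_apply[OF S T X t a]) (simp add: T' pure_closed p q)
  also have "\<dots> = sweedler X (\<lambda>x y. b (p x y) (q x y)) t"
    by (rule tensor_product.sweedler_cong[OF S X t]) (simp_all add: sweedler_pure[OF X b] p q b_closed)
  finally show ?thesis .
qed

context h_module
begin

lemma klin_hact_left: "x \<in> carrier M \<Longrightarrow> klin k Y H f \<Longrightarrow> klin k Y M (\<lambda>y. hact M (f y) x)"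
  by (rule klin_comp[of _ _ _ "\<lambda>h. hact M h x"])
     (auto intro!: klinI hact_closed simp: hact_add_left hact_smult_left)

lemma klin_hact_right: "h \<in> carrier H \<Longrightarrow> klin k Y M f \<Longrightarrow> klin k Y M (\<lambda>y. hact M h (f y))"
  by (rule klin_comp[of _ _ _ "hact M h"])
     (auto intro!: klinI hact_closed simp: hact_add_right hact_smult_right)

lemma additive_hact: "h \<in> carrier H \<Longrightarrow> additive M M (hact M h)"
  by (auto intro!: additiveI simp: hact_closed hact_add_right)

end

context right_module
begin

lemma klin_ract_left: "r \<in> carrier R \<Longrightarrow> klin k Y M f \<Longrightarrow> klin k Y M (\<lambda>y. ract M (f y) r)"
  by (rule klin_comp[of _ _ _ "\<lambda>x. ract M x r"])
     (auto intro!: klinI ract_closed simp: ract_add_left ract_smult_left)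

lemma klin_ract_right: "x \<in> carrier M \<Longrightarrow> klin k Y R f \<Longrightarrow> klin k Y M (\<lambda>y. ract M x (f y))"
  by (rule klin_comp[of _ _ _ "ract M x"])
     (auto intro!: klinI ract_closed simp: ract_add_right ract_smult_right)

lemma additive_ract_left: "r \<in> carrier R \<Longrightarrow> additive M M (\<lambda>x. ract M x r)"
  by (auto intro!: additiveI simp: ract_closed ract_add_left)

lemma additive_ract_right: "x \<in> carrier M \<Longrightarrow> additive R M (ract M x)"
  by (auto intro!: additiveI simp: ract_closed ract_add_right)

end

context left_module
begin

lemma additive_lact_right: "r \<in> carrier R \<Longrightarrow> additive M M (lact M r)"
  by (auto intro!: additiveI simp: lact_closed lact_add_right)

end

locale hopf_coring = hopf_bijective k H + A: h_module_algebra k H A + C: ha_coring k H A C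
  for k :: "('k, 'y) ring_scheme" and H :: "('k, 'h) hopf"
    and A :: "('k, 'h, 'a) hmod" and C :: "('k, 'h, 'a, 'c) coring"
begin

lemma ag_A: "abelian_group A" and ag_C: "abelian_group C"
  by (rule A.abelian_group_axioms, rule C.abelian_group_axioms)

lemma module_A: "module k A" and module_C: "module k C"
  by (rule A.module_axioms, rule C.module_axioms)

lemma module_abelian_group: "module k X \<Longrightarrow> abelian_group X"
  by (rule module.axioms(2))

lemma tensor_product_C:
  assumes "right_module k A M"
  shows "tensor_product A M (ract M) C (lact C)"
proof -
  interpret M: right_module k A M by fact
  show ?thesis
    by (intro tensor_product.intro M.abelian_group_axioms ag_C tensor_product_axioms.intro
        M.ract_closed C.lact_closed)
qed

lemma tensor_product_CC: "tensor_product A C (ract C) C (lact C)"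
  by (rule tensor_product_C) (rule C.right_module_axioms)

lemma Delta_C_closed: "c \<in> carrier C \<Longrightarrow> Delta_C C c \<in> carrier (tensor_group A C (ract C) C (lact C))"
  using C.Delta_left_linear by (auto simp: left_linear_def)

lemma eps_C_closed: "c \<in> carrier C \<Longrightarrow> eps_C C c \<in> carrier A"
  and eps_C_lact: "a \<in> carrier A \<Longrightarrow> c \<in> carrier C \<Longrightarrow> eps_C C (lact C a c) = a \<otimes>\<^bsub>A\<^esub> eps_C C c"
  and eps_C_add: "c \<in> carrier C \<Longrightarrow> d \<in> carrier C \<Longrightarrow> eps_C C (c \<oplus>\<^bsub>C\<^esub> d) = eps_C C c \<oplus>\<^bsub>A\<^esub> eps_C C d"
  and eps_C_ract: "a \<in> carrier A \<Longrightarrow> c \<in> carrier C \<Longrightarrow> eps_C C (ract C c a) = eps_C C c \<otimes>\<^bsub>A\<^esub> a"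
  and eps_C_hact: "h \<in> carrier H \<Longrightarrow> c \<in> carrier C \<Longrightarrow> eps_C C (hact C h c) = hact A h (eps_C C c)"
  using C.eps_left_linear C.eps_right_linear C.eps_h_linear
  by (auto simp: left_linear_def right_linear_def h_linear_def)

lemma hact_prod_SH:
  "\<lbrakk>h \<in> carrier H; a \<in> carrier A; b \<in> carrier A\<rbrakk> \<Longrightarrow>
    hact A h (a \<otimes>\<^bsub>A\<^esub> b) = SH H A (\<lambda>h1 h2. hact A h1 a \<otimes>\<^bsub>A\<^esub> hact A h2 b) h"
  by (simp add: SH_eq A.hact_prod A.hact_closed)

lemma hact_lact_SH:
  "\<lbrakk>h \<in> carrier H; a \<in> carrier A; x \<in> carrier C\<rbrakk> \<Longrightarrow>
    hact C h (lact C a x) = SH H C (\<lambda>h1 h2. lact C (hact A h1 a) (hact C h2 x)) h"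
  by (simp add: SH_eq C.hact_lact A.hact_closed C.hact_closed C.lact_closed)

lemma hact_ract_SH:
  assumes "hr_module k H A M" "h \<in> carrier H" "x \<in> carrier M" "a \<in> carrier A"
  shows "hact M h (ract M x a) = SH H M (\<lambda>h1 h2. ract M (hact M h1 x) (hact A h2 a)) h"
proof -
  interpret M: hr_module k H A M by fact
  show ?thesis using assms by (simp add: SH_eq M.hact_ract A.hact_closed M.hact_closed M.ract_closed)
qed

subsection \<open>The left dual ring\<close>

abbreviation "D \<equiv> left_dual H A C"

lemma dual_iff: "f \<in> carrier D \<longleftrightarrow>
    f \<in> extensional (carrier C) \<and> left_linear A C (lact C) A (monoid.mult A) f"
  by (simp add: left_dual_def)

lemma dualI:
  assumes "f \<in> extensional (carrier C)" "\<And>c. c \<in> carrier C \<Longrightarrow> f c \<in> carrier A"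
    and "\<And>c d. c \<in> carrier C \<Longrightarrow> d \<in> carrier C \<Longrightarrow> f (c \<oplus>\<^bsub>C\<^esub> d) = f c \<oplus>\<^bsub>A\<^esub> f d"
    and "\<And>a c. a \<in> carrier A \<Longrightarrow> c \<in> carrier C \<Longrightarrow> f (lact C a c) = a \<otimes>\<^bsub>A\<^esub> f c"
  shows "f \<in> carrier D"
  using assms by (simp add: dual_iff left_linear_def)

lemma dual_closed: "f \<in> carrier D \<Longrightarrow> c \<in> carrier C \<Longrightarrow> f c \<in> carrier A"
  and dual_add: "f \<in> carrier D \<Longrightarrow> c \<in> carrier C \<Longrightarrow> d \<in> carrier C \<Longrightarrow> f (c \<oplus>\<^bsub>C\<^esub> d) = f c \<oplus>\<^bsub>A\<^esub> f d"
  and dual_lact: "f \<in> carrier D \<Longrightarrow> a \<in> carrier A \<Longrightarrow> c \<in> carrier C \<Longrightarrow> f (lact C a c) = a \<otimes>\<^bsub>A\<^esub> f c"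
  and dual_extensional: "f \<in> carrier D \<Longrightarrow> f \<in> extensional (carrier C)"
  by (auto simp: dual_iff left_linear_def)

lemma dual_eqI:
  assumes "f \<in> carrier D" "g \<in> carrier D" "\<And>c. c \<in> carrier C \<Longrightarrow> f c = g c"
  shows "f = g"
  by (rule extensionalityI[OF dual_extensional dual_extensional]) (use assms in auto)

text \<open>Scalars from \<open>k\<close> act on \<open>C\<close> through the element
  \<open>x 1\<close> of \<open>A\<close>, so left \<open>A\<close>-linearity gives
  \<open>k\<close>-linearity.\<close>

lemma dual_smult:
  assumes f: "f \<in> carrier D" and x: "x \<in> carrier k" and c: "c \<in> carrier C"
  shows "f (x \<odot>\<^bsub>C\<^esub> c) = x \<odot>\<^bsub>A\<^esub> f c"
proof -
  have "x \<odot>\<^bsub>C\<^esub> c = lact C (x \<odot>\<^bsub>A\<^esub> \<one>\<^bsub>A\<^esub>) c"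
    using x c by (simp add: C.lact_smult_left C.lact_one)
  then have "f (x \<odot>\<^bsub>C\<^esub> c) = (x \<odot>\<^bsub>A\<^esub> \<one>\<^bsub>A\<^esub>) \<otimes>\<^bsub>A\<^esub> f c"
    using assms by (simp add: dual_lact)
  also have "\<dots> = x \<odot>\<^bsub>A\<^esub> f c"
    using assms dual_closed[OF f c] by (simp flip: A.smult_mult_left)
  finally show ?thesis .
qed

lemma klin_dual: "f \<in> carrier D \<Longrightarrow> klin k Y C g \<Longrightarrow> klin k Y A (\<lambda>y. f (g y))"
  by (rule klin_comp[of _ _ _ f]) (auto intro!: klinI simp: dual_closed dual_add dual_smult)

lemmas dual_klin_intros = klin_intros klin_S_invI klin_dual
  A.klin_mult_left A.klin_mult_right module_A module_C
  A.klin_hact_left A.klin_hact_right C.klin_hact_left C.klin_hact_right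

lemma dual_add_apply: "c \<in> carrier C \<Longrightarrow> (f \<oplus>\<^bsub>D\<^esub> g) c = f c \<oplus>\<^bsub>A\<^esub> g c"
  and dual_smult_apply: "c \<in> carrier C \<Longrightarrow> (x \<odot>\<^bsub>D\<^esub> f) c = x \<odot>\<^bsub>A\<^esub> f c"
  and dual_zero_apply: "c \<in> carrier C \<Longrightarrow> \<zero>\<^bsub>D\<^esub> c = \<zero>\<^bsub>A\<^esub>"
  and dual_one_apply: "c \<in> carrier C \<Longrightarrow> \<one>\<^bsub>D\<^esub> c = eps_C C c"
  by (simp_all add: left_dual_def)

lemma dual_add_closed: "f \<in> carrier D \<Longrightarrow> g \<in> carrier D \<Longrightarrow> f \<oplus>\<^bsub>D\<^esub> g \<in> carrier D"
  by (rule dualI)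
     (auto simp: dual_add_apply dual_closed dual_add dual_lact C.lact_closed A.r_distr A.M.a_ac,
      auto simp: left_dual_def)

lemma dual_smult_closed: "x \<in> carrier k \<Longrightarrow> f \<in> carrier D \<Longrightarrow> x \<odot>\<^bsub>D\<^esub> f \<in> carrier D"
  by (rule dualI)
     (auto simp: dual_smult_apply dual_closed dual_add dual_lact C.lact_closed A.smult_r_distr
        A.smult_mult_right, auto simp: left_dual_def)

lemma dual_one_closed: "\<one>\<^bsub>D\<^esub> \<in> carrier D"
  by (rule dualI)
     (auto simp: dual_one_apply eps_C_closed eps_C_add eps_C_lact C.lact_closed,
      auto simp: left_dual_def)

lemma dual_zero_closed: "\<zero>\<^bsub>D\<^esub> \<in> carrier D"
  by (rule dualI)
     (auto simp: dual_zero_apply C.lact_closed, auto simp: left_dual_def)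

lemma abelian_group_dual: "abelian_group D"
proof (rule abelian_groupI)
  fix f assume f: "f \<in> carrier D"
  have g: "(\<lambda>c\<in>carrier C. \<ominus>\<^bsub>A\<^esub> f c) \<in> carrier D"
    by (rule dualI) (use f in \<open>auto simp: dual_closed dual_add dual_lact C.lact_closed A.r_minus A.minus_add\<close>)
  show "\<exists>g\<in>carrier D. g \<oplus>\<^bsub>D\<^esub> f = \<zero>\<^bsub>D\<^esub>"
    by (rule bexI[OF _ g], rule dual_eqI)
       (use f g in \<open>auto simp: dual_add_closed dual_zero_closed dual_add_apply dual_zero_apply
          dual_closed A.l_neg\<close>)
qed (auto simp: dual_add_closed dual_zero_closed dual_add_apply dual_zero_apply dual_closed
    A.M.a_ac intro!: dual_eqI)

lemma dual_mult_apply: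
  "c \<in> carrier C \<Longrightarrow> (f \<otimes>\<^bsub>D\<^esub> g) c = sweedler A (\<lambda>c1 c2. g (ract C c1 (f c2))) (Delta_C C c)"
  by (simp add: left_dual_def)

text \<open>An element \<open>a\<close> crosses the tensor sign because both placements give
  \<open>g(c1 (a f(c2)))\<close>.\<close>

lemma balanced_dual_mult:
  assumes f: "f \<in> carrier D" and g: "g \<in> carrier D"
  shows "balanced A C (ract C) C (lact C) A (\<lambda>c1 c2. g (ract C c1 (f c2)))"
  using assms
  by (intro balancedI additiveI)
     (auto simp: dual_closed dual_add dual_lact C.ract_closed C.ract_add_left C.ract_add_right
        C.ract_mult)

lemma dual_mult_closed:
  assumes f: "f \<in> carrier D" and g: "g \<in> carrier D"
  shows "f \<otimes>\<^bsub>D\<^esub> g \<in> carrier D"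
proof (rule dualI)
  interpret T: tensor_product A C "ract C" C "lact C" by (rule tensor_product_CC)
  note bal = balanced_dual_mult[OF assms]
  note add = T.sweedler_additive[OF ag_A bal]
  let ?b = "\<lambda>c1 c2. g (ract C c1 (f c2))"
  have bc: "?b x y \<in> carrier A" if "x \<in> carrier C" "y \<in> carrier C" for x y
    using assms that by (simp add: dual_closed C.ract_closed)
  show "f \<otimes>\<^bsub>D\<^esub> g \<in> extensional (carrier C)" by (simp add: left_dual_def)
  show "(f \<otimes>\<^bsub>D\<^esub> g) c \<in> carrier A" if "c \<in> carrier C" for c
    using additive_closed[OF add Delta_C_closed[OF that]] that by (simp add: dual_mult_apply)
  show "(f \<otimes>\<^bsub>D\<^esub> g) (c \<oplus>\<^bsub>C\<^esub> d) = (f \<otimes>\<^bsub>D\<^esub> g) c \<oplus>\<^bsub>A\<^esub> (f \<otimes>\<^bsub>D\<^esub> g) d"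
    if "c \<in> carrier C" "d \<in> carrier C" for c d
  proof -
    have "Delta_C C (c \<oplus>\<^bsub>C\<^esub> d) = Delta_C C c \<oplus>\<^bsub>T.T\<^esub> Delta_C C d"
      using C.Delta_left_linear that by (simp add: left_linear_def)
    then show ?thesis
      using additive_add[OF add Delta_C_closed Delta_C_closed] that by (simp add: dual_mult_apply)
  qed
  show "(f \<otimes>\<^bsub>D\<^esub> g) (lact C a c) = a \<otimes>\<^bsub>A\<^esub> (f \<otimes>\<^bsub>D\<^esub> g) c"
    if a: "a \<in> carrier A" and c: "c \<in> carrier C" for a c
  proof -
    have "Delta_C C (lact C a c) = lact (tensor_A_bimod H A C C) a (Delta_C C c)"
      using C.Delta_left_linear a c by (simp add: left_linear_def)
    also have "\<dots> = sweedler (tensor_A H A C C) (\<lambda>m n. T.pure (lact C a m) n) (Delta_C C c)"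
      by (simp add: tensor_A_bimod_def Let_def)
    finally have "(f \<otimes>\<^bsub>D\<^esub> g) (lact C a c) =
      sweedler A ?b (sweedler (tensor_A H A C C) (\<lambda>m n. T.pure (lact C a m) n) (Delta_C C c))"
      using a c by (simp add: dual_mult_apply C.lact_closed)
    also have "\<dots> = sweedler A (\<lambda>m n. ?b (lact C a m) n) (Delta_C C c)"
      by (rule T.sweedler_sweedler_pure[OF ag_A bal _ _ _ tensor_product_CC Delta_C_closed[OF c]])
         (use a in \<open>auto simp: C.lact_closed\<close>)
    also have "\<dots> = sweedler A (\<lambda>m n. a \<otimes>\<^bsub>A\<^esub> ?b m n) (Delta_C C c)"
      by (rule T.sweedler_cong[OF ag_A Delta_C_closed[OF c]])
         (use assms a in \<open>auto simp: dual_closed dual_lact C.lact_closed C.ract_closed C.lact_ract\<close>)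
    also have "\<dots> = a \<otimes>\<^bsub>A\<^esub> (f \<otimes>\<^bsub>D\<^esub> g) c"
      unfolding dual_mult_apply[OF c]
      by (rule T.sweedler_apply[OF ag_A ag_A Delta_C_closed[OF c], symmetric])
         (use a bc in \<open>auto intro!: additiveI simp: A.r_distr\<close>)
    finally show ?thesis .
  qed
qed

lemma dual_hact_apply:
  assumes "h \<in> carrier H" "f \<in> carrier D" "c \<in> carrier C"
  shows "hact D h f c = SH H A (\<lambda>h1 h2. hact A h2 (f (hact C (S_H_inv H h1) c))) h"
  using assms by (simp add: left_dual_def SH_eq A.hact_closed dual_closed C.hact_closed)

lemma dual_hact_klin:
  assumes "f \<in> carrier D" "c \<in> carrier C"
  shows "klin k H A (\<lambda>h. hact D h f c)"
  by (rule klin_cong[OF module_H, of _ "SH H A (\<lambda>h1 h2. hact A h2 (f (hact C (S_H_inv H h1) c)))"])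
     (use assms in \<open>auto intro!: dual_klin_intros klin_SH simp: dual_hact_apply dual_closed C.hact_closed\<close>)

lemma dual_hact_closed:
  assumes h: "h \<in> carrier H" and f: "f \<in> carrier D"
  shows "hact D h f \<in> carrier D"
proof (rule dualI)
  show "hact D h f \<in> extensional (carrier C)" by (simp add: left_dual_def)
  show "hact D h f c \<in> carrier A" if "c \<in> carrier C" for c
    by (rule klin_closed[OF dual_hact_klin h]) (use f that in auto)
  show "hact D h f (c \<oplus>\<^bsub>C\<^esub> d) = hact D h f c \<oplus>\<^bsub>A\<^esub> hact D h f d"
    if c: "c \<in> carrier C" and d: "d \<in> carrier C" for c d
  proof -
    have "klin k C A (\<lambda>c. SH H A (\<lambda>h1 h2. hact A h2 (f (hact C (S_H_inv H h1) c))) h)"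
      by (rule klin_SH_body[OF module_A module_C h]) (use f in \<open>auto intro!: dual_klin_intros\<close>)
    from klin_add[OF this c d] show ?thesis using assms c d by (simp add: dual_hact_apply)
  qed
  show "hact D h f (lact C a c) = a \<otimes>\<^bsub>A\<^esub> hact D h f c" if a: "a \<in> carrier A" and c: "c \<in> carrier C" for a c
  proof -
    note [simp] = A.hact_closed C.hact_closed dual_closed[OF f] C.lact_closed a c h
    let ?T = "S_H_inv H"
    \<comment> \<open>In Sweedler notation:
      \<open>(h f)(a c) = (h3 S^-1(h2) a) (h4 f(S^-1(h1) c))\<close>.\<close>
    have "hact D h f (lact C a c) = SH H A (\<lambda>x y. SH H A (\<lambda>p q. SH H A (\<lambda>u v.
        hact A (u \<otimes>\<^bsub>H\<^esub> ?T q) a \<otimes>\<^bsub>A\<^esub> hact A v (f (hact C (?T p) c))) y) x) h"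
      unfolding dual_hact_apply[OF h f C.lact_closed[OF c a]]
    proof (rule SH_cong[OF ag_A])
      fix x y assume xy [simp]: "x \<in> carrier H" "y \<in> carrier H"
      have "f (hact C (?T x) (lact C a c)) = f (SH H C (\<lambda>p q. lact C (hact A p a) (hact C q c)) (?T x))"
        by (simp add: hact_lact_SH)
      also have "\<dots> = SH H A (\<lambda>p q. f (lact C (hact A p a) (hact C q c))) (?T x)"
        by (rule SH_apply[OF ag_C ag_A klin_additive[OF klin_dual[OF f klin_id]]]) auto
      also have "\<dots> = SH H A (\<lambda>p q. hact A p a \<otimes>\<^bsub>A\<^esub> f (hact C q c)) (?T x)"
        by (rule SH_cong[OF ag_A]) (simp add: dual_lact[OF f])
      \<comment> \<open>\<open>S^-1\<close> reverses the coproduct; therefore the leg acting on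
        \<open>a\<close> becomes the neighbour of the legs of \<open>y\<close>, as the cancellation
        requires.\<close>
      also have "\<dots> = SH H A (\<lambda>p q. hact A (?T q) a \<otimes>\<^bsub>A\<^esub> f (hact C (?T p) c)) x"
        by (rule S_inv_comult[OF module_A]) (use f in \<open>auto intro!: dual_klin_intros\<close>)
      finally have "hact A y (f (hact C (?T x) (lact C a c))) =
        hact A y (SH H A (\<lambda>p q. hact A (?T q) a \<otimes>\<^bsub>A\<^esub> f (hact C (?T p) c)) x)" by simp
      also have "\<dots> = SH H A (\<lambda>p q. hact A y (hact A (?T q) a \<otimes>\<^bsub>A\<^esub> f (hact C (?T p) c))) x"
        by (rule SH_apply[OF ag_A ag_A A.additive_hact]) auto
      also have "\<dots> = SH H A (\<lambda>p q. SH H A (\<lambda>u v.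
          hact A (u \<otimes>\<^bsub>H\<^esub> ?T q) a \<otimes>\<^bsub>A\<^esub> hact A v (f (hact C (?T p) c))) y) x"
      proof (rule SH_cong[OF ag_A])
        fix p q assume [simp]: "p \<in> carrier H" "q \<in> carrier H"
        show "hact A y (hact A (?T q) a \<otimes>\<^bsub>A\<^esub> f (hact C (?T p) c)) = SH H A (\<lambda>u v.
          hact A (u \<otimes>\<^bsub>H\<^esub> ?T q) a \<otimes>\<^bsub>A\<^esub> hact A v (f (hact C (?T p) c))) y"
          by (subst hact_prod_SH) (auto intro!: SH_cong[OF ag_A] simp: A.hact_mult)
      qed
      finally show "hact A y (f (hact C (?T x) (lact C a c))) = \<dots>" .
    qed
    also have "\<dots> = SH H A (\<lambda>x y. hact A \<one>\<^bsub>H\<^esub> a \<otimes>\<^bsub>A\<^esub> hact A y (f (hact C (?T x) c))) h"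
      by (rule collapse_middle[OF module_A conv_unit_S_inv_right, where
            D = "\<lambda>p z v. hact A z a \<otimes>\<^bsub>A\<^esub> hact A v (f (hact C (?T p) c))"])
         (use f in \<open>auto intro!: dual_klin_intros\<close>)
    also have "\<dots> = a \<otimes>\<^bsub>A\<^esub> SH H A (\<lambda>x y. hact A y (f (hact C (?T x) c))) h"
      by (subst SH_apply[OF ag_A ag_A, of "\<lambda>z. a \<otimes>\<^bsub>A\<^esub> z"])
         (auto intro!: additiveI simp: A.r_distr A.hact_one)
    finally show ?thesis using h f c by (simp add: dual_hact_apply)
  qed
qed

text \<open>In \<open>g (h f)\<close> the argument meets \<open>S^-1\<close> of a leg of
  \<open>g\<close> before that of \<open>h\<close>; as \<open>S^-1\<close> reverses products, this
  is \<open>S^-1\<close> of a leg of \<open>g h\<close>.\<close>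

lemma dual_hact_mult:
  assumes g: "g \<in> carrier H" and h: "h \<in> carrier H" and f: "f \<in> carrier D"
  shows "hact D (g \<otimes>\<^bsub>H\<^esub> h) f = hact D g (hact D h f)"
proof (rule dual_eqI)
  note [simp] = A.hact_closed C.hact_closed dual_closed[OF f] g h
  let ?T = "S_H_inv H"
  fix c assume c [simp]: "c \<in> carrier C"
  have "hact D g (hact D h f) c = SH H A (\<lambda>x y. SH H A (\<lambda>u v.
      hact A y (hact A v (f (hact C (?T u) (hact C (?T x) c))))) h) g"
    unfolding dual_hact_apply[OF g dual_hact_closed[OF h f] c]
    by (intro SH_cong[OF ag_A], subst dual_hact_apply[OF h f], simp,
        rule SH_apply[OF ag_A ag_A A.additive_hact])
       auto
  also have "\<dots> = SH H A (\<lambda>x y. SH H A (\<lambda>u v.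
      hact A (y \<otimes>\<^bsub>H\<^esub> v) (f (hact C (?T (x \<otimes>\<^bsub>H\<^esub> u)) c))) h) g"
    by (intro SH_cong[OF ag_A]) (simp add: A.hact_mult C.hact_mult S_inv_mult)
  also have "\<dots> = hact D (g \<otimes>\<^bsub>H\<^esub> h) f c"
    by (subst dual_hact_apply)
       (auto simp: f intro!: SH_mult[OF module_A, symmetric] dual_klin_intros)
  finally show "hact D (g \<otimes>\<^bsub>H\<^esub> h) f c = hact D g (hact D h f) c" by simp
qed (use assms in \<open>auto simp: dual_hact_closed\<close>)

lemma dual_hact_one:
  assumes f: "f \<in> carrier D"
  shows "hact D \<one>\<^bsub>H\<^esub> f = f"
proof (rule dual_eqI)
  fix c assume c: "c \<in> carrier C"
  show "hact D \<one>\<^bsub>H\<^esub> f c = f c"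
    by (subst dual_hact_apply, simp, fact f, fact c, subst SH_one[OF module_A])
       (use f c in \<open>auto intro!: dual_klin_intros simp: S_inv_one C.hact_one A.hact_one dual_closed C.hact_closed\<close>)
qed (use f in \<open>auto simp: dual_hact_closed\<close>)

lemma dual_hact_add:
  assumes "g \<in> carrier H" "h \<in> carrier H" "f \<in> carrier D"
  shows "hact D (g \<oplus>\<^bsub>H\<^esub> h) f = hact D g f \<oplus>\<^bsub>D\<^esub> hact D h f"
  by (rule dual_eqI)
     (use assms klin_add[OF dual_hact_klin] in
       \<open>auto simp: dual_hact_closed dual_add_closed dual_add_apply\<close>)

lemma dual_hact_smult:
  assumes "x \<in> carrier k" "h \<in> carrier H" "f \<in> carrier D"
  shows "hact D (x \<odot>\<^bsub>H\<^esub> h) f = x \<odot>\<^bsub>D\<^esub> hact D h f"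
  by (rule dual_eqI)
     (use assms klin_smult[OF dual_hact_klin] in
       \<open>auto simp: dual_hact_closed dual_smult_closed dual_smult_apply\<close>)

lemma klin_dual_hact: "f \<in> carrier D \<Longrightarrow> klin k Y H g \<Longrightarrow> klin k Y D (\<lambda>y. hact D (g y) f)"
  by (rule klin_comp[of _ _ _ "\<lambda>h. hact D h f"])
     (auto intro!: klinI simp: dual_hact_closed dual_hact_add dual_hact_smult)

end

section \<open>The algebra \<open>A\<close> inside the dual ring, and evaluation of functionals on
  tensors\<close>

context hopf_coring
begin

text \<open>The ring homomorphism from \<open>A\<close> to the left dual through which \<open>A\<close> acts on modules over the latter.\<close>

definition iota :: "'a \<Rightarrow> 'c \<Rightarrow> 'a" where
  "iota a = (\<lambda>c\<in>carrier C. eps_C C c \<otimes>\<^bsub>A\<^esub> a)"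

lemma iota_apply: "c \<in> carrier C \<Longrightarrow> iota a c = eps_C C c \<otimes>\<^bsub>A\<^esub> a"
  by (simp add: iota_def)

lemma iota_closed: "a \<in> carrier A \<Longrightarrow> iota a \<in> carrier D"
  by (rule dualI)
     (auto simp: iota_apply eps_C_closed eps_C_add eps_C_lact C.lact_closed A.l_distr A.m_assoc,
      auto simp: iota_def)

lemma iota_one: "iota \<one>\<^bsub>A\<^esub> = \<one>\<^bsub>D\<^esub>"
  by (rule dual_eqI) (auto simp: iota_closed dual_one_closed iota_apply dual_one_apply eps_C_closed)

lemma iota_add: "a \<in> carrier A \<Longrightarrow> b \<in> carrier A \<Longrightarrow> iota (a \<oplus>\<^bsub>A\<^esub> b) = iota a \<oplus>\<^bsub>D\<^esub> iota b"
  by (rule dual_eqI)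
     (auto simp: iota_closed dual_add_closed iota_apply dual_add_apply eps_C_closed A.r_distr)

lemma iota_smult: "x \<in> carrier k \<Longrightarrow> a \<in> carrier A \<Longrightarrow> iota (x \<odot>\<^bsub>A\<^esub> a) = x \<odot>\<^bsub>D\<^esub> iota a"
  by (rule dual_eqI)
     (auto simp: iota_closed dual_smult_closed iota_apply dual_smult_apply eps_C_closed A.smult_mult_right)

text \<open>\<open>\<epsilon>(c1 f(c2)) a = f(\<epsilon>(c1) c2) a\<close>, to which the left counit
  law applies.\<close>

lemma dual_mult_iota:
  assumes f: "f \<in> carrier D" and a: "a \<in> carrier A" and c: "c \<in> carrier C"
  shows "(f \<otimes>\<^bsub>D\<^esub> iota a) c = f c \<otimes>\<^bsub>A\<^esub> a"
proof -
  interpret T: tensor_product A C "ract C" C "lact C" by (rule tensor_product_CC)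
  have "(f \<otimes>\<^bsub>D\<^esub> iota a) c = sweedler A (\<lambda>c1 c2. f (lact C (eps_C C c1) c2) \<otimes>\<^bsub>A\<^esub> a) (Delta_C C c)"
    unfolding dual_mult_apply[OF c]
    by (rule T.sweedler_cong[OF ag_A Delta_C_closed[OF c]])
       (use assms in \<open>auto simp: iota_apply C.ract_closed dual_closed eps_C_ract eps_C_closed dual_lact A.m_assoc\<close>)
  also have "\<dots> = f (sweedler C (\<lambda>c1 c2. lact C (eps_C C c1) c2) (Delta_C C c)) \<otimes>\<^bsub>A\<^esub> a"
    by (rule T.sweedler_apply[OF ag_C ag_A Delta_C_closed[OF c], symmetric])
       (use f a in \<open>auto intro!: additiveI simp: dual_closed dual_add A.l_distr eps_C_closed C.lact_closed\<close>)
  finally show ?thesis by (simp add: C.counit_left c)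
qed

text \<open>The right counit law reduces \<open>f(c1 \<epsilon>(c2) a)\<close>. Together with the
  preceding lemma this identifies the \<open>A\<close>-bimodule structure that \<open>iota\<close>
  induces on the dual ring.\<close>

lemma iota_dual_mult:
  assumes f: "f \<in> carrier D" and a: "a \<in> carrier A" and c: "c \<in> carrier C"
  shows "(iota a \<otimes>\<^bsub>D\<^esub> f) c = f (ract C c a)"
proof -
  interpret T: tensor_product A C "ract C" C "lact C" by (rule tensor_product_CC)
  have "(iota a \<otimes>\<^bsub>D\<^esub> f) c = sweedler A (\<lambda>c1 c2. f (ract C (ract C c1 (eps_C C c2)) a)) (Delta_C C c)"
    unfolding dual_mult_apply[OF c]
    by (rule T.sweedler_cong[OF ag_A Delta_C_closed[OF c]])
       (use assms in \<open>auto simp: iota_apply C.ract_closed dual_closed eps_C_closed C.ract_mult\<close>)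
  also have "\<dots> = f (ract C (sweedler C (\<lambda>c1 c2. ract C c1 (eps_C C c2)) (Delta_C C c)) a)"
    by (rule T.sweedler_apply[OF ag_C ag_A Delta_C_closed[OF c], of "\<lambda>x. f (ract C x a)", symmetric])
       (use f a in \<open>auto intro!: additiveI simp: dual_closed dual_add eps_C_closed C.ract_closed C.ract_add_left\<close>)
  finally show ?thesis by (simp add: C.counit_right c)
qed

lemma iota_mult: "a \<in> carrier A \<Longrightarrow> b \<in> carrier A \<Longrightarrow> iota (a \<otimes>\<^bsub>A\<^esub> b) = iota a \<otimes>\<^bsub>D\<^esub> iota b"
  by (rule dual_eqI)
     (auto simp: iota_closed dual_mult_closed iota_apply dual_mult_iota eps_C_closed A.m_assoc)

text \<open>\<open>(h iota(a))(c) = (h2 S^-1(h1) \<epsilon>(c)) (h3 a)\<close>, and the first factor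
  cancels. This lets the compatibility with \<open>H\<close> be restricted from the dual ring to
  \<open>A\<close>.\<close>

lemma hact_iota:
  assumes h: "h \<in> carrier H" and a: "a \<in> carrier A"
  shows "hact D h (iota a) = iota (hact A h a)"
proof (rule dual_eqI)
  note [simp] = A.hact_closed C.hact_closed eps_C_closed h a
  fix c assume c [simp]: "c \<in> carrier C"
  have "hact D h (iota a) c = SH H A (\<lambda>x y. SH H A (\<lambda>u v.
      hact A (u \<otimes>\<^bsub>H\<^esub> S_H_inv H x) (eps_C C c) \<otimes>\<^bsub>A\<^esub> hact A v a) y) h"
    unfolding dual_hact_apply[OF h iota_closed[OF a] c]
    by (intro SH_cong[OF ag_A], simp add: iota_apply eps_C_hact, subst hact_prod_SH)
       (auto intro!: SH_cong[OF ag_A] simp: A.hact_mult)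
  also have "\<dots> = hact A \<one>\<^bsub>H\<^esub> (eps_C C c) \<otimes>\<^bsub>A\<^esub> hact A h a"
    by (rule collapse_left'[OF module_A conv_unit_S_inv_right, where
          E = "\<lambda>z v. hact A z (eps_C C c) \<otimes>\<^bsub>A\<^esub> hact A v a"])
       (auto intro!: dual_klin_intros)
  finally show "hact D h (iota a) c = iota (hact A h a) c" by (simp add: A.hact_one iota_apply)
qed (use assms in \<open>auto simp: dual_hact_closed iota_closed A.hact_closed\<close>)

lemma balanced_eval:
  assumes "right_module k A M" and f: "f \<in> carrier D"
  shows "balanced A M (ract M) C (lact C) M (\<lambda>m c. ract M m (f c))"
proof -
  interpret M: right_module k A M by fact
  show ?thesis
    using f by (intro balancedI additiveI)
      (auto simp: M.ract_closed M.ract_add_left M.ract_add_right M.ract_mult dual_closed dual_add dual_lact)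
qed

text \<open>
  As \<open>f\<close> and \<open>g\<close> vary, these maps separate \<open>M \<otimes>\<^sub>A (C \<otimes>\<^sub>A C)\<close>; on both sides of coassociativity
  they give \<open>(m f) g\<close> and \<open>m (f # g)\<close>.
\<close>

definition eval2 :: "('k, 'h, 'a, 'm, 'z) hrmod_scheme \<Rightarrow> ('c \<Rightarrow> 'a) \<Rightarrow> ('c \<Rightarrow> 'a) \<Rightarrow> 'm \<Rightarrow> 'c \<Rightarrow> 'c \<Rightarrow> 'm" where
  "eval2 M f g m c d = ract M m (g (ract C c (f d)))"

lemma eval2_balanced:
  assumes M: "right_module k A M" and f: "f \<in> carrier D" and g: "g \<in> carrier D"
  shows "balanced3 A M (ract M) C (lact C) (ract C) C (lact C) M (eval2 M f g)"
proof -
  interpret M: right_module k A M by fact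
  show ?thesis
    unfolding eval2_def
    by (intro balanced3I additiveI)
       (use f g in \<open>auto simp: M.ract_closed M.ract_add_left M.ract_add_right M.ract_mult dual_closed
          dual_add dual_lact C.ract_closed C.lact_closed C.ract_add_left C.ract_add_right C.ract_mult C.lact_ract\<close>)
qed

lemma triple_tensor_C:
  assumes "right_module k A M"
  shows "triple_tensor A M (ract M) C (lact C) (ract C) C (lact C)
    (tensor_A_bimod H A C C) (lact (tensor_A_bimod H A C C))"
proof -
  interpret M: right_module k A M by fact
  interpret T: tensor_product A C "ract C" C "lact C" by (rule tensor_product_CC)
  show ?thesis
  proof (intro triple_tensor.intro triple_tensor_axioms.intro M.abelian_group_axioms tensor_product_CC
      M.ract_closed C.additive_lact_right C.lact_ract[symmetric])
    fix a t assume a: "a \<in> carrier A" and t: "t \<in> carrier (tensor_A_bimod H A C C)"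
    have c: "T.pure (lact C a m) n \<in> carrier T.T" if "m \<in> carrier C" "n \<in> carrier C" for m n
      using that a by (simp add: T.pure_closed C.lact_closed)
    \<comment> \<open>The left action of \<open>tensor_A_bimod\<close> is defined by a sum in
      \<open>tensor_A\<close>; its target is exchanged in two moves through the bare tensor
      group.\<close>
    have "sweedler (tensor_A H A C C) (\<lambda>m n. T.pure (lact C a m) n) t =
        sweedler T.T (\<lambda>m n. T.pure (lact C a m) n) t"
      by (rule T.sweedler_target[OF T.T_abelian_group]) (use t c in auto)
    also have "\<dots> = sweedler (tensor_A_bimod H A C C) (\<lambda>m n. T.pure (lact C a m) n) t"
      by (rule T.sweedler_target[OF T.T_abelian_group, symmetric]) (use t c in auto)
    finally show "lact (tensor_A_bimod H A C C) a t =
        sweedler (tensor_A_bimod H A C C) (\<lambda>n p. T.pure (lact C a n) p) t"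
      by (simp add: tensor_A_bimod_def Let_def)
  qed auto
qed

lemma SH_sweedler_swap:
  assumes T: "tensor_product R M ra N la" and X: "abelian_group X"
    and t: "t \<in> carrier (tensor_group R M ra N la)" and h: "h \<in> carrier H"
    and b: "\<And>x y m n. x \<in> carrier H \<Longrightarrow> y \<in> carrier H \<Longrightarrow> m \<in> carrier M \<Longrightarrow> n \<in> carrier N \<Longrightarrow>
      b x y m n \<in> carrier X"
  shows "SH H X (\<lambda>x y. sweedler X (b x y) t) h = sweedler X (\<lambda>m n. SH H X (\<lambda>x y. b x y m n) h) t"
proof -
  interpret T: tensor_product R M ra N la by fact
  have c: "sweedler X (b x y) t \<in> carrier X" if "x \<in> carrier H" "y \<in> carrier H" for x y
    by (rule T.sweedler_closed[OF X t]) (use b that in auto)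
  have "SH H X (\<lambda>x y. sweedler X (b x y) t) h = sweedler X (\<lambda>x y. sweedler X (b x y) t) (Delta_H H h)"
    by (rule SH_eq[OF h]) (rule c)
  also have "\<dots> = sweedler X (\<lambda>m n. sweedler X (\<lambda>x y. b x y m n) (Delta_H H h)) t"
    by (rule sweedler_swap[OF tensor_product_H T X Delta_closed[OF h] t]) (rule b)
  also have "\<dots> = sweedler X (\<lambda>m n. SH H X (\<lambda>x y. b x y m n) h) t"
    by (rule T.sweedler_cong[OF X t])
       (use SH_closed[OF X] h b in \<open>auto simp flip: SH_eq\<close>)
  finally show ?thesis .
qed

text \<open>\<open>b\<close> passes through two finite sums over chosen representatives, of
  \<open>t\<close> and of the coproduct, and becomes visible on the resulting pure tensors.\<close>

lemma tensor_A_hact: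
  assumes M: "hr_module k H A M" and h: "h \<in> carrier H"
    and t: "t \<in> carrier (tensor_group A M (ract M) C (lact C))"
  shows "hact (tensor_A H A M C) h t \<in> carrier (tensor_group A M (ract M) C (lact C))"
    and "abelian_group X \<Longrightarrow> balanced A M (ract M) C (lact C) X b \<Longrightarrow>
      sweedler X b (hact (tensor_A H A M C) h t) =
      sweedler X (\<lambda>m c. SH H X (\<lambda>x y. b (hact M x m) (hact C y c)) h) t"
proof -
  interpret M: hr_module k H A M by fact
  interpret T: tensor_product A M "ract M" C "lact C" by (rule tensor_product_C) (rule M.right_module_axioms)
  note cl = T.pure_closed M.hact_closed C.hact_closed
  let ?T = "tensor A M (ract M) C (lact C)"
  have agT: "abelian_group ?T"
    by (rule abelian_group_cong[OF T.T_abelian_group]) auto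
  have inner: "sweedler ?T (\<lambda>x y. T.pure (hact M x m) (hact C y c)) (Delta_H H h) =
      SH H ?T (\<lambda>x y. T.pure (hact M x m) (hact C y c)) h" if "m \<in> carrier M" "c \<in> carrier C" for m c
    using that h by (simp add: SH_eq cl)
  have e: "hact (tensor_A H A M C) h t =
      sweedler ?T (\<lambda>m c. SH H ?T (\<lambda>x y. T.pure (hact M x m) (hact C y c)) h) t"
    unfolding tensor_A_def Let_def
    apply simp
    apply (rule T.sweedler_cong[OF agT t])
    using inner SH_closed[OF agT] by auto
  have "sweedler ?T (\<lambda>m c. SH H ?T (\<lambda>x y. T.pure (hact M x m) (hact C y c)) h) t \<in> carrier ?T"
    by (rule T.sweedler_closed[OF agT t]) (rule SH_closed[OF agT])
  then show "hact (tensor_A H A M C) h t \<in> carrier T.T" by (simp add: e)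
  assume X: "abelian_group X" and b: "balanced A M (ract M) C (lact C) X b"
  have a: "additive ?T X (sweedler X b)"
    using T.sweedler_additive[OF X b] by (simp add: additive_def)
  have bc: "b m c \<in> carrier X" if "m \<in> carrier M" "c \<in> carrier C" for m c
    using b that by (auto simp: balanced_def additive_def)
  have "sweedler X b (hact (tensor_A H A M C) h t) =
    sweedler X (\<lambda>m c. sweedler X b (SH H ?T (\<lambda>x y. T.pure (hact M x m) (hact C y c)) h)) t"
    unfolding e by (rule T.sweedler_apply[OF agT X t a]) (rule SH_closed[OF agT])
  also have "\<dots> = sweedler X (\<lambda>m c. SH H X (\<lambda>x y. b (hact M x m) (hact C y c)) h) t"
  proof (rule T.sweedler_cong[OF X t])
    fix m c assume mc: "m \<in> carrier M" "c \<in> carrier C"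
    have "sweedler X b (SH H ?T (\<lambda>x y. T.pure (hact M x m) (hact C y c)) h) =
      SH H X (\<lambda>x y. sweedler X b (T.pure (hact M x m) (hact C y c))) h"
      by (rule SH_apply[OF agT X a h]) (simp add: cl mc)
    also have "\<dots> = SH H X (\<lambda>x y. b (hact M x m) (hact C y c)) h"
      by (rule SH_cong[OF X]) (simp add: T.sweedler_pure[OF X b] mc cl)
    finally show "sweedler X b (SH H ?T (\<lambda>x y. T.pure (hact M x m) (hact C y c)) h) = \<dots>" .
    then show "sweedler X b (SH H ?T (\<lambda>x y. T.pure (hact M x m) (hact C y c)) h) \<in> carrier X"
      by (simp add: SH_closed[OF X])
  qed
  finally show "sweedler X b (hact (tensor_A H A M C) h t) = \<dots>" .
qed

lemma tensor_A_ract: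
  assumes M: "right_module k A M" and a: "a \<in> carrier A"
    and t: "t \<in> carrier (tensor_group A M (ract M) C (lact C))"
  shows "ract (tensor_A H A M C) t a \<in> carrier (tensor_group A M (ract M) C (lact C))"
    and "abelian_group X \<Longrightarrow> balanced A M (ract M) C (lact C) X b \<Longrightarrow>
      sweedler X b (ract (tensor_A H A M C) t a) = sweedler X (\<lambda>m c. b m (ract C c a)) t"
proof -
  interpret M: right_module k A M by fact
  interpret T: tensor_product A M "ract M" C "lact C" by (rule tensor_product_C) (rule M)
  let ?T = "tensor A M (ract M) C (lact C)"
  have agT: "abelian_group ?T"
    by (rule abelian_group_cong[OF T.T_abelian_group]) auto
  have e: "ract (tensor_A H A M C) t a = sweedler ?T (\<lambda>m c. T.pure m (ract C c a)) t"
    by (simp add: tensor_A_def Let_def)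
  have "sweedler ?T (\<lambda>m c. T.pure m (ract C c a)) t \<in> carrier ?T"
    by (rule T.sweedler_closed[OF agT t]) (simp add: a C.ract_closed T.pure_closed)
  then show "ract (tensor_A H A M C) t a \<in> carrier (tensor_group A M (ract M) C (lact C))"
    by (simp add: e)
  assume X: "abelian_group X" and b: "balanced A M (ract M) C (lact C) X b"
  show "sweedler X b (ract (tensor_A H A M C) t a) = sweedler X (\<lambda>m c. b m (ract C c a)) t"
    unfolding e
    by (rule T.sweedler_sweedler_pure[OF X b _ _ _ T.tensor_product_axioms t]) (auto simp: a C.ract_closed)
qed

end

section \<open>From comodules to modules over the left dual\<close>

locale hopf_coring_comodule = hopf_coring k H A C + M: hc_comodule k H A C M
  for k :: "('k, 'y) ring_scheme" and H :: "('k, 'h) hopf"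
    and A :: "('k, 'h, 'a) hmod" and C :: "('k, 'h, 'a, 'c) coring"
    and M :: "('k, 'h, 'a, 'c, 'm) comod"
begin

lemma ag_M: "abelian_group M" and module_M: "module k M"
  by (rule M.abelian_group_axioms, rule M.module_axioms)

interpretation T: tensor_product A M "ract M" C "lact C"
  by (rule tensor_product_C) (rule M.right_module_axioms)

lemma rho_closed: "x \<in> carrier M \<Longrightarrow> rho M x \<in> carrier T.T"
  using M.rho_right_linear by (auto simp: right_linear_def)

lemma rho_additive: "additive M T.T (rho M)"
  using M.rho_right_linear by (auto simp: right_linear_def additive_def)

lemma rho_ract: "x \<in> carrier M \<Longrightarrow> a \<in> carrier A \<Longrightarrow> rho M (ract M x a) = ract (tensor_A H A M C) (rho M x) a"
  using M.rho_right_linear by (auto simp: right_linear_def)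

lemma rho_hact: "x \<in> carrier M \<Longrightarrow> h \<in> carrier H \<Longrightarrow> rho M (hact M h x) = hact (tensor_A H A M C) h (rho M x)"
  using M.rho_h_linear by (auto simp: h_linear_def left_linear_def)

definition dact :: "'m \<Rightarrow> ('c \<Rightarrow> 'a) \<Rightarrow> 'm" where
  "dact x f = sweedler M (\<lambda>m0 m1. ract M m0 (f m1)) (rho M x)"

lemmas eval_balanced = balanced_eval[OF M.right_module_axioms]

lemma eval_closed: "f \<in> carrier D \<Longrightarrow> m \<in> carrier M \<Longrightarrow> c \<in> carrier C \<Longrightarrow> ract M m (f c) \<in> carrier M"
  by (simp add: M.ract_closed dual_closed)

lemma dact_additive: "f \<in> carrier D \<Longrightarrow> additive M M (\<lambda>x. dact x f)"
  unfolding dact_def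
  by (rule additive_comp[OF rho_additive T.sweedler_additive[OF ag_M eval_balanced]])

lemma dact_closed: "x \<in> carrier M \<Longrightarrow> f \<in> carrier D \<Longrightarrow> dact x f \<in> carrier M"
  by (rule additive_closed[OF dact_additive])

lemma dact_ract:
  assumes "x \<in> carrier M" "a \<in> carrier A" "f \<in> carrier D"
  shows "dact (ract M x a) f = sweedler M (\<lambda>m0 m1. ract M m0 (f (ract C m1 a))) (rho M x)"
  unfolding dact_def rho_ract[OF assms(1,2)]
  by (rule tensor_A_ract(2)[OF M.right_module_axioms assms(2) rho_closed[OF assms(1)] ag_M
      eval_balanced[OF assms(3)]])

lemma dact_smult:
  assumes x: "x \<in> carrier M" and c: "c \<in> carrier k" and f: "f \<in> carrier D"
  shows "dact (c \<odot>\<^bsub>M\<^esub> x) f = c \<odot>\<^bsub>M\<^esub> dact x f"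
proof -
  have c1: "c \<odot>\<^bsub>A\<^esub> \<one>\<^bsub>A\<^esub> \<in> carrier A" using c by simp
  \<comment> \<open>Linearity of the coaction is given over \<open>A\<close>, so the scalar is
    routed through \<open>c 1\<close> in \<open>A\<close>.\<close>
  have "c \<odot>\<^bsub>M\<^esub> x = ract M x (c \<odot>\<^bsub>A\<^esub> \<one>\<^bsub>A\<^esub>)"
    using x c by (simp add: M.ract_smult_right M.ract_one)
  then have "dact (c \<odot>\<^bsub>M\<^esub> x) f =
      sweedler M (\<lambda>m0 m1. ract M m0 (f (ract C m1 (c \<odot>\<^bsub>A\<^esub> \<one>\<^bsub>A\<^esub>)))) (rho M x)"
    using dact_ract[OF x c1 f] by simp
  also have "\<dots> = sweedler M (\<lambda>m0 m1. c \<odot>\<^bsub>M\<^esub> ract M m0 (f m1)) (rho M x)"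
    by (rule T.sweedler_cong[OF ag_M rho_closed[OF x]])
       (use c f in \<open>auto simp: C.ract_smult_right C.ract_one dual_smult dual_closed M.ract_smult_right M.ract_closed\<close>)
  also have "\<dots> = c \<odot>\<^bsub>M\<^esub> dact x f"
    unfolding dact_def
    by (rule T.sweedler_apply[OF ag_M ag_M rho_closed[OF x] klin_additive[OF M.smult_klin[OF c]], symmetric])
       (rule eval_closed[OF f])
  finally show ?thesis .
qed

lemma dact_add_right:
  assumes x: "x \<in> carrier M" and f: "f \<in> carrier D" and g: "g \<in> carrier D"
  shows "dact x (f \<oplus>\<^bsub>D\<^esub> g) = dact x f \<oplus>\<^bsub>M\<^esub> dact x g"
proof -
  have "dact x (f \<oplus>\<^bsub>D\<^esub> g) = sweedler M (\<lambda>m0 m1. ract M m0 (f m1) \<oplus>\<^bsub>M\<^esub> ract M m0 (g m1)) (rho M x)"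
    unfolding dact_def
    by (rule T.sweedler_cong[OF ag_M rho_closed[OF x]])
       (use f g in \<open>auto simp: dual_add_apply M.ract_add_right dual_closed M.ract_closed\<close>)
  also have "\<dots> = dact x f \<oplus>\<^bsub>M\<^esub> dact x g"
    unfolding dact_def by (rule T.sweedler_add_fun[OF ag_M rho_closed[OF x]]) (rule eval_closed[OF f], auto simp: eval_closed[OF g])
  finally show ?thesis .
qed

lemma dact_smult_right:
  assumes x: "x \<in> carrier M" and c: "c \<in> carrier k" and f: "f \<in> carrier D"
  shows "dact x (c \<odot>\<^bsub>D\<^esub> f) = c \<odot>\<^bsub>M\<^esub> dact x f"
proof -
  have "dact x (c \<odot>\<^bsub>D\<^esub> f) = sweedler M (\<lambda>m0 m1. c \<odot>\<^bsub>M\<^esub> ract M m0 (f m1)) (rho M x)"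
    unfolding dact_def
    by (rule T.sweedler_cong[OF ag_M rho_closed[OF x]])
       (use f c in \<open>auto simp: dual_smult_apply M.ract_smult_right dual_closed M.ract_closed\<close>)
  also have "\<dots> = c \<odot>\<^bsub>M\<^esub> dact x f"
    unfolding dact_def
    by (rule T.sweedler_apply[OF ag_M ag_M rho_closed[OF x] klin_additive[OF M.smult_klin[OF c]], symmetric])
       (rule eval_closed[OF f])
  finally show ?thesis .
qed

text \<open>\<open>m0 \<epsilon>(m1) a = x a\<close> by the counit law. This recovers the
  \<open>A\<close>-action from the action of the dual ring, as needed for the round trip of
  comodules.\<close>

lemma dact_iota:
  assumes x: "x \<in> carrier M" and a: "a \<in> carrier A"
  shows "dact x (iota a) = ract M x a"
proof -
  have "dact x (iota a) = sweedler M (\<lambda>m0 m1. ract M (ract M m0 (eps_C C m1)) a) (rho M x)"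
    unfolding dact_def
    by (rule T.sweedler_cong[OF ag_M rho_closed[OF x]])
       (use a in \<open>auto simp: iota_apply M.ract_mult eps_C_closed M.ract_closed\<close>)
  also have "\<dots> = ract M (sweedler M (\<lambda>m0 m1. ract M m0 (eps_C C m1)) (rho M x)) a"
    by (rule T.sweedler_apply[OF ag_M ag_M rho_closed[OF x] M.additive_ract_left[OF a], symmetric])
       (simp add: eps_C_closed M.ract_closed)
  finally show ?thesis by (simp add: M.coact_counit x)
qed

lemma dact_one: "x \<in> carrier M \<Longrightarrow> dact x \<one>\<^bsub>D\<^esub> = x"
  using dact_iota[of x "\<one>\<^bsub>A\<^esub>"] by (simp add: iota_one M.ract_one)

lemma dact_mult:
  assumes x: "x \<in> carrier M" and f: "f \<in> carrier D" and g: "g \<in> carrier D"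
  shows "dact x (f \<otimes>\<^bsub>D\<^esub> g) = dact (dact x f) g"
proof -
  interpret CC: tensor_product A C "ract C" C "lact C" by (rule tensor_product_CC)
  interpret TT: triple_tensor A M "ract M" C "lact C" "ract C" C "lact C"
    "tensor_A_bimod H A C C" "lact (tensor_A_bimod H A C C)"
    by (rule triple_tensor_C) (rule M.right_module_axioms)
  let ?b = "eval2 M f g"
  note bal = eval2_balanced[OF M.right_module_axioms f g]
  have bc: "?b m c d \<in> carrier M" if "m \<in> carrier M" "c \<in> carrier C" "d \<in> carrier C" for m c d
    using that f g by (simp add: eval2_def M.ract_closed dual_closed C.ract_closed)
  have D: "Delta_C C c \<in> carrier (tensor_A_bimod H A C C)" if "c \<in> carrier C" for c
    using Delta_C_closed[OF that] by simp
  have "dact x (f \<otimes>\<^bsub>D\<^esub> g) = sweedler M (\<lambda>m0 m1. sweedler M (?b m0) (Delta_C C m1)) (rho M x)"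
    unfolding dact_def
  proof (rule T.sweedler_cong[OF ag_M rho_closed[OF x]])
    fix m c assume mc: "m \<in> carrier M" "c \<in> carrier C"
    show "ract M m ((f \<otimes>\<^bsub>D\<^esub> g) c) \<in> carrier M"
      by (rule eval_closed[OF dual_mult_closed[OF f g] mc])
    show "ract M m ((f \<otimes>\<^bsub>D\<^esub> g) c) = sweedler M (?b m) (Delta_C C c)"
      unfolding dual_mult_apply[OF mc(2)] eval2_def
      by (rule CC.sweedler_apply[OF ag_A ag_M Delta_C_closed[OF mc(2)] M.additive_ract_right[OF mc(1)]])
         (use f g in \<open>simp add: dual_closed C.ract_closed\<close>)
  qed
  also have "\<dots> = sweedler M (\<lambda>m0 m1. sweedler M (\<lambda>m00 m01. ?b m00 m01 m1) (rho M m0)) (rho M x)"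
  proof (rule TT.sweedler_coassoc[where Y = "tensor_A H A M (tensor_A_bimod H A C C)", symmetric])
    show "abelian_group (tensor_A H A M (tensor_A_bimod H A C C))"
      by (rule abelian_group_cong[OF TT.MNP.T_abelian_group]) auto
  qed (use M.coact_coassoc[OF x] rho_closed x D bal ag_M T.tensor_product_axioms in auto)
  \<comment> \<open>By right \<open>A\<close>-linearity of the coaction, acting with
    \<open>f(m1)\<close> on \<open>m0\<close> multiplies the second leg of \<open>rho M m0\<close>,
    which is the argument \<open>m01 f(m1)\<close> of \<open>g\<close> in
    \<open>eval2\<close>.\<close>
  also have "\<dots> = sweedler M (\<lambda>m0 m1. dact (ract M m0 (f m1)) g) (rho M x)"
    by (rule T.sweedler_cong[OF ag_M rho_closed[OF x]])
       (use f g bc in \<open>auto simp: dact_ract dual_closed eval2_def intro!: T.sweedler_closed[OF ag_M rho_closed]\<close>)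
  also have "\<dots> = dact (dact x f) g"
    by (subst (2) dact_def,
        rule T.sweedler_apply[OF ag_M ag_M rho_closed[OF x] dact_additive[OF g], symmetric])
       (rule eval_closed[OF f])
  finally show ?thesis .
qed

lemma dact_hact:
  assumes x: "x \<in> carrier M" and h: "h \<in> carrier H" and f: "f \<in> carrier D"
  shows "dact (hact M h x) f =
    sweedler M (\<lambda>m c. SH H M (\<lambda>p q. ract M (hact M p m) (f (hact C q c))) h) (rho M x)"
  unfolding dact_def rho_hact[OF x h]
  by (rule tensor_A_hact(2)[OF M.hr_module_axioms h rho_closed[OF x] ag_M eval_balanced[OF f]])

text \<open>The cancellation is carried out for a single pair \<open>m, c\<close>, where only
  coproducts in \<open>H\<close> occur; summation over the coaction is added afterwards by
  exchanging sums.\<close>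

lemma eval_hact:
  assumes h: "h \<in> carrier H" and f: "f \<in> carrier D" and m: "m \<in> carrier M" and c: "c \<in> carrier C"
  shows "SH H M (\<lambda>x y. SH H M (\<lambda>p q. ract M (hact M p m) (hact D y f (hact C q c))) x) h =
    hact M h (ract M m (f c))"
proof -
  note [simp] = A.hact_closed C.hact_closed M.hact_closed M.ract_closed dual_closed[OF f] h m c
  let ?T = "S_H_inv H"
  have "SH H M (\<lambda>x y. SH H M (\<lambda>p q. ract M (hact M p m) (hact D y f (hact C q c))) x) h =
    SH H M (\<lambda>x y. SH H M (\<lambda>p q. SH H M (\<lambda>u v.
      ract M (hact M p m) (hact A v (f (hact C (?T u \<otimes>\<^bsub>H\<^esub> q) c)))) y) x) h"
  proof (intro SH_cong[OF ag_M])
    fix x y p q assume [simp]: "x \<in> carrier H" "y \<in> carrier H" "p \<in> carrier H" "q \<in> carrier H"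
    have "ract M (hact M p m) (hact D y f (hact C q c)) =
      ract M (hact M p m) (SH H A (\<lambda>u v. hact A v (f (hact C (?T u) (hact C q c)))) y)"
      by (simp add: dual_hact_apply f)
    also have "\<dots> = SH H M (\<lambda>u v. ract M (hact M p m) (hact A v (f (hact C (?T u) (hact C q c))))) y"
      by (rule SH_apply[OF ag_A ag_M M.additive_ract_right]) auto
    also have "\<dots> = SH H M (\<lambda>u v. ract M (hact M p m) (hact A v (f (hact C (?T u \<otimes>\<^bsub>H\<^esub> q) c)))) y"
      by (rule SH_cong[OF ag_M]) (simp add: C.hact_mult)
    finally show "ract M (hact M p m) (hact D y f (hact C q c)) = \<dots>" .
  qed
  also have "\<dots> = SH H M (\<lambda>x y. ract M (hact M x m) (hact A y (f (hact C \<one>\<^bsub>H\<^esub> c)))) h"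
    by (rule collapse_middle[OF module_M conv_unit_S_inv_left, where
          D = "\<lambda>p z v. ract M (hact M p m) (hact A v (f (hact C z c)))"])
       (use f in \<open>auto intro!: dual_klin_intros M.klin_ract_left M.klin_ract_right M.klin_hact_left\<close>)
  also have "\<dots> = hact M h (ract M m (f c))"
    by (simp add: C.hact_one hact_ract_SH[OF M.hr_module_axioms])
  finally show ?thesis .
qed

lemma hact_dact:
  assumes x: "x \<in> carrier M" and h: "h \<in> carrier H" and f: "f \<in> carrier D"
  shows "hact M h (dact x f) = SH H M (\<lambda>h1 h2. dact (hact M h1 x) (hact D h2 f)) h"
proof -
  note [simp] = A.hact_closed C.hact_closed M.hact_closed M.ract_closed dual_closed
    dual_hact_closed f h
  have "SH H M (\<lambda>h1 h2. dact (hact M h1 x) (hact D h2 f)) h =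
    SH H M (\<lambda>h1 h2. sweedler M (\<lambda>m c. SH H M (\<lambda>p q. ract M (hact M p m) (hact D h2 f (hact C q c))) h1) (rho M x)) h"
    by (rule SH_cong[OF ag_M]) (simp add: dact_hact x)
  also have "\<dots> = sweedler M (\<lambda>m c. SH H M (\<lambda>h1 h2.
      SH H M (\<lambda>p q. ract M (hact M p m) (hact D h2 f (hact C q c))) h1) h) (rho M x)"
    by (rule SH_sweedler_swap[OF T.tensor_product_axioms ag_M rho_closed[OF x] h])
       (rule SH_closed[OF ag_M])
  also have "\<dots> = sweedler M (\<lambda>m c. hact M h (ract M m (f c))) (rho M x)"
    by (rule T.sweedler_cong[OF ag_M rho_closed[OF x]])
       (auto simp: eval_hact)
  also have "\<dots> = hact M h (dact x f)"
    unfolding dact_def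
    by (rule T.sweedler_apply[OF ag_M ag_M rho_closed[OF x] M.additive_hact[OF h], symmetric]) simp
  finally show ?thesis by simp
qed

abbreviation "FM \<equiv> comod_to_mod H A C M"

lemma FM_simps [simp]:
  "carrier FM = carrier M" "ring.add FM = ring.add M" "ring.zero FM = ring.zero M"
  "monoid.mult FM = monoid.mult M" "monoid.one FM = monoid.one M"
  "smult FM = smult M" "hact FM = hact M"
  by (simp_all add: comod_to_mod_def)

lemma FM_ract [simp]: "x \<in> carrier M \<Longrightarrow> f \<in> carrier D \<Longrightarrow> ract FM x f = dact x f"
  by (simp add: comod_to_mod_def dact_def)

lemma module_FM: "module k FM"
  by (rule moduleI)
     (auto simp: M.smult_l_distr M.smult_r_distr M.smult_assoc1 module.axioms(1)[OF module_M]
        intro: abelian_group_cong[OF ag_M])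

lemma hr_module_FM: "hr_module k H D FM"
proof (intro hr_module.intro h_module.intro right_module.intro module_FM)
  show "h_module_axioms k H FM"
    by unfold_locales
       (auto simp: M.hact_closed M.hact_add_left M.hact_add_right M.hact_smult_left M.hact_smult_right
          M.hact_one M.hact_mult)
  show "right_module_axioms k D FM"
    by unfold_locales
       (auto simp: dact_closed additive_add[OF dact_additive] dual_add_closed dact_add_right dact_smult
          dual_smult_closed dact_smult_right dual_one_closed dact_one dual_mult_closed dact_mult)
  show "hr_module_axioms H D FM"
  proof
    fix h x f assume a: "h \<in> carrier H" "x \<in> carrier FM" "f \<in> carrier D"
    have c: "dact (hact M h1 x) (hact D h2 f) \<in> carrier M" if "h1 \<in> carrier H" "h2 \<in> carrier H" for h1 h2
      using that a by (simp add: dact_closed M.hact_closed dual_hact_closed)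
    have "hact M h (dact x f) = sweedler M (\<lambda>h1 h2. dact (hact M h1 x) (hact D h2 f)) (Delta_H H h)"
      using hact_dact[of x h f] a c by (simp add: SH_eq)
    \<comment> \<open>\<open>FM\<close> is another record around the additive group of
      \<open>M\<close>, so the target of the sum is changed before the actions are
      rewritten.\<close>
    also have "\<dots> = sweedler FM (\<lambda>h1 h2. dact (hact M h1 x) (hact D h2 f)) (Delta_H H h)"
      by (rule tensor_product.sweedler_target[OF tensor_product_H ag_M, symmetric])
         (use a c Delta_closed in auto)
    also have "\<dots> = sweedler FM (\<lambda>h1 h2. ract FM (hact FM h1 x) (hact D h2 f)) (Delta_H H h)"
      by (rule tensor_product.sweedler_cong[OF tensor_product_H module_abelian_group[OF module_FM]])
         (use a c Delta_closed in \<open>auto simp: M.hact_closed dual_hact_closed\<close>)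
    finally show "hact FM h (ract FM x f) =
        sweedler FM (\<lambda>h1 h2. ract FM (hact FM h1 x) (hact D h2 f)) (Delta_H H h)"
      using a by simp
  qed
qed

end

section \<open>Dual bases\<close>

lemma additive_finsum_fun:
  assumes X: "abelian_group X" and Y: "abelian_group Y" and f: "\<And>j. j \<in> J \<Longrightarrow> additive X Y (f j)"
  shows "additive X Y (\<lambda>x. \<Oplus>\<^bsub>Y\<^esub>j\<in>J. f j x)"
proof -
  interpret Y: abelian_group Y by fact
  have cl: "(\<lambda>j. f j x) \<in> J \<rightarrow> carrier Y" if "x \<in> carrier X" for x
    using additive_closed[OF f that] by blast
  show ?thesis
  proof (rule additiveI)
    fix x y assume xy: "x \<in> carrier X" "y \<in> carrier X"
    have "(\<Oplus>\<^bsub>Y\<^esub>j\<in>J. f j (x \<oplus>\<^bsub>X\<^esub> y)) = (\<Oplus>\<^bsub>Y\<^esub>j\<in>J. f j x \<oplus>\<^bsub>Y\<^esub> f j y)"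
      by (rule Y.finsum_cong') (use cl xy in \<open>auto simp: additive_add[OF f]\<close>)
    also have "\<dots> = (\<Oplus>\<^bsub>Y\<^esub>j\<in>J. f j x) \<oplus>\<^bsub>Y\<^esub> (\<Oplus>\<^bsub>Y\<^esub>j\<in>J. f j y)"
      by (rule Y.finsum_addf) (use cl xy in auto)
    finally show "(\<Oplus>\<^bsub>Y\<^esub>j\<in>J. f j (x \<oplus>\<^bsub>X\<^esub> y)) = \<dots>" .
  qed (use cl in \<open>auto intro: Y.finsum_closed\<close>)
qed

locale dual_basis = hopf_coring k H A C
  for k :: "('k, 'y) ring_scheme" and H :: "('k, 'h) hopf"
    and A :: "('k, 'h, 'a) hmod" and C :: "('k, 'h, 'a, 'c) coring" +
  fixes J :: "'j set" and e :: "'j \<Rightarrow> 'c" and \<phi> :: "'j \<Rightarrow> 'c \<Rightarrow> 'a"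
  assumes finite_J: "finite J"
    and e_closed: "j \<in> J \<Longrightarrow> e j \<in> carrier C"
    and \<phi>_closed: "j \<in> J \<Longrightarrow> \<phi> j \<in> carrier D"
    and expand: "c \<in> carrier C \<Longrightarrow> c = (\<Oplus>\<^bsub>C\<^esub>j\<in>J. lact C (\<phi> j c) (e j))"
begin

text \<open>\<open>f(c) = \<Sum> \<phi>j(c) f(ej)\<close> by left linearity, and multiplying by
  \<open>iota(a)\<close> on the right multiplies values by \<open>a\<close>. So the functionals
  \<open>\<phi>j\<close> generate the dual as a right \<open>A\<close>-module.\<close>

lemma dual_expand:
  assumes f: "f \<in> carrier D"
  shows "f = (\<Oplus>\<^bsub>D\<^esub>j\<in>J. \<phi> j \<otimes>\<^bsub>D\<^esub> iota (f (e j)))"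
proof (rule dual_eqI[OF f])
  interpret D: abelian_group D by (rule abelian_group_dual)
  have c: "\<phi> j \<otimes>\<^bsub>D\<^esub> iota (f (e j)) \<in> carrier D" if "j \<in> J" for j
    using that f by (simp add: dual_mult_closed iota_closed dual_closed e_closed \<phi>_closed)
  then show "(\<Oplus>\<^bsub>D\<^esub>j\<in>J. \<phi> j \<otimes>\<^bsub>D\<^esub> iota (f (e j))) \<in> carrier D"
    by (intro D.finsum_closed) auto
  fix x assume x: "x \<in> carrier C"
  have "f x = f (\<Oplus>\<^bsub>C\<^esub>j\<in>J. lact C (\<phi> j x) (e j))"
    using expand[OF x] by simp
  also have "\<dots> = (\<Oplus>\<^bsub>A\<^esub>j\<in>J. f (lact C (\<phi> j x) (e j)))"
    by (rule additive_finsum[OF ag_C ag_A _ finite_J])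
       (use f x in \<open>auto intro!: additiveI simp: dual_closed dual_add C.lact_closed e_closed \<phi>_closed\<close>)
  also have "\<dots> = (\<Oplus>\<^bsub>A\<^esub>j\<in>J. (\<phi> j \<otimes>\<^bsub>D\<^esub> iota (f (e j))) x)"
    by (rule A.M.finsum_cong')
       (use f x in \<open>auto simp: dual_mult_iota dual_closed dual_lact e_closed \<phi>_closed\<close>)
  also have "\<dots> = (\<Oplus>\<^bsub>D\<^esub>j\<in>J. \<phi> j \<otimes>\<^bsub>D\<^esub> iota (f (e j))) x"
    by (rule additive_finsum[OF abelian_group_dual ag_A _ finite_J, of "\<lambda>f. f x", symmetric])
       (use x c in \<open>auto intro!: additiveI simp: dual_closed dual_add_apply\<close>)
  finally show "f x = (\<Oplus>\<^bsub>D\<^esub>j\<in>J. \<phi> j \<otimes>\<^bsub>D\<^esub> iota (f (e j))) x" .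
qed

text \<open>Both sides are additive in \<open>t\<close>. For a pure tensor, \<open>c\<close> is
  expanded in the dual basis and the coefficients \<open>\<phi>j(c)\<close> are moved to the left
  leg.\<close>

lemma tensor_expand:
  assumes M: "right_module k A M" and t: "t \<in> carrier (tensor_group A M (ract M) C (lact C))"
  shows "t = (\<Oplus>\<^bsub>tensor_group A M (ract M) C (lact C)\<^esub>j\<in>J.
    pure_A A M C (sweedler M (\<lambda>m c. ract M m (\<phi> j c)) t) (e j))"
proof -
  interpret M: right_module k A M by fact
  interpret T: tensor_product A M "ract M" C "lact C" by (rule tensor_product_C) (rule M)
  interpret TT: abelian_group T.T by (rule T.T_abelian_group)
  note agM = M.abelian_group_axioms and agT = T.T_abelian_group
  let ?ev = "\<lambda>j. sweedler M (\<lambda>m c. ract M m (\<phi> j c))"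
  have ev: "additive T.T M (?ev j)" if "j \<in> J" for j
    by (rule T.sweedler_additive[OF agM balanced_eval[OF M \<phi>_closed[OF that]]])
  have ev_pure: "?ev j (T.pure m c) = ract M m (\<phi> j c)" if "j \<in> J" "m \<in> carrier M" "c \<in> carrier C" for j m c
    by (rule T.sweedler_pure[OF agM balanced_eval[OF M \<phi>_closed[OF that(1)]] that(2,3)])
  have left: "additive M T.T (\<lambda>m. T.pure m c)" if "c \<in> carrier C" for c
    using T.pure_balanced that by (simp add: balanced_def)
  have right: "additive C T.T (T.pure m)" if "m \<in> carrier M" for m
    using T.pure_balanced that by (simp add: balanced_def)
  have cl: "T.pure (?ev j u) (e j) \<in> carrier T.T" if "j \<in> J" "u \<in> carrier T.T" for j u
    using additive_closed[OF ev] that by (simp add: T.pure_closed e_closed)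
  show ?thesis
  proof (rule T.tensor_additive_eqI[OF agT, of "\<lambda>t. t", OF _ _ _ t])
    show "additive T.T T.T (\<lambda>t. t)" by (simp add: additiveI)
    show "additive T.T T.T (\<lambda>t. \<Oplus>\<^bsub>T.T\<^esub>j\<in>J. T.pure (?ev j t) (e j))"
      by (rule additive_finsum_fun[OF agT agT additive_comp[OF ev left[OF e_closed]]])
    fix m c assume m: "m \<in> carrier M" and c: "c \<in> carrier C"
    have "T.pure m c = T.pure m (\<Oplus>\<^bsub>C\<^esub>j\<in>J. lact C (\<phi> j c) (e j))"
      using expand[OF c] by simp
    also have "\<dots> = (\<Oplus>\<^bsub>T.T\<^esub>j\<in>J. T.pure m (lact C (\<phi> j c) (e j)))"
      by (rule additive_finsum[OF ag_C agT right[OF m] finite_J])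
         (use c in \<open>auto simp: C.lact_closed dual_closed e_closed \<phi>_closed\<close>)
    also have "\<dots> = (\<Oplus>\<^bsub>T.T\<^esub>j\<in>J. T.pure (?ev j (T.pure m c)) (e j))"
      by (rule TT.finsum_cong')
         (use m c cl T.pure_closed in \<open>auto simp: ev_pure T.pure_balance dual_closed e_closed \<phi>_closed\<close>)
    finally show "T.pure m c = (\<Oplus>\<^bsub>T.T\<^esub>j\<in>J. T.pure (?ev j (T.pure m c)) (e j))" .
  qed
qed

lemma tensor_eqI:
  fixes M :: "('k, 'h, 'a, 'm, 'z) hrmod_scheme"
  assumes M: "right_module k A M"
    and t: "t \<in> carrier (tensor_group A M (ract M) C (lact C))"
    and u: "u \<in> carrier (tensor_group A M (ract M) C (lact C))"
    and eq: "\<And>f. f \<in> carrier D \<Longrightarrow>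
      sweedler M (\<lambda>m c. ract M m (f c)) t = sweedler M (\<lambda>m c. ract M m (f c)) u"
  shows "t = u"
proof -
  interpret M: right_module k A M by fact
  interpret T: tensor_product A M "ract M" C "lact C" by (rule tensor_product_C) (rule M)
  interpret TT: abelian_group T.T by (rule T.T_abelian_group)
  let ?ev = "\<lambda>j. sweedler M (\<lambda>m c. ract M m (\<phi> j c))"
  have "(\<Oplus>\<^bsub>T.T\<^esub>j\<in>J. T.pure (?ev j t) (e j)) = (\<Oplus>\<^bsub>T.T\<^esub>j\<in>J. T.pure (?ev j u) (e j))"
  proof (rule TT.finsum_cong')
    show "(\<lambda>j. T.pure (?ev j u) (e j)) \<in> J \<rightarrow> carrier T.T"
      using u e_closed by (auto intro!: T.pure_closed T.sweedler_closed[OF M.abelian_group_axioms]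
          simp: M.ract_closed dual_closed \<phi>_closed)
  qed (auto simp: eq \<phi>_closed)
  then show ?thesis using tensor_expand[OF M t] tensor_expand[OF M u] by simp
qed

text \<open>In \<open>m \<otimes> (c \<otimes> d)\<close> the last leg is expanded and
  \<open>\<phi>i(d)\<close> moved onto \<open>c\<close>; then \<open>c \<phi>i(d)\<close> is
  expanded and \<open>\<phi>j(c \<phi>i(d))\<close> moved onto \<open>m\<close>. This order is the
  one built into \<open>eval2\<close>.\<close>

lemma triple_tensor_expand:
  fixes M :: "('k, 'h, 'a, 'm, 'z) hrmod_scheme"
  defines "U \<equiv> tensor_A_bimod H A C C"
  assumes M: "right_module k A M" and t: "t \<in> carrier (tensor_group A M (ract M) U (lact U))"
  shows "t = (\<Oplus>\<^bsub>tensor_group A M (ract M) U (lact U)\<^esub>i\<in>J. \<Oplus>\<^bsub>tensor_group A M (ract M) U (lact U)\<^esub>j\<in>J.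
    pure_A A M U (sweedler M (\<lambda>m u. sweedler M (eval2 M (\<phi> i) (\<phi> j) m) u) t) (pure_A A C C (e j) (e i)))"
proof -
  interpret M: right_module k A M by fact
  interpret CC: tensor_product A C "ract C" C "lact C" by (rule tensor_product_CC)
  interpret TT: triple_tensor A M "ract M" C "lact C" "ract C" C "lact C" U "lact U"
    unfolding U_def by (rule triple_tensor_C) (rule M)
  let ?T = "tensor_group A M (ract M) U (lact U)"
  interpret T: abelian_group ?T by (rule TT.MNP.T_abelian_group)
  interpret UU: abelian_group U by (rule TT.abelian_group_T')
  note agM = M.abelian_group_axioms and agT = TT.MNP.T_abelian_group and agU = TT.abelian_group_T'
  let ?ev = "\<lambda>i j. sweedler M (\<lambda>m u. sweedler M (eval2 M (\<phi> i) (\<phi> j) m) u)"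
  have bal: "balanced3 A M (ract M) C (lact C) (ract C) C (lact C) M (eval2 M (\<phi> i) (\<phi> j))"
    if "i \<in> J" "j \<in> J" for i j
    by (rule eval2_balanced[OF M]) (use that \<phi>_closed in auto)
  have ev: "additive ?T M (?ev i j)" if "i \<in> J" "j \<in> J" for i j
    by (rule TT.MNP.sweedler_additive[OF agM TT.balanced_sweedler[OF agM bal[OF that]]])
  have ev_pure: "?ev i j (TT.MNP.pure m (CC.pure c d)) = eval2 M (\<phi> i) (\<phi> j) m c d"
    if "i \<in> J" "j \<in> J" "m \<in> carrier M" "c \<in> carrier C" "d \<in> carrier C" for i j m c d
    by (rule TT.sweedler_pure_pure[OF agM bal[OF that(1,2)] that(3-5)])
  have left: "additive M ?T (\<lambda>m. TT.MNP.pure m c)" if "c \<in> carrier U" for c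
    using TT.MNP.pure_balanced that by (simp add: balanced_def)
  have right: "additive U ?T (TT.MNP.pure m)" if "m \<in> carrier M" for m
    using TT.MNP.pure_balanced that by (simp add: balanced_def)
  have pU: "CC.pure c d \<in> carrier U" if "c \<in> carrier C" "d \<in> carrier C" for c d
    by (rule TT.pure_NP_closed[OF that])
  have cl: "TT.MNP.pure (?ev i j u) (CC.pure (e j) (e i)) \<in> carrier ?T"
    if "i \<in> J" "j \<in> J" "u \<in> carrier ?T" for i j u
    using additive_closed[OF ev] that by (simp add: TT.MNP.pure_closed pU e_closed)
  have cl': "(\<Oplus>\<^bsub>?T\<^esub>j\<in>J. TT.MNP.pure (?ev i j u) (CC.pure (e j) (e i))) \<in> carrier ?T"
    if "i \<in> J" "u \<in> carrier ?T" for i u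
    using cl that by (intro T.finsum_closed) auto
  let ?R = "\<lambda>t. \<Oplus>\<^bsub>?T\<^esub>i\<in>J. \<Oplus>\<^bsub>?T\<^esub>j\<in>J. TT.MNP.pure (?ev i j t) (CC.pure (e j) (e i))"
  have addR: "additive ?T ?T ?R"
    by (intro additive_finsum_fun[OF agT agT] additive_comp[OF ev left] pU e_closed)
  have CC_right: "additive C U (CC.pure c)" if "c \<in> carrier C" for c
    using CC.pure_balanced that by (simp add: balanced_def additive_def U_def)
  have CC_left: "additive C U (\<lambda>d. CC.pure d c)" if "c \<in> carrier C" for c
    using CC.pure_balanced that by (simp add: balanced_def additive_def U_def)
  \<comment> \<open>The left action on the inner tensor product is a Sweedler sum; its value on a
    pure tensor requires a balancedness check.\<close>
  have L_pure: "CC.pure (lact C a c) d = lact U a (CC.pure c d)"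
    if a: "a \<in> carrier A" and c: "c \<in> carrier C" and d: "d \<in> carrier C" for a c d
  proof -
    have "lact U a (CC.pure c d) = sweedler U (\<lambda>n p. CC.pure (lact C a n) p) (CC.pure c d)"
      by (rule TT.L[OF a pU[OF c d]])
    also have "\<dots> = CC.pure (lact C a c) d"
    proof (rule CC.sweedler_pure[OF agU _ c d], rule balancedI)
      show "additive C U (\<lambda>m. CC.pure (lact C a m) n)" if "n \<in> carrier C" for n
        by (rule additive_comp[OF C.additive_lact_right[OF a] CC_left[OF that]])
      show "additive C U (CC.pure (lact C a m))" if "m \<in> carrier C" for m
        by (rule CC_right) (use a that C.lact_closed in auto)
      show "CC.pure (lact C a (ract C m r)) n = CC.pure (lact C a m) (lact C r n)"
        if "m \<in> carrier C" "r \<in> carrier A" "n \<in> carrier C" for m r n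
        using that a by (simp add: CC.pure_balance C.lact_closed flip: C.lact_ract)
    qed
    finally show ?thesis by simp
  qed
  have pures: "TT.MNP.pure m (CC.pure c d) = ?R (TT.MNP.pure m (CC.pure c d))"
    if m: "m \<in> carrier M" and c: "c \<in> carrier C" and d: "d \<in> carrier C" for m c d
  proof -
    have a1: "lact C (\<phi> i x) (e i) \<in> carrier C" if "i \<in> J" "x \<in> carrier C" for i x
      using that by (simp add: C.lact_closed dual_closed e_closed \<phi>_closed)
    have a2: "ract C c (\<phi> i d) \<in> carrier C" if "i \<in> J" for i
      using that c d by (simp add: C.ract_closed dual_closed e_closed \<phi>_closed)
    have "TT.MNP.pure m (CC.pure c d) = TT.MNP.pure m (CC.pure c (\<Oplus>\<^bsub>C\<^esub>i\<in>J. lact C (\<phi> i d) (e i)))"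
      using expand[OF d] by simp
    also have "\<dots> = (\<Oplus>\<^bsub>?T\<^esub>i\<in>J. TT.MNP.pure m (CC.pure c (lact C (\<phi> i d) (e i))))"
      by (rule additive_finsum[OF ag_C agT additive_comp[OF CC_right[OF c] right[OF m]] finite_J])
         (rule a1[OF _ d])
    also have "\<dots> = ?R (TT.MNP.pure m (CC.pure c d))"
    proof (rule T.finsum_cong')
      fix i assume i: "i \<in> J"
      have "TT.MNP.pure m (CC.pure c (lact C (\<phi> i d) (e i))) = TT.MNP.pure m (CC.pure (ract C c (\<phi> i d)) (e i))"
        using CC.pure_balance[OF c _ e_closed[OF i], of "\<phi> i d"] d i by (simp add: dual_closed \<phi>_closed)
      also have "\<dots> = TT.MNP.pure m (CC.pure (\<Oplus>\<^bsub>C\<^esub>j\<in>J. lact C (\<phi> j (ract C c (\<phi> i d))) (e j)) (e i))"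
        using expand[OF a2[OF i]] by simp
      also have "\<dots> = (\<Oplus>\<^bsub>?T\<^esub>j\<in>J. TT.MNP.pure m (CC.pure (lact C (\<phi> j (ract C c (\<phi> i d))) (e j)) (e i)))"
        by (rule additive_finsum[OF ag_C agT additive_comp[OF CC_left[OF e_closed[OF i]] right[OF m]] finite_J])
           (rule a1[OF _ a2[OF i]])
      also have "\<dots> = (\<Oplus>\<^bsub>?T\<^esub>j\<in>J. TT.MNP.pure (?ev i j (TT.MNP.pure m (CC.pure c d))) (CC.pure (e j) (e i)))"
      proof (rule T.finsum_cong')
        show "(\<lambda>j. TT.MNP.pure (?ev i j (TT.MNP.pure m (CC.pure c d))) (CC.pure (e j) (e i))) \<in> J \<rightarrow> carrier ?T"
          using cl i m c d TT.MNP.pure_closed pU by auto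
        fix j assume j: "j \<in> J"
        let ?a = "\<phi> j (ract C c (\<phi> i d))"
        have a: "?a \<in> carrier A" using i j a2 by (simp add: dual_closed \<phi>_closed)
        have "TT.MNP.pure m (CC.pure (lact C ?a (e j)) (e i)) = TT.MNP.pure m (lact U ?a (CC.pure (e j) (e i)))"
          by (simp add: L_pure a e_closed i j)
        also have "\<dots> = TT.MNP.pure (ract M m ?a) (CC.pure (e j) (e i))"
          by (rule TT.MNP.pure_balance[OF m a pU, symmetric]) (use i j e_closed in auto)
        finally show "TT.MNP.pure m (CC.pure (lact C ?a (e j)) (e i)) =
            TT.MNP.pure (?ev i j (TT.MNP.pure m (CC.pure c d))) (CC.pure (e j) (e i))"
          using i j m c d by (simp add: ev_pure eval2_def)
      qed simp
      finally show "TT.MNP.pure m (CC.pure c (lact C (\<phi> i d) (e i))) = \<dots>" .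
    qed (use m c d cl' TT.MNP.pure_closed pU in auto)
    finally show ?thesis .
  qed
  show ?thesis
  proof (rule TT.MNP.tensor_additive_eqI[OF agT _ addR _ t])
    show "additive ?T ?T (\<lambda>t. t)" by (simp add: additiveI)
    \<comment> \<open>The second leg \<open>u\<close> is still an arbitrary element of the inner
      tensor product; additivity in \<open>u\<close> reduces it to pure tensors as well.\<close>
    fix m u assume m: "m \<in> carrier M" and u: "u \<in> carrier U"
    show "TT.MNP.pure m u = ?R (TT.MNP.pure m u)"
    proof (rule CC.tensor_additive_eqI[OF agT, of "TT.MNP.pure m" "\<lambda>u. ?R (TT.MNP.pure m u)"])
      show "additive CC.T ?T (TT.MNP.pure m)"
        using right[OF m] by (simp add: additive_def U_def)
      then show "additive CC.T ?T (\<lambda>u. ?R (TT.MNP.pure m u))"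
        by (rule additive_comp[OF _ addR])
    qed (use u pures m in \<open>auto simp: U_def\<close>)
  qed
qed

lemma triple_tensor_eqI:
  fixes M :: "('k, 'h, 'a, 'm, 'z) hrmod_scheme"
  defines "U \<equiv> tensor_A_bimod H A C C"
  assumes M: "right_module k A M"
    and t: "t \<in> carrier (tensor_group A M (ract M) U (lact U))"
    and s: "s \<in> carrier (tensor_group A M (ract M) U (lact U))"
    and eq: "\<And>f g. f \<in> carrier D \<Longrightarrow> g \<in> carrier D \<Longrightarrow>
      sweedler M (\<lambda>m u. sweedler M (eval2 M f g m) u) t = sweedler M (\<lambda>m u. sweedler M (eval2 M f g m) u) s"
  shows "t = s"
proof -
  interpret M: right_module k A M by fact
  interpret CC: tensor_product A C "ract C" C "lact C" by (rule tensor_product_CC)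
  interpret TT: triple_tensor A M "ract M" C "lact C" "ract C" C "lact C" U "lact U"
    unfolding U_def by (rule triple_tensor_C) (rule M)
  let ?T = "tensor_group A M (ract M) U (lact U)"
  interpret T: abelian_group ?T by (rule TT.MNP.T_abelian_group)
  let ?ev = "\<lambda>i j. sweedler M (\<lambda>m u. sweedler M (eval2 M (\<phi> i) (\<phi> j) m) u)"
  have cl: "TT.MNP.pure (?ev i j s) (CC.pure (e j) (e i)) \<in> carrier ?T" if "i \<in> J" "j \<in> J" for i j
    using additive_closed[OF TT.MNP.sweedler_additive[OF M.abelian_group_axioms
        TT.balanced_sweedler[OF M.abelian_group_axioms eval2_balanced[OF M]]] s, of "\<phi> i" "\<phi> j"] that
    by (simp add: TT.MNP.pure_closed TT.pure_NP_closed e_closed \<phi>_closed)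
  have "(\<Oplus>\<^bsub>?T\<^esub>i\<in>J. \<Oplus>\<^bsub>?T\<^esub>j\<in>J. TT.MNP.pure (?ev i j t) (CC.pure (e j) (e i))) =
    (\<Oplus>\<^bsub>?T\<^esub>i\<in>J. \<Oplus>\<^bsub>?T\<^esub>j\<in>J. TT.MNP.pure (?ev i j s) (CC.pure (e j) (e i)))"
    by (intro T.finsum_cong') (auto simp: eq \<phi>_closed intro!: T.finsum_closed cl)
  then show ?thesis
    using triple_tensor_expand[OF M, of t] triple_tensor_expand[OF M, of s] t s
    by (simp add: U_def)
qed

end

section \<open>From modules over the left dual to comodules\<close>

text \<open>The tensor product sees only carrier and addition of its left factor. This permits
  exchanging a module for a different record on the same additive group.\<close>

lemma tensor_null_cong_left:
  assumes "carrier M = carrier M'" "ring.add M = ring.add M'"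
  shows "tensor_null R M ra N la = tensor_null R M' ra N la"
  using assms by (simp add: tensor_null_def tensor_relators_def)

lemma tensor_group_cong_left:
  assumes "carrier M = carrier M'" "ring.add M = ring.add M'"
  shows "tensor_group R M ra N la = tensor_group R M' ra N la"
  using assms by (simp add: tensor_group_def tensor_null_cong_left[OF assms])

lemma pure_tensor_cong_left:
  assumes "carrier M = carrier M'" "ring.add M = ring.add M'"
  shows "pure_tensor R M ra N la = pure_tensor R M' ra N la"
  using assms by (simp add: pure_tensor_def tensor_null_cong_left[OF assms] fun_eq_iff)

section \<open>Twists by the antipode that yield \<open>H\<close>-linearity of the coaction\<close>

context hopf_coring
begin

text \<open>\<open>S\<close> reverses the coproduct and undoes \<open>S^-1\<close>, so
  \<open>(S(y) f)(c) = S(y1) f(y2 c)\<close>. The left side is therefore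
  \<open>(h1 m) (h2 S(h3) f(h4 c))\<close>, in which \<open>h2 S(h3)\<close> cancels.\<close>

lemma eval_twisted:
  assumes M: "hr_module k H A M" and h: "h \<in> carrier H" and f: "f \<in> carrier D"
    and m: "m \<in> carrier M" and c: "c \<in> carrier C"
  shows "SH H M (\<lambda>p y. hact M p (ract M m (hact D (S_H H y) f c))) h =
    SH H M (\<lambda>p q. ract M (hact M p m) (f (hact C q c))) h"
proof -
  interpret M: hr_module k H A M by fact
  note ag_M = M.abelian_group_axioms and module_M = M.module_axioms
  note [simp] = A.hact_closed C.hact_closed M.hact_closed M.ract_closed dual_closed[OF f] antipode_closed h m c
  have "SH H M (\<lambda>p y. hact M p (ract M m (hact D (S_H H y) f c))) h =
    SH H M (\<lambda>p y. SH H M (\<lambda>r s. SH H M (\<lambda>u v.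
      ract M (hact M r m) (hact A (s \<otimes>\<^bsub>H\<^esub> S_H H u) (f (hact C v c)))) y) p) h"
  proof (rule SH_cong[OF ag_M])
    fix p y assume [simp]: "p \<in> carrier H" "y \<in> carrier H"
    have "hact D (S_H H y) f c = SH H A (\<lambda>u v. hact A v (f (hact C (S_H_inv H u) c))) (S_H H y)"
      by (simp add: dual_hact_apply f)
    also have "\<dots> = SH H A (\<lambda>u v. hact A (S_H H u) (f (hact C (S_H_inv H (S_H H v)) c))) y"
      by (rule antipode_comult[OF module_A]) (use f in \<open>auto intro!: dual_klin_intros\<close>)
    also have "\<dots> = SH H A (\<lambda>u v. hact A (S_H H u) (f (hact C v c))) y"
      by (rule SH_cong[OF ag_A]) simp
    finally have "hact M p (ract M m (hact D (S_H H y) f c)) =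
      hact M p (ract M m (SH H A (\<lambda>u v. hact A (S_H H u) (f (hact C v c))) y))" by simp
    also have "\<dots> = SH H M (\<lambda>u v. hact M p (ract M m (hact A (S_H H u) (f (hact C v c))))) y"
      by (rule SH_apply[OF ag_A ag_M additive_comp[OF M.additive_ract_right M.additive_hact]]) auto
    also have "\<dots> = SH H M (\<lambda>u v. SH H M (\<lambda>r s.
      ract M (hact M r m) (hact A s (hact A (S_H H u) (f (hact C v c))))) p) y"
      by (rule SH_cong[OF ag_M]) (simp add: hact_ract_SH[OF M])
    also have "\<dots> = SH H M (\<lambda>r s. SH H M (\<lambda>u v.
      ract M (hact M r m) (hact A s (hact A (S_H H u) (f (hact C v c))))) y) p"
      by (rule SH_swap[OF ag_M]) auto
    also have "\<dots> = SH H M (\<lambda>r s. SH H M (\<lambda>u v.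
      ract M (hact M r m) (hact A (s \<otimes>\<^bsub>H\<^esub> S_H H u) (f (hact C v c)))) y) p"
      by (intro SH_cong[OF ag_M]) (simp add: A.hact_mult)
    finally show "hact M p (ract M m (hact D (S_H H y) f c)) = \<dots>" .
  qed
  also have "\<dots> = SH H M (\<lambda>p y. ract M (hact M p m) (hact A \<one>\<^bsub>H\<^esub> (f (hact C y c)))) h"
    by (rule collapse_middle[OF module_M conv_unit_antipode_right, where
          D = "\<lambda>r z v. ract M (hact M r m) (hact A z (f (hact C v c)))"])
       (use f in \<open>auto intro!: dual_klin_intros M.klin_ract_left M.klin_ract_right M.klin_hact_left\<close>)
  also have "\<dots> = SH H M (\<lambda>p q. ract M (hact M p m) (f (hact C q c))) h"
    by (rule SH_cong[OF ag_M]) (simp add: A.hact_one)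
  finally show ?thesis .
qed

text \<open>The same twist on the module side: compatibility of \<open>N\<close> with
  \<open>H\<close> gives \<open>(h1 x) ((h2 S(h3)) f)\<close>, and \<open>h2 S(h3)\<close>
  cancels.\<close>

lemma dual_ract_twisted:
  assumes N: "hr_module k H D N" and h: "h \<in> carrier H" and f: "f \<in> carrier D" and x: "x \<in> carrier N"
  shows "SH H N (\<lambda>p y. hact N p (ract N x (hact D (S_H H y) f))) h = ract N (hact N h x) f"
proof -
  interpret N: hr_module k H D N by fact
  note ag_N = N.abelian_group_axioms and module_N = N.module_axioms
  note [simp] = N.hact_closed N.ract_closed dual_hact_closed[OF _ f] antipode_closed h f x
  have "SH H N (\<lambda>p y. hact N p (ract N x (hact D (S_H H y) f))) h =
    SH H N (\<lambda>p y. SH H N (\<lambda>r s. ract N (hact N r x) (hact D (s \<otimes>\<^bsub>H\<^esub> S_H H y) f)) p) h"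
  proof (rule SH_cong[OF ag_N])
    fix p y assume [simp]: "p \<in> carrier H" "y \<in> carrier H"
    have "hact N p (ract N x (hact D (S_H H y) f)) =
      SH H N (\<lambda>r s. ract N (hact N r x) (hact D s (hact D (S_H H y) f))) p"
      by (simp add: N.hact_ract SH_eq dual_hact_closed)
    also have "\<dots> = SH H N (\<lambda>r s. ract N (hact N r x) (hact D (s \<otimes>\<^bsub>H\<^esub> S_H H y) f)) p"
      by (rule SH_cong[OF ag_N]) (simp add: dual_hact_mult)
    finally show "hact N p (ract N x (hact D (S_H H y) f)) = \<dots>" .
  qed
  also have "\<dots> = ract N (hact N h x) (hact D \<one>\<^bsub>H\<^esub> f)"
    by (rule collapse_right'[OF module_N conv_unit_antipode_right, where
          E = "\<lambda>r z. ract N (hact N r x) (hact D z f)"])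
       (auto intro!: klin_intros N.klin_ract_left N.klin_ract_right N.klin_hact_left klin_dual_hact)
  finally show ?thesis by (simp add: dual_hact_one)
qed

end

text \<open>The new action and the coaction are restricted to the carriers so that objects stay
  normalised. The tensor product is formed from \<open>N\<close> and \<open>ra\<close>, since the
  record being defined cannot refer to itself.\<close>

definition (in dual_basis) mod_to_comod ::
  "('k, 'h, 'c \<Rightarrow> 'a, 'm) hrmod \<Rightarrow> ('k, 'h, 'a, 'c, 'm) comod" where
  "mod_to_comod N =
     (let ra = (\<lambda>x\<in>carrier N. \<lambda>a\<in>carrier A. ract N x (iota a))
      in \<lparr>carrier = carrier N, monoid.mult = monoid.mult N, monoid.one = monoid.one N,
          ring.zero = ring.zero N, ring.add = ring.add N, smult = smult N, hact = hact N, ract = ra,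
          rho = (\<lambda>x\<in>carrier N. \<Oplus>\<^bsub>tensor_group A N ra C (lact C)\<^esub>j\<in>J.
            pure_tensor A N ra C (lact C) (ract N x (\<phi> j)) (e j))\<rparr>)"

locale dual_module = dual_basis k H A C J e \<phi> + N: hr_module k H "left_dual H A C" N
  for k :: "('k, 'y) ring_scheme" and H :: "('k, 'h) hopf"
    and A :: "('k, 'h, 'a) hmod" and C :: "('k, 'h, 'a, 'c) coring"
    and J :: "'j set" and e :: "'j \<Rightarrow> 'c" and \<phi> :: "'j \<Rightarrow> 'c \<Rightarrow> 'a"
    and N :: "('k, 'h, 'c \<Rightarrow> 'a, 'm) hrmod"
begin

abbreviation "G \<equiv> mod_to_comod N"

lemma G_simps [simp]:
  "carrier G = carrier N" "ring.add G = ring.add N" "ring.zero G = ring.zero N"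
  "monoid.mult G = monoid.mult N" "monoid.one G = monoid.one N"
  "smult G = smult N" "hact G = hact N"
  by (simp_all add: mod_to_comod_def Let_def)

lemma G_ract [simp]: "x \<in> carrier N \<Longrightarrow> a \<in> carrier A \<Longrightarrow> ract G x a = ract N x (iota a)"
  by (simp add: mod_to_comod_def Let_def)

lemma G_rho:
  assumes "x \<in> carrier N"
  shows "rho G x = (\<Oplus>\<^bsub>tensor_group A G (ract G) C (lact C)\<^esub>j\<in>J. pure_A A G C (ract N x (\<phi> j)) (e j))"
proof -
  let ?ra = "\<lambda>x\<in>carrier N. \<lambda>a\<in>carrier A. ract N x (iota a)"
  have ra: "ract G = ?ra" by (simp add: mod_to_comod_def Let_def)
  have "tensor_group A G ?ra C (lact C) = tensor_group A N ?ra C (lact C)"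
    "pure_tensor A G ?ra C (lact C) = pure_tensor A N ?ra C (lact C)"
    by (rule tensor_group_cong_left pure_tensor_cong_left; simp)+
  then show ?thesis
    unfolding ra using assms by (simp add: mod_to_comod_def Let_def)
qed

lemma ag_N: "abelian_group N" and ag_G: "abelian_group G"
  by (rule N.abelian_group_axioms) (rule abelian_group_cong[OF N.abelian_group_axioms], auto)

lemma module_G: "module k G"
  by (rule moduleI)
     (auto simp: N.smult_l_distr N.smult_r_distr N.smult_assoc1 module.axioms(1)[OF N.module_axioms] ag_G)

text \<open>The equality is unconditional because the two records share the zero used as default
  value.\<close>

lemma SH_G: "SH H G = SH H N"
proof (intro ext)
  fix b h
  show "SH H G b h = SH H N b h"
  proof (cases "h \<in> carrier H \<and> (\<forall>x\<in>carrier H. \<forall>y\<in>carrier H. b x y \<in> carrier N)")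
    case True
    have "sweedler G b (Delta_H H h) = sweedler N b (Delta_H H h)"
      by (rule tensor_product.sweedler_target[OF tensor_product_H ag_N])
         (use True Delta_closed in \<open>auto\<close>)
    then show ?thesis using True by (simp add: SH_def)
  next
    case False
    then show ?thesis by (simp only: SH_def G_simps if_False)
  qed
qed

text \<open>This is restriction of scalars along \<open>iota\<close>, which preserves sums, products
  and units and commutes with the action of \<open>H\<close>.\<close>

lemma hr_module_G: "hr_module k H A G"
proof (intro hr_module.intro h_module.intro right_module.intro module_G)
  show "h_module_axioms k H G"
    by unfold_locales
       (auto simp: N.hact_closed N.hact_add_left N.hact_add_right N.hact_smult_left N.hact_smult_right
          N.hact_one N.hact_mult)
  show "right_module_axioms k A G"
    by unfold_locales
       (auto simp: iota_closed N.ract_closed N.ract_add_left iota_add N.ract_add_right N.ract_smult_left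
          iota_smult N.ract_smult_right iota_one N.ract_one iota_mult N.ract_mult)
  show "hr_module_axioms H A G"
  proof
    fix h x a assume a: "h \<in> carrier H" "x \<in> carrier G" "a \<in> carrier A"
    have "hact N h (ract N x (iota a)) = SH H N (\<lambda>h1 h2. ract N (hact N h1 x) (hact D h2 (iota a))) h"
      using a by (simp add: SH_eq N.hact_ract iota_closed dual_hact_closed N.hact_closed N.ract_closed)
    also have "\<dots> = SH H G (\<lambda>h1 h2. ract G (hact G h1 x) (hact A h2 a)) h"
      unfolding SH_G
      by (rule SH_cong[OF ag_N]) (use a in \<open>auto simp: hact_iota N.hact_closed A.hact_closed\<close>)
    finally show "hact G h (ract G x a) = sweedler G (\<lambda>h1 h2. ract G (hact G h1 x) (hact A h2 a)) (Delta_H H h)"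
      using a by (simp add: SH_eq N.hact_closed A.hact_closed iota_closed N.ract_closed)
  qed
qed

sublocale G: hr_module k H A G by (rule hr_module_G)

interpretation T: tensor_product A G "ract G" C "lact C"
  by (rule tensor_product_C) (rule G.right_module_axioms)

interpretation T: abelian_group T.T by (rule T.T_abelian_group)

lemma rho_G_closed: "x \<in> carrier N \<Longrightarrow> rho G x \<in> carrier T.T"
  unfolding G_rho
  by (rule T.finsum_closed) (auto intro!: T.pure_closed simp: N.ract_closed e_closed \<phi>_closed)

lemma eval_closed_G: "f \<in> carrier D \<Longrightarrow> m \<in> carrier N \<Longrightarrow> c \<in> carrier C \<Longrightarrow> ract G m (f c) \<in> carrier N"
  using G.ract_closed[of m "f c"] by (simp add: dual_closed)

text \<open>\<open>\<Sum> (x \<phi>j) f(ej) = x (\<Sum> \<phi>j # iota(f(ej)))\<close>, and the sum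
  in parentheses is \<open>f\<close>.\<close>

lemma rho_G_eval:
  assumes x: "x \<in> carrier N" and f: "f \<in> carrier D"
  shows "sweedler G (\<lambda>m c. ract G m (f c)) (rho G x) = ract N x f"
proof -
  interpret DD: abelian_group D by (rule abelian_group_dual)
  note bal = balanced_eval[OF G.right_module_axioms f]
  have p: "\<phi> j \<otimes>\<^bsub>D\<^esub> iota (f (e j)) \<in> carrier D" if "j \<in> J" for j
    using that f by (simp add: dual_mult_closed iota_closed dual_closed e_closed \<phi>_closed)
  have "sweedler G (\<lambda>m c. ract G m (f c)) (rho G x) =
    (\<Oplus>\<^bsub>G\<^esub>j\<in>J. sweedler G (\<lambda>m c. ract G m (f c)) (T.pure (ract N x (\<phi> j)) (e j)))"
    unfolding G_rho[OF x]
    by (rule additive_finsum[OF T.T_abelian_group ag_G T.sweedler_additive[OF ag_G bal] finite_J])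
       (simp add: T.pure_closed N.ract_closed e_closed \<phi>_closed x)
  also have "\<dots> = (\<Oplus>\<^bsub>G\<^esub>j\<in>J. ract N x (\<phi> j \<otimes>\<^bsub>D\<^esub> iota (f (e j))))"
    by (rule G.M.finsum_cong')
       (use x f p in \<open>auto simp: T.sweedler_pure[OF ag_G bal] N.ract_closed N.ract_mult e_closed \<phi>_closed
          dual_closed iota_closed\<close>)
  also have "\<dots> = ract N x (\<Oplus>\<^bsub>D\<^esub>j\<in>J. \<phi> j \<otimes>\<^bsub>D\<^esub> iota (f (e j)))"
    by (rule additive_finsum[OF abelian_group_dual ag_G _ finite_J, symmetric])
       (use N.additive_ract_right[OF x] p in \<open>auto simp: additive_def\<close>)
  also have "\<dots> = ract N x f"
    using dual_expand[OF f] by simp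
  finally show ?thesis .
qed

lemma rho_G_eqI:
  assumes "t \<in> carrier T.T" "u \<in> carrier T.T"
    and "\<And>f. f \<in> carrier D \<Longrightarrow>
      sweedler G (\<lambda>m c. ract G m (f c)) t = sweedler G (\<lambda>m c. ract G m (f c)) u"
  shows "t = u"
  using tensor_eqI[OF G.right_module_axioms] assms by blast

lemma rho_G_add:
  assumes x: "x \<in> carrier N" and y: "y \<in> carrier N"
  shows "rho G (x \<oplus>\<^bsub>N\<^esub> y) = rho G x \<oplus>\<^bsub>T.T\<^esub> rho G y"
proof (rule rho_G_eqI)
  fix f assume f: "f \<in> carrier D"
  show "sweedler G (\<lambda>m c. ract G m (f c)) (rho G (x \<oplus>\<^bsub>N\<^esub> y)) =
      sweedler G (\<lambda>m c. ract G m (f c)) (rho G x \<oplus>\<^bsub>T.T\<^esub> rho G y)"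
    using additive_add[OF T.sweedler_additive[OF ag_G balanced_eval[OF G.right_module_axioms f]]]
      x y f N.ract_add_left
    by (simp add: rho_G_eval rho_G_closed)
qed (use x y in \<open>auto simp: rho_G_closed\<close>)

text \<open>Evaluating at \<open>f\<close> after the right action of \<open>a\<close> is evaluating
  at \<open>c \<mapsto> f(c a)\<close>, which is the functional \<open>iota a # f\<close>.\<close>

lemma rho_G_ract:
  assumes x: "x \<in> carrier N" and a: "a \<in> carrier A"
  shows "rho G (ract G x a) = ract (tensor_A H A G C) (rho G x) a"
proof (rule rho_G_eqI)
  show "rho G (ract G x a) \<in> carrier T.T"
    using G.ract_closed[of x a] x a by (simp add: rho_G_closed del: G_ract)
  show "ract (tensor_A H A G C) (rho G x) a \<in> carrier T.T"
    by (rule tensor_A_ract(1)[OF G.right_module_axioms a rho_G_closed[OF x]])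
  fix f assume f: "f \<in> carrier D"
  have if': "iota a \<otimes>\<^bsub>D\<^esub> f \<in> carrier D" using a f by (simp add: dual_mult_closed iota_closed)
  have "sweedler G (\<lambda>m c. ract G m (f c)) (ract (tensor_A H A G C) (rho G x) a) =
    sweedler G (\<lambda>m c. ract G m (f (ract C c a))) (rho G x)"
    by (rule tensor_A_ract(2)[OF G.right_module_axioms a rho_G_closed[OF x] ag_G
          balanced_eval[OF G.right_module_axioms f]])
  also have "\<dots> = sweedler G (\<lambda>m c. ract G m ((iota a \<otimes>\<^bsub>D\<^esub> f) c)) (rho G x)"
    by (rule T.sweedler_cong[OF ag_G rho_G_closed[OF x]])
       (use a f in \<open>auto simp: iota_dual_mult dual_closed C.ract_closed N.ract_closed iota_closed\<close>)
  also have "\<dots> = ract N (ract N x (iota a)) f"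
    using x a f if' by (simp add: rho_G_eval N.ract_mult iota_closed)
  finally show "sweedler G (\<lambda>m c. ract G m (f c)) (rho G (ract G x a)) =
      sweedler G (\<lambda>m c. ract G m (f c)) (ract (tensor_A H A G C) (rho G x) a)"
    using x a f by (simp add: rho_G_eval N.ract_closed iota_closed)
qed

lemma rho_G_hact:
  assumes x: "x \<in> carrier N" and h: "h \<in> carrier H"
  shows "rho G (hact N h x) = hact (tensor_A H A G C) h (rho G x)"
proof (rule rho_G_eqI)
  show "rho G (hact N h x) \<in> carrier T.T" using x h by (simp add: rho_G_closed N.hact_closed)
  show "hact (tensor_A H A G C) h (rho G x) \<in> carrier T.T"
    by (rule tensor_A_hact(1)[OF hr_module_G h rho_G_closed[OF x]])
  fix f assume f: "f \<in> carrier D"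
  have "sweedler G (\<lambda>m c. ract G m (f c)) (hact (tensor_A H A G C) h (rho G x)) =
    sweedler G (\<lambda>m c. SH H G (\<lambda>p q. ract G (hact G p m) (f (hact C q c))) h) (rho G x)"
    by (rule tensor_A_hact(2)[OF hr_module_G h rho_G_closed[OF x] ag_G
          balanced_eval[OF G.right_module_axioms f]])
  \<comment> \<open>The twist turns each summand into \<open>hact G p\<close> of an evaluation at
    one functional, so after exchanging the sums \<open>rho_G_eval\<close> applies.\<close>
  also have "\<dots> = sweedler G (\<lambda>m c. SH H G (\<lambda>p y. hact G p (ract G m (hact D (S_H H y) f c))) h) (rho G x)"
    by (rule T.sweedler_cong[OF ag_G rho_G_closed[OF x]])
       (rule SH_closed[OF ag_G], rule eval_twisted[OF hr_module_G h f, symmetric])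
  also have "\<dots> = SH H G (\<lambda>p y. sweedler G (\<lambda>m c. hact G p (ract G m (hact D (S_H H y) f c))) (rho G x)) h"
  proof (rule SH_sweedler_swap[OF T.tensor_product_axioms ag_G rho_G_closed[OF x] h, symmetric])
    fix p y m c assume "p \<in> carrier H" "y \<in> carrier H" "m \<in> carrier G" "c \<in> carrier C"
    then show "hact G p (ract G m (hact D (S_H H y) f c)) \<in> carrier G"
      by (intro G.hact_closed G.ract_closed dual_closed dual_hact_closed antipode_closed f)
  qed
  also have "\<dots> = SH H G (\<lambda>p y. hact G p (ract N x (hact D (S_H H y) f))) h"
  proof (rule SH_cong[OF ag_G])
    fix p y assume py: "p \<in> carrier H" "y \<in> carrier H"
    have d: "hact D (S_H H y) f \<in> carrier D" using py f by (simp add: dual_hact_closed antipode_closed)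
    have "sweedler G (\<lambda>m c. hact G p (ract G m (hact D (S_H H y) f c))) (rho G x) =
      hact G p (sweedler G (\<lambda>m c. ract G m (hact D (S_H H y) f c)) (rho G x))"
      by (rule T.sweedler_apply[OF ag_G ag_G rho_G_closed[OF x] G.additive_hact[OF py(1)], symmetric])
         (use eval_closed_G[OF d] in auto)
    then show "sweedler G (\<lambda>m c. hact G p (ract G m (hact D (S_H H y) f c))) (rho G x) =
        hact G p (ract N x (hact D (S_H H y) f))"
      using rho_G_eval[OF x d] by simp
  qed
  also have "\<dots> = ract N (hact N h x) f"
    using dual_ract_twisted[OF N.hr_module_axioms h f x] by (simp add: SH_G)
  finally show "sweedler G (\<lambda>m c. ract G m (f c)) (rho G (hact N h x)) =
      sweedler G (\<lambda>m c. ract G m (f c)) (hact (tensor_A H A G C) h (rho G x))"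
    using x h f by (simp add: rho_G_eval N.hact_closed)
qed

lemma rho_G_coassoc:
  assumes x: "x \<in> carrier N"
  shows "sweedler (tensor_A H A G (tensor_A_bimod H A C C))
      (\<lambda>m0 m1. sweedler (tensor_A H A G (tensor_A_bimod H A C C))
         (\<lambda>m00 m01. pure_A A G (tensor_A_bimod H A C C) m00 (pure_A A C C m01 m1)) (rho G m0))
      (rho G x) =
    sweedler (tensor_A H A G (tensor_A_bimod H A C C))
      (\<lambda>m0 m1. pure_A A G (tensor_A_bimod H A C C) m0 (Delta_C C m1)) (rho G x)"
    (is "?l = ?r")
proof -
  interpret CC: tensor_product A C "ract C" C "lact C" by (rule tensor_product_CC)
  interpret TT: triple_tensor A G "ract G" C "lact C" "ract C" C "lact C"
    "tensor_A_bimod H A C C" "lact (tensor_A_bimod H A C C)"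
    by (rule triple_tensor_C) (rule G.right_module_axioms)
  let ?Y = "tensor_A H A G (tensor_A_bimod H A C C)"
  have Y: "abelian_group ?Y"
    by (rule abelian_group_cong[OF TT.MNP.T_abelian_group]) auto
  have Y': "carrier ?Y = carrier TT.MNP.T" "ring.add ?Y = ring.add TT.MNP.T" by auto
  have \<Delta>: "Delta_C C c \<in> carrier (tensor_A_bimod H A C C)" if "c \<in> carrier C" for c
    using Delta_C_closed[OF that] by simp
  have \<rho>: "rho G m \<in> carrier T.T" if "m \<in> carrier G" for m
    using rho_G_closed that by simp
  note bal = eval2_balanced[OF G.right_module_axioms]
  note left = TT.sweedler_nest_left[where D = "rho G", OF Y Y' ag_G bal T.tensor_product_axioms
      T.tensor_product_axioms rho_G_closed[OF x] \<rho>]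
  note right = TT.sweedler_nest_right[where D' = "Delta_C C", OF Y Y' ag_G bal T.tensor_product_axioms
      rho_G_closed[OF x] \<Delta>]
  show ?thesis
  proof (rule triple_tensor_eqI[OF G.right_module_axioms])
    \<comment> \<open>Membership does not involve the functionals inside \<open>eval2\<close>; the
      unit of the dual ring serves to instantiate them.\<close>
    show "?l \<in> carrier TT.MNP.T" by (rule left(1)[OF dual_one_closed dual_one_closed])
    show "?r \<in> carrier TT.MNP.T" by (rule right(1)[OF dual_one_closed dual_one_closed])
    fix f g assume f: "f \<in> carrier D" and g: "g \<in> carrier D"
    have fg: "f \<otimes>\<^bsub>D\<^esub> g \<in> carrier D" by (rule dual_mult_closed[OF f g])
    have "sweedler G (\<lambda>m u. sweedler G (eval2 G f g m) u) ?l =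
      sweedler G (\<lambda>m0 m1. sweedler G (\<lambda>m00 m01. eval2 G f g m00 m01 m1) (rho G m0)) (rho G x)"
      by (rule left(2)[OF f g])
    also have "\<dots> = sweedler G (\<lambda>m0 m1. ract N (ract G m0 (f m1)) g) (rho G x)"
    proof (rule T.sweedler_cong[OF ag_G rho_G_closed[OF x]])
      fix m c assume m: "m \<in> carrier G" and c: "c \<in> carrier C"
      have fc: "f c \<in> carrier A" using f c by (simp add: dual_closed)
      \<comment> \<open>\<open>eval2\<close> evaluates at \<open>g\<close> after \<open>f c\<close>
        has acted on the second leg; right linearity of the coaction moves that action onto
        \<open>m\<close>.\<close>
      have "sweedler G (\<lambda>m00 m01. eval2 G f g m00 m01 c) (rho G m) =
        sweedler G (\<lambda>m c. ract G m (g c)) (ract (tensor_A H A G C) (rho G m) (f c))"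
        unfolding eval2_def
        by (rule tensor_A_ract(2)[OF G.right_module_axioms fc \<rho>[OF m] ag_G
              balanced_eval[OF G.right_module_axioms g], symmetric])
      also have "\<dots> = sweedler G (\<lambda>m c. ract G m (g c)) (rho G (ract G m (f c)))"
        using rho_G_ract[of m "f c"] m fc by simp
      also have "\<dots> = ract N (ract G m (f c)) g"
        by (rule rho_G_eval[OF _ g]) (use G.ract_closed m fc in auto)
      finally show e: "sweedler G (\<lambda>m00 m01. eval2 G f g m00 m01 c) (rho G m) = ract N (ract G m (f c)) g" .
      show "sweedler G (\<lambda>m00 m01. eval2 G f g m00 m01 c) (rho G m) \<in> carrier G"
        unfolding e using G.ract_closed[of m "f c"] m fc g by (simp add: N.ract_closed)
    qed
    also have "\<dots> = ract N (sweedler G (\<lambda>m c. ract G m (f c)) (rho G x)) g"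
      by (rule T.sweedler_apply[OF ag_G ag_G rho_G_closed[OF x], symmetric])
         (use N.additive_ract_left[OF g] eval_closed_G[OF f] in \<open>auto simp: additive_def\<close>)
    also have "\<dots> = ract N x (f \<otimes>\<^bsub>D\<^esub> g)"
      using x f g by (simp add: rho_G_eval N.ract_mult)
    also have "\<dots> = sweedler G (\<lambda>m c. ract G m ((f \<otimes>\<^bsub>D\<^esub> g) c)) (rho G x)"
      using x fg by (simp add: rho_G_eval)
    also have "\<dots> = sweedler G (\<lambda>m0 m1. sweedler G (eval2 G f g m0) (Delta_C C m1)) (rho G x)"
    proof (rule T.sweedler_cong[OF ag_G rho_G_closed[OF x]])
      fix m c assume mc: "m \<in> carrier G" "c \<in> carrier C"
      show "ract G m ((f \<otimes>\<^bsub>D\<^esub> g) c) \<in> carrier G"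
        using eval_closed_G[OF fg] mc by simp
      show "ract G m ((f \<otimes>\<^bsub>D\<^esub> g) c) = sweedler G (eval2 G f g m) (Delta_C C c)"
        unfolding dual_mult_apply[OF mc(2)] eval2_def
        by (rule CC.sweedler_apply[OF ag_A ag_G Delta_C_closed[OF mc(2)] G.additive_ract_right[OF mc(1)]])
           (use f g in \<open>simp add: dual_closed C.ract_closed\<close>)
    qed
    also have "\<dots> = sweedler G (\<lambda>m u. sweedler G (eval2 G f g m) u) ?r"
      by (rule right(2)[OF f g, symmetric])
    finally show "sweedler G (\<lambda>m u. sweedler G (eval2 G f g m) u) ?l =
      sweedler G (\<lambda>m u. sweedler G (eval2 G f g m) u) ?r" .
  qed
qed

lemma hc_comodule_G: "hc_comodule k H A C G"
proof (intro hc_comodule.intro hr_module_G hc_comodule_axioms.intro)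
  show "right_linear A G (ract G) (tensor_A H A G C) (ract (tensor_A H A G C)) (rho G)"
    by (auto simp: right_linear_def rho_G_closed rho_G_add rho_G_ract simp del: G_ract)
  show "h_linear H G (tensor_A H A G C) (rho G)"
    by (auto simp: h_linear_def left_linear_def rho_G_closed rho_G_add rho_G_hact)
  fix x assume x: "x \<in> carrier G"
  show "sweedler (tensor_A H A G (tensor_A_bimod H A C C))
      (\<lambda>m0 m1. sweedler (tensor_A H A G (tensor_A_bimod H A C C))
         (\<lambda>m00 m01. pure_A A G (tensor_A_bimod H A C C) m00 (pure_A A C C m01 m1)) (rho G m0))
      (rho G x) =
    sweedler (tensor_A H A G (tensor_A_bimod H A C C))
      (\<lambda>m0 m1. pure_A A G (tensor_A_bimod H A C C) m0 (Delta_C C m1)) (rho G x)"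
    by (rule rho_G_coassoc) (use x in simp)
  \<comment> \<open>The counit is the unit of the dual ring, so the counit law amounts to evaluation
    at that unit.\<close>
  have "sweedler G (\<lambda>m0 m1. ract G m0 (eps_C C m1)) (rho G x) =
    sweedler G (\<lambda>m c. ract G m (\<one>\<^bsub>D\<^esub> c)) (rho G x)"
    by (rule T.sweedler_cong[OF ag_G rho_G_closed])
       (use x G.ract_closed in \<open>auto simp: dual_one_apply eps_C_closed simp del: G_ract\<close>)
  also have "\<dots> = x" using x by (simp add: rho_G_eval dual_one_closed N.ract_one)
  finally show "sweedler G (\<lambda>m0 m1. ract G m0 (eps_C C m1)) (rho G x) = x" .
qed

end

section \<open>The isomorphism of categories\<close>

context hopf_coring
begin

text \<open>The coordinates of the splitting \<open>s\<close> are the functionals, and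
  \<open>p\<close> sends unit vectors to the basis elements. Projectivity provides a possibly
  infinite index set; finite generation leaves finitely many coordinates that are not identically
  zero.\<close>

lemma dual_basis_exists:
  assumes fg: "finitely_generated_left A C" and proj: "projective_left A C"
  obtains J :: "'c set" and e \<phi> where "dual_basis k H A C J e \<phi>"
proof -
  obtain G where G: "finite G" "G \<subseteq> carrier C"
    and gen: "\<And>x. x \<in> carrier C \<Longrightarrow> \<exists>r\<in>G \<rightarrow> carrier A. x = (\<Oplus>\<^bsub>C\<^esub>g\<in>G. lact C (r g) g)"
    using fg unfolding finitely_generated_left_def by blast
  obtain I :: "'c set" and s p
    where s: "left_linear A C (lact C) (free_left_module A I) (smult (free_left_module A I)) s"
      and p: "left_linear A (free_left_module A I) (smult (free_left_module A I)) C (lact C) p"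
      and ps: "\<And>x. x \<in> carrier C \<Longrightarrow> p (s x) = x"
    using proj unfolding projective_left_def by blast
  let ?F = "free_left_module A I"
  define \<delta> where "\<delta> i = (\<lambda>j\<in>I. if j = i then \<one>\<^bsub>A\<^esub> else \<zero>\<^bsub>A\<^esub>)" for i
  define e where "e i = p (\<delta> i)" for i
  define \<phi> where "\<phi> i = (\<lambda>c\<in>carrier C. s c i)" for i
  \<comment> \<open>The coordinates that are nonzero on some generator. By linearity of
    \<open>s\<close> all other coordinates vanish on the whole of \<open>C\<close>.\<close>
  define J where "J = (\<Union>g\<in>G. {i \<in> I. s g i \<noteq> \<zero>\<^bsub>A\<^esub>})"
  have F: "v \<in> carrier ?F \<longleftrightarrow> v \<in> I \<rightarrow>\<^sub>E carrier A \<and> finite {i \<in> I. v i \<noteq> \<zero>\<^bsub>A\<^esub>}" for v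
    by (simp add: free_left_module_def)
  have s_closed: "s c \<in> carrier ?F" if "c \<in> carrier C" for c
    using s that by (auto simp: left_linear_def)
  have s_add: "s (c \<oplus>\<^bsub>C\<^esub> d) i = s c i \<oplus>\<^bsub>A\<^esub> s d i" if "c \<in> carrier C" "d \<in> carrier C" "i \<in> I" for c d i
    using s that by (simp add: left_linear_def free_left_module_def)
  have s_lact: "s (lact C a c) i = a \<otimes>\<^bsub>A\<^esub> s c i" if "a \<in> carrier A" "c \<in> carrier C" "i \<in> I" for a c i
    using s that by (simp add: left_linear_def free_left_module_def)
  have s_apply: "s c i \<in> carrier A" if "c \<in> carrier C" "i \<in> I" for c i
    using s_closed[OF that(1)] that(2) by (auto simp: F)
  have \<delta>_closed: "\<delta> i \<in> carrier ?F" for i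
    by (auto simp: F \<delta>_def intro: finite_subset[of _ "{i}"])
  have e_closed: "e i \<in> carrier C" for i
    using p \<delta>_closed by (auto simp: e_def left_linear_def)
  have J: "finite J" "J \<subseteq> I"
    using G s_closed by (auto simp: J_def F)
  have s_zero: "s c i = \<zero>\<^bsub>A\<^esub>" if c: "c \<in> carrier C" and i: "i \<in> I" "i \<notin> J" for c i
  proof -
    obtain r where r: "r \<in> G \<rightarrow> carrier A" "c = (\<Oplus>\<^bsub>C\<^esub>g\<in>G. lact C (r g) g)"
      using gen[OF c] by blast
    have rG: "r g \<in> carrier A" "g \<in> carrier C" if "g \<in> G" for g
      using r G that by auto
    have "s c i = (\<Oplus>\<^bsub>A\<^esub>g\<in>G. s (lact C (r g) g) i)"
      unfolding r(2)
      by (rule additive_finsum[OF ag_C ag_A _ G(1), of "\<lambda>c. s c i"])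
         (use r G i in \<open>auto intro!: additiveI s_apply s_add C.lact_closed\<close>)
    also have "\<dots> = (\<Oplus>\<^bsub>A\<^esub>g\<in>G. \<zero>\<^bsub>A\<^esub>)"
      by (rule A.M.finsum_cong') (use rG i in \<open>auto simp: s_lact J_def\<close>)
    finally show ?thesis by simp
  qed
  have p_zero: "p \<zero>\<^bsub>?F\<^esub> = \<zero>\<^bsub>C\<^esub>"
  proof -
    have z: "\<zero>\<^bsub>?F\<^esub> \<in> carrier ?F" "\<zero>\<^bsub>?F\<^esub> \<oplus>\<^bsub>?F\<^esub> \<zero>\<^bsub>?F\<^esub> = \<zero>\<^bsub>?F\<^esub>"
      by (auto simp: free_left_module_def fun_eq_iff)
    then have "p \<zero>\<^bsub>?F\<^esub> \<oplus>\<^bsub>C\<^esub> p \<zero>\<^bsub>?F\<^esub> = p \<zero>\<^bsub>?F\<^esub>" "p \<zero>\<^bsub>?F\<^esub> \<in> carrier C"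
      using p unfolding left_linear_def by (metis, auto)
    then show ?thesis by simp
  qed
  \<comment> \<open>Induction on a finite set containing the support of \<open>v\<close>: in the
    step \<open>w\<close> is \<open>v\<close> with coordinate \<open>i\<close> deleted, so
    \<open>v\<close> is \<open>w\<close> plus \<open>v i\<close> times the unit vector
    \<open>\<delta> i\<close>.\<close>
  have p_expand: "p v = (\<Oplus>\<^bsub>C\<^esub>i\<in>K. lact C (v i) (e i))"
    if "finite K" "K \<subseteq> I" "v \<in> carrier ?F" "\<And>i. i \<in> I - K \<Longrightarrow> v i = \<zero>\<^bsub>A\<^esub>" for K v
    using that
  proof (induction K arbitrary: v rule: finite_induct)
    case empty
    then have "v = \<zero>\<^bsub>?F\<^esub>"
      by (auto simp: F free_left_module_def fun_eq_iff PiE_def extensional_def)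
    then show ?case by (simp add: p_zero)
  next
    case (insert i K)
    have v: "v \<in> I \<rightarrow>\<^sub>E carrier A" and i: "i \<in> I" using insert.prems by (auto simp: F)
    define w where "w = v(i := \<zero>\<^bsub>A\<^esub>)"
    have w: "w \<in> carrier ?F"
      using insert.prems(2) i
      by (auto simp: F w_def PiE_iff extensional_def intro: finite_subset[of _ "{i \<in> I. v i \<noteq> \<zero>\<^bsub>A\<^esub>}"])
    have vi: "v i \<in> carrier A" using v i by auto
    have va: "smult ?F (v i) (\<delta> i) \<in> carrier ?F"
      using vi by (auto simp: free_left_module_def \<delta>_def intro: finite_subset[of _ "{i}"])
    have "v = w \<oplus>\<^bsub>?F\<^esub> smult ?F (v i) (\<delta> i)"
    proof
      fix j
      show "v j = (w \<oplus>\<^bsub>?F\<^esub> smult ?F (v i) (\<delta> i)) j"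
        using v vi i by (cases "j \<in> I") (auto simp: free_left_module_def w_def \<delta>_def PiE_iff extensional_def)
    qed
    then have "p v = p (w \<oplus>\<^bsub>?F\<^esub> smult ?F (v i) (\<delta> i))" by simp
    also have "\<dots> = p w \<oplus>\<^bsub>C\<^esub> lact C (v i) (e i)"
      using p w va vi \<delta>_closed by (simp add: left_linear_def e_def)
    also have "p w = (\<Oplus>\<^bsub>C\<^esub>j\<in>K. lact C (w j) (e j))"
      by (rule insert.IH[OF _ w]) (use insert.prems in \<open>auto simp: w_def\<close>)
    also have "\<dots> = (\<Oplus>\<^bsub>C\<^esub>j\<in>K. lact C (v j) (e j))"
      by (rule C.M.finsum_cong')
         (use insert v in \<open>auto simp: w_def intro!: C.lact_closed e_closed\<close>)
    also have "(\<Oplus>\<^bsub>C\<^esub>j\<in>K. lact C (v j) (e j)) \<oplus>\<^bsub>C\<^esub> lact C (v i) (e i) =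
      (\<Oplus>\<^bsub>C\<^esub>j\<in>insert i K. lact C (v j) (e j))"
    proof -
      have c: "(\<lambda>j. lact C (v j) (e j)) \<in> K \<rightarrow> carrier C" "lact C (v i) (e i) \<in> carrier C"
        using insert.prems v vi by (auto intro!: C.lact_closed e_closed)
      show ?thesis
        using insert.hyps c by (simp add: C.M.finsum_closed C.M.a_comm)
    qed
    finally show ?case .
  qed
  have "dual_basis k H A C J e \<phi>"
  proof
    fix j assume j: "j \<in> J"
    show "e j \<in> carrier C" by (rule e_closed)
    have "j \<in> I" using j J by auto
    then show "\<phi> j \<in> carrier D"
      by (intro dualI) (auto simp: \<phi>_def s_apply s_add s_lact C.lact_closed)
  next
    fix c assume c: "c \<in> carrier C"
    have "c = p (s c)" using ps[OF c] by simp
    also have "\<dots> = (\<Oplus>\<^bsub>C\<^esub>j\<in>J. lact C (s c j) (e j))"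
      by (rule p_expand) (use J c s_closed s_zero in auto)
    finally show "c = (\<Oplus>\<^bsub>C\<^esub>j\<in>J. lact C (\<phi> j c) (e j))" using c by (simp add: \<phi>_def)
  qed (rule J)
  then show thesis by (rule that)
qed

end

text \<open>Morphisms are extensional functions, so the unit laws hold as equations of functions and
  not merely on carriers.\<close>

lemma category_concrete:
  assumes "\<And>X. X \<in> Q \<Longrightarrow> (\<lambda>x\<in>carrier X. x) \<in> P X X"
    and "\<And>X Y Z f g. \<lbrakk>X \<in> Q; Y \<in> Q; Z \<in> Q; f \<in> P X Y; g \<in> P Y Z\<rbrakk> \<Longrightarrow> compose (carrier X) g f \<in> P X Z"
    and P: "\<And>X Y f. f \<in> P X Y \<Longrightarrow> f \<in> extensional (carrier X) \<inter> (carrier X \<rightarrow> carrier Y)"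
  shows "category \<lparr>Ob = Q, Hom = P, Id = (\<lambda>M. \<lambda>x\<in>carrier M. x),
    Comp = (\<lambda>L M N g f. compose (carrier L) g f)\<rparr>"
proof (unfold_locales, simp_all add: assms(1,2))
  fix X Y f assume "f \<in> P X Y"
  from P[OF this]
  show "compose (carrier X) f (\<lambda>x\<in>carrier X. x) = f" "compose (carrier X) (\<lambda>x\<in>carrier Y. x) f = f"
    by (auto simp: compose_def extensional_def fun_eq_iff)
next
  fix W X Y Z f g h assume "f \<in> P W X"
  from P[OF this] show "compose (carrier W) (compose (carrier X) h g) f =
      compose (carrier W) h (compose (carrier W) g f)"
    by (auto simp: compose_def fun_eq_iff)
qed

lemma category_mod_cat: "category (mod_cat k H R :: (('k, 'h, 'r, 'm) hrmod, 'm \<Rightarrow> 'm) cat)"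
  unfolding mod_cat_def
proof (rule category_concrete)
  fix X :: "('k, 'h, 'r, 'm) hrmod"
  assume "X \<in> {M. hr_module k H R M \<and> normalised k H R M}"
  then interpret X: hr_module k H R X by simp
  show "(\<lambda>x\<in>carrier X. x) \<in> {f \<in> extensional (carrier X).
      right_linear R X (ract X) X (ract X) f \<and> h_linear H X X f}"
    by (auto simp: right_linear_def h_linear_def left_linear_def X.ract_closed X.hact_closed)
  fix Y Z :: "('k, 'h, 'r, 'm) hrmod" and f g
  assume "f \<in> {f \<in> extensional (carrier X). right_linear R X (ract X) Y (ract Y) f \<and> h_linear H X Y f}"
    "g \<in> {f \<in> extensional (carrier Y). right_linear R Y (ract Y) Z (ract Z) f \<and> h_linear H Y Z f}"
  then show "compose (carrier X) g f \<in> {f \<in> extensional (carrier X).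
      right_linear R X (ract X) Z (ract Z) f \<and> h_linear H X Z f}"
    by (auto simp: right_linear_def h_linear_def left_linear_def compose_def
        X.ract_closed X.hact_closed Pi_iff)
qed (auto simp: right_linear_def)

section \<open>The functor from comodules to modules\<close>

context hopf_coring
begin

lemma comodule_locale: "hc_comodule k H A C M \<Longrightarrow> hopf_coring_comodule k H A C M"
  by (intro hopf_coring_comodule.intro hopf_coring_axioms)

text \<open>This is what makes \<open>f \<otimes> C\<close> well defined on the tensor
  product.\<close>

lemma balanced_pure_map:
  assumes M: "right_module k A M" and N: "right_module k A N"
    and f: "right_linear A M (ract M) N (ract N) f"
  shows "balanced A M (ract M) C (lact C) (tensor_A H A N C) (\<lambda>m c. pure_A A N C (f m) c)"
proof -
  interpret M: right_module k A M by fact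
  interpret N: right_module k A N by fact
  interpret T: tensor_product A N "ract N" C "lact C" by (rule tensor_product_C) (rule N)
  show ?thesis
    using f
    by (intro balancedI additiveI)
       (auto simp: right_linear_def T.pure_closed T.pure_add_left T.pure_add_right T.pure_balance Pi_iff)
qed

lemma sweedler_pure_map:
  assumes M: "right_module k A M" and N: "right_module k A N"
    and f: "right_linear A M (ract M) N (ract N) f"
    and t: "t \<in> carrier (tensor_group A M (ract M) C (lact C))"
  shows "sweedler (tensor_A H A N C) (\<lambda>m c. pure_A A N C (f m) c) t
      \<in> carrier (tensor_group A N (ract N) C (lact C))"
    and "abelian_group X \<Longrightarrow> balanced A N (ract N) C (lact C) X b \<Longrightarrow>
      sweedler X b (sweedler (tensor_A H A N C) (\<lambda>m c. pure_A A N C (f m) c) t) =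
      sweedler X (\<lambda>m c. b (f m) c) t"
proof -
  interpret M: right_module k A M by fact
  interpret N: right_module k A N by fact
  interpret TM: tensor_product A M "ract M" C "lact C" by (rule tensor_product_C) (rule M)
  interpret T: tensor_product A N "ract N" C "lact C" by (rule tensor_product_C) (rule N)
  have fc: "f m \<in> carrier N" if "m \<in> carrier M" for m using f that by (auto simp: right_linear_def)
  have ag: "abelian_group (tensor_A H A N C)"
    by (rule abelian_group_cong[OF T.T_abelian_group]) auto
  have "sweedler (tensor_A H A N C) (\<lambda>m c. T.pure (f m) c) t \<in> carrier (tensor_A H A N C)"
    by (rule TM.sweedler_closed[OF ag t]) (simp add: T.pure_closed fc)
  then show "sweedler (tensor_A H A N C) (\<lambda>m c. T.pure (f m) c) t \<in> carrier T.T" by simp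
  assume "abelian_group X" "balanced A N (ract N) C (lact C) X b"
  then show "sweedler X b (sweedler (tensor_A H A N C) (\<lambda>m c. T.pure (f m) c) t) =
      sweedler X (\<lambda>m c. b (f m) c) t"
    by (rule T.sweedler_sweedler_pure[OF _ _ _ _ _ TM.tensor_product_axioms t]) (auto simp: fc)
qed

lemma colinear_id:
  assumes "hc_comodule k H A C M"
  shows "colinear H A C M M (\<lambda>x\<in>carrier M. x)"
proof -
  interpret hopf_coring_comodule k H A C M by (rule comodule_locale) fact
  interpret T: tensor_product A M "ract M" C "lact C"
    by (rule tensor_product_C) (rule M.right_module_axioms)
  have ag: "abelian_group (tensor_A H A M C)"
    by (rule abelian_group_cong[OF T.T_abelian_group]) auto
  show ?thesis
    unfolding colinear_def
  proof
    fix x assume x: "x \<in> carrier M"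
    have "sweedler (tensor_A H A M C) (\<lambda>m0. T.pure ((\<lambda>x\<in>carrier M. x) m0)) (rho M x) =
      sweedler (tensor_A H A M C) T.pure (rho M x)"
      by (rule T.sweedler_cong[OF ag rho_closed[OF x]]) (auto simp: T.pure_closed)
    also have "\<dots> = sweedler T.T T.pure (rho M x)"
      by (rule T.sweedler_target[OF T.T_abelian_group _ _ _ rho_closed[OF x]]) (auto simp: T.pure_closed)
    also have "\<dots> = rho M x" by (rule T.sweedler_pure_self[OF rho_closed[OF x]])
    finally show "rho M ((\<lambda>x\<in>carrier M. x) x) =
        sweedler (tensor_A H A M C) (\<lambda>m0. T.pure ((\<lambda>x\<in>carrier M. x) m0)) (rho M x)"
      using x by simp
  qed
qed

text \<open>\<open>f \<otimes> C\<close> followed by \<open>g \<otimes> C\<close> is computed by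
  evaluating the balanced map of \<open>g\<close> on a tensor given by the sum for
  \<open>f\<close>.\<close>

lemma colinear_compose:
  assumes L: "hc_comodule k H A C L" and M: "hc_comodule k H A C M" and N: "hc_comodule k H A C N"
    and f: "right_linear A L (ract L) M (ract M) f" "colinear H A C L M f"
    and g: "right_linear A M (ract M) N (ract N) g" "colinear H A C M N g"
  shows "colinear H A C L N (compose (carrier L) g f)"
proof -
  interpret L: hopf_coring_comodule k H A C L by (rule comodule_locale) fact
  interpret M: hopf_coring_comodule k H A C M by (rule comodule_locale) fact
  interpret N: hopf_coring_comodule k H A C N by (rule comodule_locale) fact
  note rL = L.M.right_module_axioms and rM = M.M.right_module_axioms and rN = N.M.right_module_axioms
  interpret T: tensor_product A N "ract N" C "lact C" by (rule tensor_product_C) (rule rN)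
  interpret TL: tensor_product A L "ract L" C "lact C" by (rule tensor_product_C) (rule rL)
  have ag: "abelian_group (tensor_A H A N C)"
    by (rule abelian_group_cong[OF T.T_abelian_group]) auto
  have fc: "f m \<in> carrier M" if "m \<in> carrier L" for m using f that by (auto simp: right_linear_def)
  have gc: "g m \<in> carrier N" if "m \<in> carrier M" for m using g that by (auto simp: right_linear_def)
  show ?thesis
    unfolding colinear_def
  proof
    fix x assume x: "x \<in> carrier L"
    have "rho N (compose (carrier L) g f x) =
      sweedler (tensor_A H A N C) (\<lambda>m c. T.pure (g m) c) (rho M (f x))"
      using g(2) x fc by (simp add: compose_def colinear_def)
    also have "\<dots> = sweedler (tensor_A H A N C) (\<lambda>m c. T.pure (g m) c)
        (sweedler (tensor_A H A M C) (\<lambda>m c. pure_A A M C (f m) c) (rho L x))"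
      using f(2) x by (simp add: colinear_def)
    also have "\<dots> = sweedler (tensor_A H A N C) (\<lambda>m c. T.pure (g (f m)) c) (rho L x)"
      by (rule sweedler_pure_map(2)[OF rL rM f(1) L.rho_closed[OF x] ag balanced_pure_map[OF rM rN g(1)]])
    also have "\<dots> = sweedler (tensor_A H A N C) (\<lambda>m0 m1. T.pure (compose (carrier L) g f m0) m1) (rho L x)"
      by (rule TL.sweedler_cong[OF ag L.rho_closed[OF x]])
         (auto simp: compose_def T.pure_closed fc gc)
    finally show "rho N (compose (carrier L) g f x) =
      sweedler (tensor_A H A N C) (\<lambda>m0 m1. T.pure (compose (carrier L) g f m0) m1) (rho L x)" .
  qed
qed

lemma category_comod_cat: "category (comod_cat k H A C :: (('k, 'h, 'a, 'c, 'm) comod, 'm \<Rightarrow> 'm) cat)"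
  unfolding comod_cat_def
proof (rule category_concrete)
  let ?O = "{M. hc_comodule k H A C M \<and> normalised k H A M \<and> rho M \<in> extensional (carrier M)}"
  let ?M = "\<lambda>M N. {f \<in> extensional (carrier M).
    right_linear A M (ract M) N (ract N) f \<and> h_linear H M N f \<and> colinear H A C M N f}"
  fix X :: "('k, 'h, 'a, 'c, 'm) comod"
  assume X: "X \<in> ?O"
  then interpret X: hc_comodule k H A C X by simp
  show "(\<lambda>x\<in>carrier X. x) \<in> ?M X X"
    using colinear_id[OF X.hc_comodule_axioms]
    by (auto simp: right_linear_def h_linear_def left_linear_def X.ract_closed X.hact_closed)
  fix Y Z :: "('k, 'h, 'a, 'c, 'm) comod" and f g
  assume o: "Y \<in> ?O" "Z \<in> ?O" "f \<in> ?M X Y" "g \<in> ?M Y Z"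
  have "colinear H A C X Z (compose (carrier X) g f)"
    by (rule colinear_compose[where M = Y]) (use X o in auto)
  then show "compose (carrier X) g f \<in> ?M X Z"
    using o(3,4)
    by (auto simp: right_linear_def h_linear_def left_linear_def compose_def
        X.ract_closed X.hact_closed Pi_iff)
qed (auto simp: right_linear_def)

lemma normalised_comod_to_mod:
  assumes "hc_comodule k H A C M" "normalised k H A M"
  shows "normalised k H D (comod_to_mod H A C M)"
proof -
  interpret hopf_coring_comodule k H A C M by (rule comodule_locale) fact
  show ?thesis
    using assms(2) dact_closed by (auto simp: normalised_def comod_to_mod_def dact_def[symmetric])
qed

text \<open>\<open>f(m0 q(m1)) = f(m0) q(m1)\<close> by \<open>A\<close>-linearity, and colinearity
  identifies \<open>f(m0) \<otimes> m1\<close> with the coaction of \<open>f x\<close>.\<close>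

lemma comod_to_mod_linear:
  assumes M: "hc_comodule k H A C M" and N: "hc_comodule k H A C N"
    and f: "right_linear A M (ract M) N (ract N) f" "colinear H A C M N f"
  shows "right_linear D (comod_to_mod H A C M) (ract (comod_to_mod H A C M))
    (comod_to_mod H A C N) (ract (comod_to_mod H A C N)) f"
proof -
  interpret M: hopf_coring_comodule k H A C M by (rule comodule_locale) fact
  interpret N: hopf_coring_comodule k H A C N by (rule comodule_locale) fact
  note rM = M.M.right_module_axioms and rN = N.M.right_module_axioms
  interpret TM: tensor_product A M "ract M" C "lact C" by (rule tensor_product_C) (rule rM)
  have fc: "f m \<in> carrier N" if "m \<in> carrier M" for m using f that by (auto simp: right_linear_def)
  have fa: "additive M N f" using f by (simp add: right_linear_def additive_def)
  have "f (M.dact x q) = N.dact (f x) q" if x: "x \<in> carrier M" and q: "q \<in> carrier D" for x q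
  proof -
    have "f (M.dact x q) = sweedler N (\<lambda>m c. f (ract M m (q c))) (rho M x)"
      unfolding M.dact_def
      by (rule TM.sweedler_apply[OF M.ag_M N.ag_M M.rho_closed[OF x] fa]) (rule M.eval_closed[OF q])
    also have "\<dots> = sweedler N (\<lambda>m c. ract N (f m) (q c)) (rho M x)"
      by (rule TM.sweedler_cong[OF N.ag_M M.rho_closed[OF x]])
         (use f(1) q fc M.eval_closed[OF q] N.eval_closed[OF q] in \<open>auto simp: right_linear_def dual_closed\<close>)
    also have "\<dots> = N.dact (f x) q"
      using sweedler_pure_map(2)[OF rM rN f(1) M.rho_closed[OF x] N.ag_M balanced_eval[OF rN q]] f(2) x
      by (simp add: N.dact_def colinear_def)
    finally show ?thesis .
  qed
  then show ?thesis using f(1) fc by (auto simp: right_linear_def)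
qed

lemma functor_comod_to_mod:
  "cat_functor
     (comod_cat k H A C :: (('k, 'h, 'a, 'c, 'm) comod, 'm \<Rightarrow> 'm) cat)
     (mod_cat k H D :: (('k, 'h, 'c \<Rightarrow> 'a, 'm) hrmod, 'm \<Rightarrow> 'm) cat)
     (comod_to_mod H A C) (\<lambda>M N f. f)"
proof (intro cat_functor.intro category_mod_cat category_comod_cat cat_functor_axioms.intro)
  fix X :: "('k, 'h, 'a, 'c, 'm) comod" assume "X \<in> Ob (comod_cat k H A C)"
  then have X: "hc_comodule k H A C X" "normalised k H A X" by (auto simp: comod_cat_def)
  show "comod_to_mod H A C X \<in> Ob (mod_cat k H D)"
    using hopf_coring_comodule.hr_module_FM[OF comodule_locale[OF X(1)]] normalised_comod_to_mod[OF X]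
    by (simp add: mod_cat_def)
next
  fix X Y :: "('k, 'h, 'a, 'c, 'm) comod" and f
  assume "X \<in> Ob (comod_cat k H A C)" "Y \<in> Ob (comod_cat k H A C)" "f \<in> Hom (comod_cat k H A C) X Y"
  then show "f \<in> Hom (mod_cat k H D) (comod_to_mod H A C X) (comod_to_mod H A C Y)"
    using comod_to_mod_linear[of X Y f]
    by (auto simp: comod_cat_def mod_cat_def h_linear_def left_linear_def comod_to_mod_def)
qed (simp_all add: comod_cat_def mod_cat_def comod_to_mod_def)

end

section \<open>The inverse functor and the two round trips\<close>

context dual_basis
begin

lemma module_locale: "hr_module k H D N \<Longrightarrow> dual_module k H A C J e \<phi> N"
  by (intro dual_module.intro dual_basis_axioms)

lemma normalised_mod_to_comod:
  assumes "hr_module k H D N" "normalised k H D N"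
  shows "normalised k H A (mod_to_comod N)"
proof -
  interpret dual_module k H A C J e \<phi> N by (rule module_locale) fact
  show ?thesis
    using assms(2) N.ract_closed iota_closed by (auto simp: normalised_def mod_to_comod_def Let_def)
qed

text \<open>\<open>A\<close>-linearity is linearity over the dual ring at elements
  \<open>iota a\<close>. Colinearity is tested by evaluating at each \<open>q\<close>, where it
  reads \<open>f(x q) = f(x) q\<close>.\<close>

lemma mod_to_comod_linear:
  assumes M: "hr_module k H D M" and N: "hr_module k H D N"
    and f: "right_linear D M (ract M) N (ract N) f"
  shows "right_linear A (mod_to_comod M) (ract (mod_to_comod M)) (mod_to_comod N) (ract (mod_to_comod N)) f"
    and "colinear H A C (mod_to_comod M) (mod_to_comod N) f"
proof -
  interpret M: dual_module k H A C J e \<phi> M by (rule module_locale) fact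
  interpret N: dual_module k H A C J e \<phi> N by (rule module_locale) fact
  note rM = M.G.right_module_axioms and rN = N.G.right_module_axioms
  interpret TM: tensor_product A M.G "ract M.G" C "lact C" by (rule tensor_product_C) (rule rM)
  have fc: "f m \<in> carrier N" if "m \<in> carrier M" for m using f that by (auto simp: right_linear_def)
  show l: "right_linear A M.G (ract M.G) N.G (ract N.G) f"
    using f iota_closed fc by (auto simp: right_linear_def)
  have fa: "additive M.G N.G f" using f by (simp add: right_linear_def additive_def)
  show "colinear H A C M.G N.G f"
    unfolding colinear_def
  proof
    fix x assume "x \<in> carrier M.G"
    then have x: "x \<in> carrier M" by simp
    show "rho N.G (f x) = sweedler (tensor_A H A N.G C) (\<lambda>m0 m1. pure_A A N.G C (f m0) m1) (rho M.G x)"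
    proof (rule N.rho_G_eqI)
      fix q assume q: "q \<in> carrier D"
      have "sweedler N.G (\<lambda>m c. ract N.G m (q c))
          (sweedler (tensor_A H A N.G C) (\<lambda>m0 m1. pure_A A N.G C (f m0) m1) (rho M.G x)) =
        sweedler N.G (\<lambda>m c. ract N.G (f m) (q c)) (rho M.G x)"
        by (rule sweedler_pure_map(2)[OF rM rN l M.rho_G_closed[OF x] N.ag_G balanced_eval[OF rN q]])
      also have "\<dots> = sweedler N.G (\<lambda>m c. f (ract M.G m (q c))) (rho M.G x)"
        by (rule TM.sweedler_cong[OF N.ag_G M.rho_G_closed[OF x]])
           (use l q fc N.eval_closed_G[OF q] in \<open>auto simp: right_linear_def dual_closed\<close>)
      also have "\<dots> = f (sweedler M.G (\<lambda>m c. ract M.G m (q c)) (rho M.G x))"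
        by (rule TM.sweedler_apply[OF M.ag_G N.ag_G M.rho_G_closed[OF x] fa, symmetric])
           (use M.eval_closed_G[OF q] in auto)
      also have "\<dots> = ract N (f x) q"
        using f x q by (simp add: M.rho_G_eval right_linear_def)
      finally show "sweedler N.G (\<lambda>m c. ract N.G m (q c)) (rho N.G (f x)) =
          sweedler N.G (\<lambda>m c. ract N.G m (q c))
          (sweedler (tensor_A H A N.G C) (\<lambda>m0 m1. pure_A A N.G C (f m0) m1) (rho M.G x))"
        using x q fc by (simp add: N.rho_G_eval)
    qed (use x fc N.rho_G_closed sweedler_pure_map(1)[OF rM rN l M.rho_G_closed[OF x]] in auto)
  qed
qed

lemma functor_mod_to_comod:
  "cat_functor
     (mod_cat k H D :: (('k, 'h, 'c \<Rightarrow> 'a, 'm) hrmod, 'm \<Rightarrow> 'm) cat)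
     (comod_cat k H A C :: (('k, 'h, 'a, 'c, 'm) comod, 'm \<Rightarrow> 'm) cat)
     mod_to_comod (\<lambda>M N f. f)"
proof (intro cat_functor.intro category_mod_cat category_comod_cat cat_functor_axioms.intro)
  fix X :: "('k, 'h, 'c \<Rightarrow> 'a, 'm) hrmod" assume "X \<in> Ob (mod_cat k H D)"
  then have X: "hr_module k H D X" "normalised k H D X" by (auto simp: mod_cat_def)
  have "rho (mod_to_comod X) \<in> extensional (carrier (mod_to_comod X))"
    by (simp add: mod_to_comod_def Let_def)
  then show "mod_to_comod X \<in> Ob (comod_cat k H A C)"
    using dual_module.hc_comodule_G[OF module_locale[OF X(1)]] normalised_mod_to_comod[OF X]
    by (simp add: comod_cat_def)
next
  fix X Y :: "('k, 'h, 'c \<Rightarrow> 'a, 'm) hrmod" and f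
  assume "X \<in> Ob (mod_cat k H D)" "Y \<in> Ob (mod_cat k H D)" "f \<in> Hom (mod_cat k H D) X Y"
  then show "f \<in> Hom (comod_cat k H A C) (mod_to_comod X) (mod_to_comod Y)"
    using mod_to_comod_linear[of X Y f]
    by (auto simp: comod_cat_def mod_cat_def h_linear_def left_linear_def mod_to_comod_def Let_def)
qed (simp_all add: comod_cat_def mod_cat_def mod_to_comod_def Let_def)

text \<open>On the carriers the actions agree by \<open>rho_G_eval\<close>. Record equality compares
  them elsewhere too, where normalisation makes both undefined.\<close>

lemma mod_to_comod_to_mod:
  assumes N: "hr_module k H D N" and n: "normalised k H D N"
  shows "comod_to_mod H A C (mod_to_comod N) = N"
proof -
  interpret dual_module k H A C J e \<phi> N by (rule module_locale) fact
  have r: "ract N \<in> carrier N \<rightarrow>\<^sub>E carrier D \<rightarrow>\<^sub>E carrier N"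
    using n by (simp add: normalised_def)
  have "ract (comod_to_mod H A C G) x f = ract N x f" for x f
  proof (cases "x \<in> carrier N")
    case x: True
    then have "ract N x \<in> carrier D \<rightarrow>\<^sub>E carrier N" using r by auto
    then show ?thesis
      using x rho_G_eval[OF x, of f]
      by (cases "f \<in> carrier D") (auto simp: comod_to_mod_def PiE_def extensional_def)
  next
    case False
    then show ?thesis using r by (simp add: comod_to_mod_def PiE_def extensional_def)
  qed
  then have "ract (comod_to_mod H A C G) = ract N" by blast
  then show ?thesis
    by (intro hrmod.equality) (simp_all add: comod_to_mod_def)
qed

text \<open>\<open>dact_iota\<close> returns the \<open>A\<close>-action and
  \<open>tensor_expand\<close> the coaction; off the carriers both are fixed by normalisation and
  extensionality.\<close>

lemma comod_to_mod_to_comod: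
  assumes M: "hc_comodule k H A C M" and n: "normalised k H A M" and \<rho>: "rho M \<in> extensional (carrier M)"
  shows "mod_to_comod (comod_to_mod H A C M) = M"
proof -
  interpret hopf_coring_comodule k H A C M by (rule comodule_locale) fact
  interpret N: dual_module k H A C J e \<phi> FM by (rule module_locale) (rule hr_module_FM)
  have r: "ract M \<in> carrier M \<rightarrow>\<^sub>E carrier A \<rightarrow>\<^sub>E carrier M"
    using n by (simp add: normalised_def)
  have ract: "ract N.G = ract M"
  proof (intro ext)
    fix x a
    show "ract N.G x a = ract M x a"
    proof (cases "x \<in> carrier M")
      case x: True
      then have "ract M x \<in> carrier A \<rightarrow>\<^sub>E carrier M" using r by auto
      then show ?thesis
        using x by (cases "a \<in> carrier A")
          (auto simp: mod_to_comod_def Let_def iota_closed dact_iota PiE_def extensional_def)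
    next
      case False
      then show ?thesis using r by (simp add: mod_to_comod_def Let_def PiE_def extensional_def)
    qed
  qed
  have "rho N.G x = rho M x" for x
  proof (cases "x \<in> carrier M")
    case x: True
    have T: "tensor_group A N.G (ract M) C (lact C) = tensor_group A M (ract M) C (lact C)"
      "pure_tensor A N.G (ract M) C (lact C) = pure_tensor A M (ract M) C (lact C)"
      by (rule tensor_group_cong_left pure_tensor_cong_left; simp)+
    interpret T: tensor_product A M "ract M" C "lact C"
      by (rule tensor_product_C) (rule M.right_module_axioms)
    interpret TT: abelian_group T.T by (rule T.T_abelian_group)
    have "rho N.G x = (\<Oplus>\<^bsub>T.T\<^esub>j\<in>J. T.pure (ract FM x (\<phi> j)) (e j))"
      using N.G_rho[of x] x by (simp add: ract T)
    also have "\<dots> = (\<Oplus>\<^bsub>T.T\<^esub>j\<in>J. T.pure (dact x (\<phi> j)) (e j))"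
      by (rule TT.finsum_cong') (auto simp: x \<phi>_closed T.pure_closed dact_closed e_closed)
    also have "\<dots> = rho M x"
      unfolding dact_def by (rule tensor_expand[OF M.right_module_axioms rho_closed[OF x], symmetric])
    finally show ?thesis .
  next
    case False
    then show ?thesis using \<rho> by (simp add: mod_to_comod_def Let_def extensional_def)
  qed
  then have rho: "rho N.G = rho M" by blast
  show ?thesis
    by (rule comod.equality) (simp_all add: ract rho)
qed

lemma isomorphism_comod_mod:
  "cat_isomorphism
     (comod_cat k H A C :: (('k, 'h, 'a, 'c, 'm) comod, 'm \<Rightarrow> 'm) cat)
     (mod_cat k H D :: (('k, 'h, 'c \<Rightarrow> 'a, 'm) hrmod, 'm \<Rightarrow> 'm) cat)
     (comod_to_mod H A C) (\<lambda>M N f. f)"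
  unfolding cat_isomorphism_def
proof (intro conjI functor_comod_to_mod exI)
  show "cat_functor (mod_cat k H D :: (('k, 'h, 'c \<Rightarrow> 'a, 'm) hrmod, 'm \<Rightarrow> 'm) cat)
    (comod_cat k H A C) mod_to_comod (\<lambda>M N f. f)"
    by (rule functor_mod_to_comod)
qed (auto simp: comod_cat_def mod_cat_def comod_to_mod_to_comod mod_to_comod_to_mod)

end

theorem lemma2p11:
  fixes k :: "'k ring"
    and H :: "('k, 'h) hopf"
    and A :: "('k, 'h, 'a) hmod"
    and C :: "('k, 'h, 'a, 'c) coring"
  assumes "hopf_algebra k H"
    and "bij_betw (S_H H) (carrier H) (carrier H)"
    and "h_module_algebra k H A"
    and "ha_coring k H A C"
  shows "cat_functor
           (comod_cat k H A C :: (('k, 'h, 'a, 'c, 'm) comod, 'm \<Rightarrow> 'm) cat)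
           (mod_cat k H (left_dual H A C) :: (('k, 'h, 'c \<Rightarrow> 'a, 'm) hrmod, 'm \<Rightarrow> 'm) cat)
           (comod_to_mod H A C) (\<lambda>M N f. f) \<and>
         (finitely_generated_left A C \<and> projective_left A C \<longrightarrow>
           cat_isomorphism
             (comod_cat k H A C :: (('k, 'h, 'a, 'c, 'm) comod, 'm \<Rightarrow> 'm) cat)
             (mod_cat k H (left_dual H A C) :: (('k, 'h, 'c \<Rightarrow> 'a, 'm) hrmod, 'm \<Rightarrow> 'm) cat)
             (comod_to_mod H A C) (\<lambda>M N f. f))"
proof -
  interpret hopf_coring k H A C
    by (intro hopf_coring.intro hopf_bijective.intro hopf_bijective_axioms.intro assms)
  show ?thesis
    using functor_comod_to_mod dual_basis_exists dual_basis.isomorphism_comod_mod by metis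
qed

end
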